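(* The following data, with all details as in the context, form a bicategory $\mathbf{entw}$: the 0-cells are the entwinings $(R,A,C,\psi)$ over variable rings $R$; the 1-cells $(R,A,C,\psi)\to(S,B,D,\chi)$ are the triples $(M,\alpha,\gamma)$ consisting of an $S$-$R$-bimodule $M$ and two $S$-$R$-bimodule maps $\alpha: B\otimes_S M\to M\otimes_R A$ and $\gamma: D\otimes_S M\to M\otimes_R C$ satisfying the hexagon, the two pentagons and the two (co)unit triangles; the 2-cells $(M,\alpha,\gamma)\Rightarrow(N,\beta,\delta)$ are the $S$-$R$-bimodule maps $\theta:M\to N$ satisfying the two compatibility squares; the composition of 1-cells is $$(P,\sigma,\tau)\circ(M,\alpha,\gamma)=\bigl(P\otimes_S M,\ (P\otimes_S\alpha)\circ(\sigma\otimes_S M),\ (P\otimes_S\gamma)\circ(\tau\otimes_S M)\bigr);$$ the horizontal and vertical compositions of 2-cells are those of the underlying bimodule maps; and the coherence isomorphisms are those of the bicategory of rings and bimodules.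
   Context: The result holds in either of two settings: (i) all ground rings $R,S,\dots$ are commutative unital rings, $A$ is an $R$-algebra and $C$ is an $R$-coalgebra; (ii) ground rings are arbitrary (not necessarily commutative) unital rings, $A$ is an $R$-ring (a monoid in the monoidal category of $R$-$R$-bimodules) and $C$ is an $R$-coring (a comonoid in that category). The ground ring is allowed to vary. Associativity and unit isomorphisms of tensor products of bimodules are suppressed from the formulas, and an object's name also denotes its identity map. Structure maps: $\mu^A:A\otimes_R A\to A$, $\eta^A:R\to A$, $\Delta^C:C\to C\otimes_R C$, $\epsilon^C:C\to R$. Entwining (0-cell): $(R,A,C,\psi)$ with $A$ an $R$-algebra and $C$ an $R$-coalgebra in setting (i), respectively $A$ an $R$-ring and $C$ an $R$-coring in setting (ii), and $\psi:C\otimes_R A\to A\otimes_R C$ an $R$-$R$-bimodule map (not necessarily invertible) such that - $\psi\circ(C\otimes\mu^A)=(\mu^A\otimes C)\circ(A\otimes\psi)\circ(\psi\otimes A)$, - $\psi\circ(C\otimes\eta^A)=\eta^A\otimes C$, - $(A\otimes\Delta^C)\circ\psi=(\psi\otimes C)\circ(C\otimes\psi)\circ(\Delta^C\otimes A)$, - $(A\otimes\epsilon^C)\circ\psi=\epsilon^C\otimes A$. 1-cell $(M,\alpha,\gamma):(R,A,C,\psi)\to(S,B,D,\chi)$: an $S$-$R$-bimodule $M$ with $S$-$R$-bimodule maps $\alpha:B\otimes_S M\to M\otimes_R A$ and $\gamma:D\otimes_S M\to M\otimes_R C$ such that - (hexagon) $(M\otimes\psi)\circ(\gamma\otimes A)\circ(D\otimes\alpha)=(\alpha\otimes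 C)\circ(B\otimes\gamma)\circ(\chi\otimes M)$ as maps $D\otimes_S B\otimes_S M\to M\otimes_R A\otimes_R C$, - (pentagon for $\alpha$) $\alpha\circ(\mu^B\otimes M)=(M\otimes\mu^A)\circ(\alpha\otimes A)\circ(B\otimes\alpha)$, - (pentagon for $\gamma$) $(M\otimes\Delta^C)\circ\gamma=(\gamma\otimes C)\circ(D\otimes\gamma)\circ(\Delta^D\otimes M)$, - (triangles) $\alpha\circ(\eta^B\otimes M)=M\otimes\eta^A$ and $(M\otimes\epsilon^C)\circ\gamma=\epsilon^D\otimes M$. 2-cell $\theta:(M,\alpha,\gamma)\Rightarrow(N,\beta,\delta)$ between 1-cells $(R,A,C,\psi)\to(S,B,D,\chi)$: an $S$-$R$-bimodule map $\theta:M\to N$ with $(\theta\otimes A)\circ\alpha=\beta\circ(B\otimes\theta)$ and $(\theta\otimes C)\circ\gamma=\delta\circ(D\otimes\theta)$. Composition of 1-cells is for $(M,\alpha,\gamma):(R,A,C,\psi)\to(S,B,D,\chi)$ and $(P,\sigma,\tau):(S,B,D,\chi)\to(U,E,G,\lambda)$. Vertical composition of 2-cells is composition of maps; horizontal composition is the tensor product of bimodule maps over the middle ground ring. The associativity constraint at $(Q,\rho,\nu),(P,\sigma,\tau),(M,\alpha,\gamma)$ is the canonical bimodule isomorphism $Q\otimes_U(P\otimes_S M)\to(Q\otimes_U P)\otimes_S M$. The identity 1-cell on $(R,A,C,\psi)$ is the bimodule $R$ with the canonical isomorphisms $A\otimes_R R\cong R\otimes_R A$ and $C\otimes_R R\cong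 R\otimes_R C$, and the unit constraints are the canonical bimodule isomorphisms $S\otimes_S M\cong M\cong M\otimes_R R$. *)

theory Defs
  imports "HOL-Algebra.Module" "HOL-Algebra.Free_Abelian_Groups"
begin

section \<open>Bicategories\<close>

text \<open>
  The hom-categories are indexed families: \<open>one_cells B X Y\<close> are the 1-cells \<open>X \<rightarrow> Y\<close> and
  \<open>two_cells B X Y f g\<close> are the 2-cells \<open>f \<Rightarrow> g\<close> between 1-cells \<open>X \<rightarrow> Y\<close>. A raw 1- or 2-cell need
  not determine its source and target, so every operation receives the cells that it depends on
  as arguments. Compositions are written in the order of maps: \<open>comp1 B X Y Z g f\<close> is \<open>g \<circ> f\<close> for
  \<open>f : X \<rightarrow> Y\<close> and \<open>g : Y \<rightarrow> Z\<close>; \<open>vcomp B X Y f g h \<theta>' \<theta>\<close> is \<open>\<theta>' \<cdot> \<theta>\<close> for \<open>\<theta> : f \<Rightarrow> g\<close> and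
  \<open>\<theta>' : g \<Rightarrow> h\<close>; and \<open>hcomp B X Y Z g g' f f' \<eta> \<theta>\<close> is the 2-cell \<open>g \<circ> f \<Rightarrow> g' \<circ> f'\<close> for
  \<open>\<eta> : g \<Rightarrow> g'\<close> and \<open>\<theta> : f \<Rightarrow> f'\<close>. The associativity constraint
  \<open>assoc2 B W X Y Z h g f\<close> goes from \<open>h \<circ> (g \<circ> f)\<close> to \<open>(h \<circ> g) \<circ> f\<close>.
\<close>

record ('o, 'f, 't) bicat =
  zero_cells :: "'o set"
  one_cells :: "'o \<Rightarrow> 'o \<Rightarrow> 'f set"
  two_cells :: "'o \<Rightarrow> 'o \<Rightarrow> 'f \<Rightarrow> 'f \<Rightarrow> 't set"
  id1 :: "'o \<Rightarrow> 'f"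
  comp1 :: "'o \<Rightarrow> 'o \<Rightarrow> 'o \<Rightarrow> 'f \<Rightarrow> 'f \<Rightarrow> 'f"
  id2 :: "'o \<Rightarrow> 'o \<Rightarrow> 'f \<Rightarrow> 't"
  vcomp :: "'o \<Rightarrow> 'o \<Rightarrow> 'f \<Rightarrow> 'f \<Rightarrow> 'f \<Rightarrow> 't \<Rightarrow> 't \<Rightarrow> 't"
  hcomp :: "'o \<Rightarrow> 'o \<Rightarrow> 'o \<Rightarrow> 'f \<Rightarrow> 'f \<Rightarrow> 'f \<Rightarrow> 'f \<Rightarrow> 't \<Rightarrow> 't \<Rightarrow> 't"
  assoc2 :: "'o \<Rightarrow> 'o \<Rightarrow> 'o \<Rightarrow> 'o \<Rightarrow> 'f \<Rightarrow> 'f \<Rightarrow> 'f \<Rightarrow> 't"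
  lunit2 :: "'o \<Rightarrow> 'o \<Rightarrow> 'f \<Rightarrow> 't"
  runit2 :: "'o \<Rightarrow> 'o \<Rightarrow> 'f \<Rightarrow> 't"

definition iso2 :: "('o, 'f, 't) bicat \<Rightarrow> 'o \<Rightarrow> 'o \<Rightarrow> 'f \<Rightarrow> 'f \<Rightarrow> 't \<Rightarrow> bool" where
  "iso2 B X Y f g \<theta> \<longleftrightarrow> \<theta> \<in> two_cells B X Y f g \<and>
     (\<exists>\<theta>' \<in> two_cells B X Y g f.
        vcomp B X Y f g f \<theta>' \<theta> = id2 B X Y f \<and> vcomp B X Y g f g \<theta> \<theta>' = id2 B X Y g)"

locale bicategory =
  fixes B :: "('o, 'f, 't) bicat"
  assumes id2_closed:
    "\<lbrakk>X \<in> zero_cells B; Y \<in> zero_cells B; f \<in> one_cells B X Y\<rbrakk>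
      \<Longrightarrow> id2 B X Y f \<in> two_cells B X Y f f"
  and vcomp_closed:
    "\<lbrakk>X \<in> zero_cells B; Y \<in> zero_cells B;
      f \<in> one_cells B X Y; g \<in> one_cells B X Y; h \<in> one_cells B X Y;
      \<theta> \<in> two_cells B X Y f g; \<theta>' \<in> two_cells B X Y g h\<rbrakk>
      \<Longrightarrow> vcomp B X Y f g h \<theta>' \<theta> \<in> two_cells B X Y f h"
  and vcomp_id_left:
    "\<lbrakk>X \<in> zero_cells B; Y \<in> zero_cells B; f \<in> one_cells B X Y; g \<in> one_cells B X Y;
      \<theta> \<in> two_cells B X Y f g\<rbrakk>
      \<Longrightarrow> vcomp B X Y f g g (id2 B X Y g) \<theta> = \<theta>"
  and vcomp_id_right:
    "\<lbrakk>X \<in> zero_cells B; Y \<in> zero_cells B; f \<in> one_cells B X Y; g \<in> one_cells B X Y;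
      \<theta> \<in> two_cells B X Y f g\<rbrakk>
      \<Longrightarrow> vcomp B X Y f f g \<theta> (id2 B X Y f) = \<theta>"
  and vcomp_assoc:
    "\<lbrakk>X \<in> zero_cells B; Y \<in> zero_cells B; f \<in> one_cells B X Y; g \<in> one_cells B X Y;
      h \<in> one_cells B X Y; k \<in> one_cells B X Y;
      \<theta> \<in> two_cells B X Y f g; \<theta>' \<in> two_cells B X Y g h; \<theta>'' \<in> two_cells B X Y h k\<rbrakk>
      \<Longrightarrow> vcomp B X Y f h k \<theta>'' (vcomp B X Y f g h \<theta>' \<theta>) =
          vcomp B X Y f g k (vcomp B X Y g h k \<theta>'' \<theta>') \<theta>"
  and id1_closed:
    "X \<in> zero_cells B \<Longrightarrow> id1 B X \<in> one_cells B X X"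
  and comp1_closed:
    "\<lbrakk>X \<in> zero_cells B; Y \<in> zero_cells B; Z \<in> zero_cells B;
      f \<in> one_cells B X Y; g \<in> one_cells B Y Z\<rbrakk>
      \<Longrightarrow> comp1 B X Y Z g f \<in> one_cells B X Z"
  and hcomp_closed:
    "\<lbrakk>X \<in> zero_cells B; Y \<in> zero_cells B; Z \<in> zero_cells B;
      f \<in> one_cells B X Y; f' \<in> one_cells B X Y; g \<in> one_cells B Y Z; g' \<in> one_cells B Y Z;
      \<theta> \<in> two_cells B X Y f f'; \<eta> \<in> two_cells B Y Z g g'\<rbrakk>
      \<Longrightarrow> hcomp B X Y Z g g' f f' \<eta> \<theta>
            \<in> two_cells B X Z (comp1 B X Y Z g f) (comp1 B X Y Z g' f')"
  and hcomp_id: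
    "\<lbrakk>X \<in> zero_cells B; Y \<in> zero_cells B; Z \<in> zero_cells B;
      f \<in> one_cells B X Y; g \<in> one_cells B Y Z\<rbrakk>
      \<Longrightarrow> hcomp B X Y Z g g f f (id2 B Y Z g) (id2 B X Y f) = id2 B X Z (comp1 B X Y Z g f)"
  and interchange:
    "\<lbrakk>X \<in> zero_cells B; Y \<in> zero_cells B; Z \<in> zero_cells B;
      f \<in> one_cells B X Y; f' \<in> one_cells B X Y; f'' \<in> one_cells B X Y;
      g \<in> one_cells B Y Z; g' \<in> one_cells B Y Z; g'' \<in> one_cells B Y Z;
      \<theta> \<in> two_cells B X Y f f'; \<theta>' \<in> two_cells B X Y f' f'';
      \<eta> \<in> two_cells B Y Z g g'; \<eta>' \<in> two_cells B Y Z g' g''\<rbrakk>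
      \<Longrightarrow> hcomp B X Y Z g g'' f f'' (vcomp B Y Z g g' g'' \<eta>' \<eta>) (vcomp B X Y f f' f'' \<theta>' \<theta>) =
          vcomp B X Z (comp1 B X Y Z g f) (comp1 B X Y Z g' f') (comp1 B X Y Z g'' f'')
            (hcomp B X Y Z g' g'' f' f'' \<eta>' \<theta>') (hcomp B X Y Z g g' f f' \<eta> \<theta>)"
  and assoc2_iso:
    "\<lbrakk>W \<in> zero_cells B; X \<in> zero_cells B; Y \<in> zero_cells B; Z \<in> zero_cells B;
      f \<in> one_cells B W X; g \<in> one_cells B X Y; h \<in> one_cells B Y Z\<rbrakk>
      \<Longrightarrow> iso2 B W Z (comp1 B W Y Z h (comp1 B W X Y g f)) (comp1 B W X Z (comp1 B X Y Z h g) f)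
            (assoc2 B W X Y Z h g f)"
  and assoc2_natural:
    "\<lbrakk>W \<in> zero_cells B; X \<in> zero_cells B; Y \<in> zero_cells B; Z \<in> zero_cells B;
      f \<in> one_cells B W X; f' \<in> one_cells B W X; g \<in> one_cells B X Y; g' \<in> one_cells B X Y;
      h \<in> one_cells B Y Z; h' \<in> one_cells B Y Z;
      \<theta> \<in> two_cells B W X f f'; \<eta> \<in> two_cells B X Y g g'; \<zeta> \<in> two_cells B Y Z h h'\<rbrakk>
      \<Longrightarrow> vcomp B W Z (comp1 B W Y Z h (comp1 B W X Y g f))
            (comp1 B W Y Z h' (comp1 B W X Y g' f')) (comp1 B W X Z (comp1 B X Y Z h' g') f')
            (assoc2 B W X Y Z h' g' f')
            (hcomp B W Y Z h h' (comp1 B W X Y g f) (comp1 B W X Y g' f') \<zeta>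
              (hcomp B W X Y g g' f f' \<eta> \<theta>)) =
          vcomp B W Z (comp1 B W Y Z h (comp1 B W X Y g f))
            (comp1 B W X Z (comp1 B X Y Z h g) f) (comp1 B W X Z (comp1 B X Y Z h' g') f')
            (hcomp B W X Z (comp1 B X Y Z h g) (comp1 B X Y Z h' g') f f'
              (hcomp B X Y Z h h' g g' \<zeta> \<eta>) \<theta>)
            (assoc2 B W X Y Z h g f)"
  and lunit2_iso:
    "\<lbrakk>X \<in> zero_cells B; Y \<in> zero_cells B; f \<in> one_cells B X Y\<rbrakk>
      \<Longrightarrow> iso2 B X Y (comp1 B X Y Y (id1 B Y) f) f (lunit2 B X Y f)"
  and lunit2_natural:
    "\<lbrakk>X \<in> zero_cells B; Y \<in> zero_cells B; f \<in> one_cells B X Y; f' \<in> one_cells B X Y;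
      \<theta> \<in> two_cells B X Y f f'\<rbrakk>
      \<Longrightarrow> vcomp B X Y (comp1 B X Y Y (id1 B Y) f) (comp1 B X Y Y (id1 B Y) f') f'
            (lunit2 B X Y f')
            (hcomp B X Y Y (id1 B Y) (id1 B Y) f f' (id2 B Y Y (id1 B Y)) \<theta>) =
          vcomp B X Y (comp1 B X Y Y (id1 B Y) f) f f' \<theta> (lunit2 B X Y f)"
  and runit2_iso:
    "\<lbrakk>X \<in> zero_cells B; Y \<in> zero_cells B; f \<in> one_cells B X Y\<rbrakk>
      \<Longrightarrow> iso2 B X Y (comp1 B X X Y f (id1 B X)) f (runit2 B X Y f)"
  and runit2_natural:
    "\<lbrakk>X \<in> zero_cells B; Y \<in> zero_cells B; f \<in> one_cells B X Y; f' \<in> one_cells B X Y;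
      \<theta> \<in> two_cells B X Y f f'\<rbrakk>
      \<Longrightarrow> vcomp B X Y (comp1 B X X Y f (id1 B X)) (comp1 B X X Y f' (id1 B X)) f'
            (runit2 B X Y f')
            (hcomp B X X Y f f' (id1 B X) (id1 B X) \<theta> (id2 B X X (id1 B X))) =
          vcomp B X Y (comp1 B X X Y f (id1 B X)) f f' \<theta> (runit2 B X Y f)"
  and pentagon:
    "\<lbrakk>V \<in> zero_cells B; W \<in> zero_cells B; X \<in> zero_cells B; Y \<in> zero_cells B; Z \<in> zero_cells B;
      f \<in> one_cells B V W; g \<in> one_cells B W X; h \<in> one_cells B X Y; k \<in> one_cells B Y Z\<rbrakk>
      \<Longrightarrow> vcomp B V Z
            (comp1 B V Y Z k (comp1 B V X Y h (comp1 B V W X g f)))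
            (comp1 B V X Z (comp1 B X Y Z k h) (comp1 B V W X g f))
            (comp1 B V W Z (comp1 B W X Z (comp1 B X Y Z k h) g) f)
            (assoc2 B V W X Z (comp1 B X Y Z k h) g f)
            (assoc2 B V X Y Z k h (comp1 B V W X g f)) =
          vcomp B V Z
            (comp1 B V Y Z k (comp1 B V X Y h (comp1 B V W X g f)))
            (comp1 B V W Z (comp1 B W Y Z k (comp1 B W X Y h g)) f)
            (comp1 B V W Z (comp1 B W X Z (comp1 B X Y Z k h) g) f)
            (hcomp B V W Z (comp1 B W Y Z k (comp1 B W X Y h g))
              (comp1 B W X Z (comp1 B X Y Z k h) g) f f
              (assoc2 B W X Y Z k h g) (id2 B V W f))
            (vcomp B V Z
              (comp1 B V Y Z k (comp1 B V X Y h (comp1 B V W X g f)))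
              (comp1 B V Y Z k (comp1 B V W Y (comp1 B W X Y h g) f))
              (comp1 B V W Z (comp1 B W Y Z k (comp1 B W X Y h g)) f)
              (assoc2 B V W Y Z k (comp1 B W X Y h g) f)
              (hcomp B V Y Z k k (comp1 B V X Y h (comp1 B V W X g f))
                (comp1 B V W Y (comp1 B W X Y h g) f)
                (id2 B Y Z k) (assoc2 B V W X Y h g f)))"
  and triangle:
    "\<lbrakk>X \<in> zero_cells B; Y \<in> zero_cells B; Z \<in> zero_cells B;
      f \<in> one_cells B X Y; g \<in> one_cells B Y Z\<rbrakk>
      \<Longrightarrow> vcomp B X Z (comp1 B X Y Z g (comp1 B X Y Y (id1 B Y) f))
            (comp1 B X Y Z (comp1 B Y Y Z g (id1 B Y)) f) (comp1 B X Y Z g f)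
            (hcomp B X Y Z (comp1 B Y Y Z g (id1 B Y)) g f f (runit2 B Y Z g) (id2 B X Y f))
            (assoc2 B X Y Y Z g (id1 B Y) f) =
          hcomp B X Y Z g g (comp1 B X Y Y (id1 B Y) f) f (id2 B Y Z g) (lunit2 B X Y f)"


section \<open>Bimodules\<close>

text \<open>
  As for the library's modules, only the additive structure of the underlying \<open>ring\<close> record is
  used; its fields \<open>mult\<close> and \<open>one\<close> carry no information. All carriers are subsets of one type
  \<open>'u\<close>, which plays the part of the universe in which rings and bimodules live.
\<close>

record ('a, 'b, 'c) bimodule = "('a, 'b) module" +
  rsmult :: "['b, 'c] \<Rightarrow> 'b" (infixl \<open>\<odot>r\<index>\<close> 70)

type_synonym 'u bimod = "('u, 'u, 'u) bimodule"

locale bimodule = left: ring S + right: ring R + bimod: abelian_group M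
  for S :: "'u ring" and R :: "'u ring" and M :: "'u bimod" +
  assumes smult_closed:
    "\<lbrakk>s \<in> carrier S; x \<in> carrier M\<rbrakk> \<Longrightarrow> s \<odot>\<^bsub>M\<^esub> x \<in> carrier M"
  and smult_l_distr:
    "\<lbrakk>s \<in> carrier S; t \<in> carrier S; x \<in> carrier M\<rbrakk>
      \<Longrightarrow> (s \<oplus>\<^bsub>S\<^esub> t) \<odot>\<^bsub>M\<^esub> x = s \<odot>\<^bsub>M\<^esub> x \<oplus>\<^bsub>M\<^esub> t \<odot>\<^bsub>M\<^esub> x"
  and smult_r_distr:
    "\<lbrakk>s \<in> carrier S; x \<in> carrier M; y \<in> carrier M\<rbrakk>
      \<Longrightarrow> s \<odot>\<^bsub>M\<^esub> (x \<oplus>\<^bsub>M\<^esub> y) = s \<odot>\<^bsub>M\<^esub> x \<oplus>\<^bsub>M\<^esub> s \<odot>\<^bsub>M\<^esub> y"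
  and smult_assoc:
    "\<lbrakk>s \<in> carrier S; t \<in> carrier S; x \<in> carrier M\<rbrakk>
      \<Longrightarrow> (s \<otimes>\<^bsub>S\<^esub> t) \<odot>\<^bsub>M\<^esub> x = s \<odot>\<^bsub>M\<^esub> (t \<odot>\<^bsub>M\<^esub> x)"
  and smult_one:
    "x \<in> carrier M \<Longrightarrow> \<one>\<^bsub>S\<^esub> \<odot>\<^bsub>M\<^esub> x = x"
  and rsmult_closed:
    "\<lbrakk>r \<in> carrier R; x \<in> carrier M\<rbrakk> \<Longrightarrow> x \<odot>r\<^bsub>M\<^esub> r \<in> carrier M"
  and rsmult_r_distr:
    "\<lbrakk>r \<in> carrier R; t \<in> carrier R; x \<in> carrier M\<rbrakk>
      \<Longrightarrow> x \<odot>r\<^bsub>M\<^esub> (r \<oplus>\<^bsub>R\<^esub> t) = x \<odot>r\<^bsub>M\<^esub> r \<oplus>\<^bsub>M\<^esub> x \<odot>r\<^bsub>M\<^esub> t"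
  and rsmult_l_distr:
    "\<lbrakk>r \<in> carrier R; x \<in> carrier M; y \<in> carrier M\<rbrakk>
      \<Longrightarrow> (x \<oplus>\<^bsub>M\<^esub> y) \<odot>r\<^bsub>M\<^esub> r = x \<odot>r\<^bsub>M\<^esub> r \<oplus>\<^bsub>M\<^esub> y \<odot>r\<^bsub>M\<^esub> r"
  and rsmult_assoc:
    "\<lbrakk>r \<in> carrier R; t \<in> carrier R; x \<in> carrier M\<rbrakk>
      \<Longrightarrow> x \<odot>r\<^bsub>M\<^esub> (r \<otimes>\<^bsub>R\<^esub> t) = (x \<odot>r\<^bsub>M\<^esub> r) \<odot>r\<^bsub>M\<^esub> t"
  and rsmult_one:
    "x \<in> carrier M \<Longrightarrow> x \<odot>r\<^bsub>M\<^esub> \<one>\<^bsub>R\<^esub> = x"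
  and smult_rsmult:
    "\<lbrakk>s \<in> carrier S; x \<in> carrier M; r \<in> carrier R\<rbrakk>
      \<Longrightarrow> (s \<odot>\<^bsub>M\<^esub> x) \<odot>r\<^bsub>M\<^esub> r = s \<odot>\<^bsub>M\<^esub> (x \<odot>r\<^bsub>M\<^esub> r)"

definition ring_bimod :: "'u ring \<Rightarrow> 'u bimod" where
  "ring_bimod R =
     \<lparr>carrier = carrier R, mult = mult R, one = one R, ring.zero = \<zero>\<^bsub>R\<^esub>, add = add R,
      smult = mult R, rsmult = mult R\<rparr>"

text \<open>Maps are extensional, so that maps which agree on the carrier are equal.\<close>

definition additive_hom :: "'u bimod \<Rightarrow> 'u bimod \<Rightarrow> ('u \<Rightarrow> 'u) set" where
  "additive_hom M N = {f \<in> carrier M \<rightarrow>\<^sub>E carrier N.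
     \<forall>x \<in> carrier M. \<forall>y \<in> carrier M. f (x \<oplus>\<^bsub>M\<^esub> y) = f x \<oplus>\<^bsub>N\<^esub> f y}"

definition bimod_hom :: "'u ring \<Rightarrow> 'u ring \<Rightarrow> 'u bimod \<Rightarrow> 'u bimod \<Rightarrow> ('u \<Rightarrow> 'u) set" where
  "bimod_hom S R M N = {f \<in> additive_hom M N.
     (\<forall>s \<in> carrier S. \<forall>x \<in> carrier M. f (s \<odot>\<^bsub>M\<^esub> x) = s \<odot>\<^bsub>N\<^esub> f x) \<and>
     (\<forall>x \<in> carrier M. \<forall>r \<in> carrier R. f (x \<odot>r\<^bsub>M\<^esub> r) = f x \<odot>r\<^bsub>N\<^esub> r)}"

definition id_map :: "'u bimod \<Rightarrow> 'u \<Rightarrow> 'u" where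
  "id_map M = (\<lambda>x \<in> carrier M. x)"


section \<open>Tensor products of bimodules\<close>

text \<open>
  The tensor product over \<open>S\<close> of a right \<open>S\<close>-module \<open>P\<close> and a left \<open>S\<close>-module \<open>M\<close> is the free
  abelian group on the pairs of elements modulo the subgroup generated by the usual relations.
  For the result to have its carrier in \<open>'u\<close> again, a class is represented by the image of one
  chosen member under an injection of the formal sums into \<open>'u\<close>; there is such an injection
  whenever \<open>'u\<close> is infinite.
\<close>

inductive_set tensor_rel :: "'u ring \<Rightarrow> 'u bimod \<Rightarrow> 'u bimod \<Rightarrow> ('u \<times> 'u \<Rightarrow>\<^sub>0 int) set"
  for S P M where
  zero: "0 \<in> tensor_rel S P M"
| diff: "\<lbrakk>u \<in> tensor_rel S P M; v \<in> tensor_rel S P M\<rbrakk> \<Longrightarrow> u - v \<in> tensor_rel S P M"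
| add_left: "\<lbrakk>p \<in> carrier P; q \<in> carrier P; m \<in> carrier M\<rbrakk>
    \<Longrightarrow> frag_of (p \<oplus>\<^bsub>P\<^esub> q, m) - frag_of (p, m) - frag_of (q, m) \<in> tensor_rel S P M"
| add_right: "\<lbrakk>p \<in> carrier P; m \<in> carrier M; n \<in> carrier M\<rbrakk>
    \<Longrightarrow> frag_of (p, m \<oplus>\<^bsub>M\<^esub> n) - frag_of (p, m) - frag_of (p, n) \<in> tensor_rel S P M"
| balanced: "\<lbrakk>p \<in> carrier P; s \<in> carrier S; m \<in> carrier M\<rbrakk>
    \<Longrightarrow> frag_of (p \<odot>r\<^bsub>P\<^esub> s, m) - frag_of (p, s \<odot>\<^bsub>M\<^esub> m) \<in> tensor_rel S P M"

definition encode :: "('u \<times> 'u \<Rightarrow>\<^sub>0 int) \<Rightarrow> 'u" where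
  "encode = (SOME e. inj e)"

definition decode :: "'u \<Rightarrow> ('u \<times> 'u \<Rightarrow>\<^sub>0 int)" where
  "decode = inv_into UNIV encode"

definition tensor_class :: "'u ring \<Rightarrow> 'u bimod \<Rightarrow> 'u bimod \<Rightarrow> ('u \<times> 'u \<Rightarrow>\<^sub>0 int) \<Rightarrow> 'u" where
  "tensor_class S P M u = encode (SOME v. v - u \<in> tensor_rel S P M)"

definition tensor :: "'u bimod \<Rightarrow> 'u ring \<Rightarrow> 'u bimod \<Rightarrow> 'u bimod"
    (\<open>(_ \<boxtimes>\<^bsub>_\<^esub>/ _)\<close> [66, 0, 66] 65) where
  "P \<boxtimes>\<^bsub>S\<^esub> M =
     \<lparr>carrier = tensor_class S P M ` {u. Poly_Mapping.keys u \<subseteq> carrier P \<times> carrier M},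
      mult = undefined,
      one = undefined,
      ring.zero = tensor_class S P M 0,
      add = (\<lambda>t t'. tensor_class S P M (decode t + decode t')),
      smult = (\<lambda>s t. tensor_class S P M
                 (frag_extend (\<lambda>(p, m). frag_of (s \<odot>\<^bsub>P\<^esub> p, m)) (decode t))),
      rsmult = (\<lambda>t r. tensor_class S P M
                 (frag_extend (\<lambda>(p, m). frag_of (p, m \<odot>r\<^bsub>M\<^esub> r)) (decode t)))\<rparr>"

definition tensor_elt :: "'u ring \<Rightarrow> 'u bimod \<Rightarrow> 'u bimod \<Rightarrow> 'u \<Rightarrow> 'u \<Rightarrow> 'u" where
  "tensor_elt S P M p m = tensor_class S P M (frag_of (p, m))"

text \<open>
  The additive map out of \<open>P \<boxtimes>\<^bsub>S\<^esub> M\<close> that sends \<open>p \<otimes> m\<close> to \<open>b p m\<close>; it exists uniquely when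
  \<open>b\<close> is biadditive and \<open>S\<close>-balanced.
\<close>

definition tensor_lift ::
    "'u ring \<Rightarrow> 'u bimod \<Rightarrow> 'u bimod \<Rightarrow> 'u bimod \<Rightarrow> ('u \<Rightarrow> 'u \<Rightarrow> 'u) \<Rightarrow> 'u \<Rightarrow> 'u" where
  "tensor_lift S P M N b = (THE f. f \<in> additive_hom (P \<boxtimes>\<^bsub>S\<^esub> M) N \<and>
     (\<forall>p \<in> carrier P. \<forall>m \<in> carrier M. f (tensor_elt S P M p m) = b p m))"

definition tensor_map ::
    "'u ring \<Rightarrow> 'u bimod \<Rightarrow> 'u bimod \<Rightarrow> 'u bimod \<Rightarrow> 'u bimod \<Rightarrow> ('u \<Rightarrow> 'u) \<Rightarrow> ('u \<Rightarrow> 'u) \<Rightarrow> 'u \<Rightarrow> 'u"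
  where
  "tensor_map S P P' M M' f g =
     tensor_lift S P M (P' \<boxtimes>\<^bsub>S\<^esub> M') (\<lambda>p m. tensor_elt S P' M' (f p) (g m))"

text \<open>\<open>P \<otimes> g : P \<boxtimes>\<^bsub>S\<^esub> M \<rightarrow> P \<boxtimes>\<^bsub>S\<^esub> M'\<close> for \<open>g : M \<rightarrow> M'\<close>, and
  \<open>f \<otimes> M : P \<boxtimes>\<^bsub>S\<^esub> M \<rightarrow> P' \<boxtimes>\<^bsub>S\<^esub> M\<close> for \<open>f : P \<rightarrow> P'\<close>.\<close>

definition lwhisker ::
    "'u ring \<Rightarrow> 'u bimod \<Rightarrow> 'u bimod \<Rightarrow> 'u bimod \<Rightarrow> ('u \<Rightarrow> 'u) \<Rightarrow> 'u \<Rightarrow> 'u" where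
  "lwhisker S P M M' g = tensor_map S P P M M' (id_map P) g"

definition rwhisker ::
    "'u ring \<Rightarrow> 'u bimod \<Rightarrow> 'u bimod \<Rightarrow> 'u bimod \<Rightarrow> ('u \<Rightarrow> 'u) \<Rightarrow> 'u \<Rightarrow> 'u" where
  "rwhisker S P P' M f = tensor_map S P P' M M f (id_map M)"

text \<open>\<open>X \<boxtimes>\<^bsub>S\<^esub> (Y \<boxtimes>\<^bsub>R\<^esub> Z) \<rightarrow> (X \<boxtimes>\<^bsub>S\<^esub> Y) \<boxtimes>\<^bsub>R\<^esub> Z\<close> and back.\<close>

definition tensor_assoc ::
    "'u ring \<Rightarrow> 'u ring \<Rightarrow> 'u bimod \<Rightarrow> 'u bimod \<Rightarrow> 'u bimod \<Rightarrow> 'u \<Rightarrow> 'u" where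
  "tensor_assoc S R X Y Z =
     tensor_lift S X (Y \<boxtimes>\<^bsub>R\<^esub> Z) ((X \<boxtimes>\<^bsub>S\<^esub> Y) \<boxtimes>\<^bsub>R\<^esub> Z)
       (\<lambda>x. tensor_lift R Y Z ((X \<boxtimes>\<^bsub>S\<^esub> Y) \<boxtimes>\<^bsub>R\<^esub> Z)
         (\<lambda>y z. tensor_elt R (X \<boxtimes>\<^bsub>S\<^esub> Y) Z (tensor_elt S X Y x y) z))"

definition tensor_assoc_inv ::
    "'u ring \<Rightarrow> 'u ring \<Rightarrow> 'u bimod \<Rightarrow> 'u bimod \<Rightarrow> 'u bimod \<Rightarrow> 'u \<Rightarrow> 'u" where
  "tensor_assoc_inv S R X Y Z =
     tensor_lift R (X \<boxtimes>\<^bsub>S\<^esub> Y) Z (X \<boxtimes>\<^bsub>S\<^esub> (Y \<boxtimes>\<^bsub>R\<^esub> Z))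
       (\<lambda>t z. tensor_lift S X Y (X \<boxtimes>\<^bsub>S\<^esub> (Y \<boxtimes>\<^bsub>R\<^esub> Z))
         (\<lambda>x y. tensor_elt S X (Y \<boxtimes>\<^bsub>R\<^esub> Z) x (tensor_elt R Y Z y z)) t)"

definition left_unit :: "'u ring \<Rightarrow> 'u bimod \<Rightarrow> 'u \<Rightarrow> 'u" where
  "left_unit S M = tensor_lift S (ring_bimod S) M M (\<lambda>s m. s \<odot>\<^bsub>M\<^esub> m)"

definition left_unit_inv :: "'u ring \<Rightarrow> 'u bimod \<Rightarrow> 'u \<Rightarrow> 'u" where
  "left_unit_inv S M = (\<lambda>m \<in> carrier M. tensor_elt S (ring_bimod S) M \<one>\<^bsub>S\<^esub> m)"

definition right_unit :: "'u ring \<Rightarrow> 'u bimod \<Rightarrow> 'u \<Rightarrow> 'u" where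
  "right_unit R M = tensor_lift R M (ring_bimod R) M (\<lambda>m r. m \<odot>r\<^bsub>M\<^esub> r)"

definition right_unit_inv :: "'u ring \<Rightarrow> 'u bimod \<Rightarrow> 'u \<Rightarrow> 'u" where
  "right_unit_inv R M = (\<lambda>m \<in> carrier M. tensor_elt R M (ring_bimod R) m \<one>\<^bsub>R\<^esub>)"


section \<open>The data of the bicategory of rings and bimodules\<close>

text \<open>A 1-cell \<open>R \<rightarrow> S\<close> is an \<open>S\<close>-\<open>R\<close>-bimodule.\<close>

definition Bim :: "('u ring, 'u bimod, 'u \<Rightarrow> 'u) bicat" where
  "Bim =
     \<lparr>zero_cells = {R. ring R},
      one_cells = (\<lambda>R S. {M. bimodule S R M}),
      two_cells = (\<lambda>R S M N. bimod_hom S R M N),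
      id1 = ring_bimod,
      comp1 = (\<lambda>R S U P M. P \<boxtimes>\<^bsub>S\<^esub> M),
      id2 = (\<lambda>R S M. id_map M),
      vcomp = (\<lambda>R S M N K \<theta>' \<theta>. compose (carrier M) \<theta>' \<theta>),
      hcomp = (\<lambda>R S U P P' M M' \<eta> \<theta>. tensor_map S P P' M M' \<eta> \<theta>),
      assoc2 = (\<lambda>R S U V Q P M. tensor_assoc U S Q P M),
      lunit2 = (\<lambda>R S M. left_unit S M),
      runit2 = (\<lambda>R S M. right_unit R M)\<rparr>"


section \<open>Rings, corings and entwinings over a base ring\<close>

text \<open>
  In all diagrams the associativity and unit isomorphisms are inserted where they are usually
  suppressed.
\<close>

definition is_R_ring :: "'u ring \<Rightarrow> 'u bimod \<Rightarrow> ('u \<Rightarrow> 'u) \<Rightarrow> ('u \<Rightarrow> 'u) \<Rightarrow> bool" where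
  "is_R_ring R A \<mu> \<eta> \<longleftrightarrow>
     bimodule R R A \<and>
     \<mu> \<in> bimod_hom R R (A \<boxtimes>\<^bsub>R\<^esub> A) A \<and>
     \<eta> \<in> bimod_hom R R (ring_bimod R) A \<and>
     (\<forall>x \<in> carrier (A \<boxtimes>\<^bsub>R\<^esub> (A \<boxtimes>\<^bsub>R\<^esub> A)).
        (\<mu> \<circ> lwhisker R A (A \<boxtimes>\<^bsub>R\<^esub> A) A \<mu>) x =
        (\<mu> \<circ> rwhisker R (A \<boxtimes>\<^bsub>R\<^esub> A) A A \<mu> \<circ> tensor_assoc R R A A A) x) \<and>
     (\<forall>x \<in> carrier (ring_bimod R \<boxtimes>\<^bsub>R\<^esub> A).
        (\<mu> \<circ> rwhisker R (ring_bimod R) A A \<eta>) x = left_unit R A x) \<and>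
     (\<forall>x \<in> carrier (A \<boxtimes>\<^bsub>R\<^esub> ring_bimod R).
        (\<mu> \<circ> lwhisker R A (ring_bimod R) A \<eta>) x = right_unit R A x)"

definition is_R_coring :: "'u ring \<Rightarrow> 'u bimod \<Rightarrow> ('u \<Rightarrow> 'u) \<Rightarrow> ('u \<Rightarrow> 'u) \<Rightarrow> bool" where
  "is_R_coring R C \<Delta> \<epsilon> \<longleftrightarrow>
     bimodule R R C \<and>
     \<Delta> \<in> bimod_hom R R C (C \<boxtimes>\<^bsub>R\<^esub> C) \<and>
     \<epsilon> \<in> bimod_hom R R C (ring_bimod R) \<and>
     (\<forall>x \<in> carrier C.
        (tensor_assoc R R C C C \<circ> lwhisker R C C (C \<boxtimes>\<^bsub>R\<^esub> C) \<Delta> \<circ> \<Delta>) x =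
        (rwhisker R C (C \<boxtimes>\<^bsub>R\<^esub> C) C \<Delta> \<circ> \<Delta>) x) \<and>
     (\<forall>x \<in> carrier C. (left_unit R C \<circ> rwhisker R C (ring_bimod R) C \<epsilon> \<circ> \<Delta>) x = x) \<and>
     (\<forall>x \<in> carrier C. (right_unit R C \<circ> lwhisker R C C (ring_bimod R) \<epsilon> \<circ> \<Delta>) x = x)"

definition symmetric_bimod :: "'u ring \<Rightarrow> 'u bimod \<Rightarrow> bool" where
  "symmetric_bimod R M \<longleftrightarrow> (\<forall>r \<in> carrier R. \<forall>x \<in> carrier M. r \<odot>\<^bsub>M\<^esub> x = x \<odot>r\<^bsub>M\<^esub> r)"

text \<open>
  Algebras and coalgebras over a commutative ring \<open>R\<close> are the monoids and comonoids among
  \<open>R\<close>-modules, that is, among the \<open>R\<close>-\<open>R\<close>-bimodules whose two actions coincide.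
\<close>

definition is_R_algebra :: "'u ring \<Rightarrow> 'u bimod \<Rightarrow> ('u \<Rightarrow> 'u) \<Rightarrow> ('u \<Rightarrow> 'u) \<Rightarrow> bool" where
  "is_R_algebra R A \<mu> \<eta> \<longleftrightarrow> cring R \<and> symmetric_bimod R A \<and> is_R_ring R A \<mu> \<eta>"

definition is_R_coalgebra :: "'u ring \<Rightarrow> 'u bimod \<Rightarrow> ('u \<Rightarrow> 'u) \<Rightarrow> ('u \<Rightarrow> 'u) \<Rightarrow> bool" where
  "is_R_coalgebra R C \<Delta> \<epsilon> \<longleftrightarrow> cring R \<and> symmetric_bimod R C \<and> is_R_coring R C \<Delta> \<epsilon>"

record 'u entwining =
  base :: "'u ring"
  alg :: "'u bimod"
  amult :: "'u \<Rightarrow> 'u"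
  aunit :: "'u \<Rightarrow> 'u"
  coalg :: "'u bimod"
  comult :: "'u \<Rightarrow> 'u"
  counit :: "'u \<Rightarrow> 'u"
  entw_map :: "'u \<Rightarrow> 'u"

definition is_entwining_map ::
    "'u ring \<Rightarrow> 'u bimod \<Rightarrow> ('u \<Rightarrow> 'u) \<Rightarrow> ('u \<Rightarrow> 'u) \<Rightarrow>
     'u bimod \<Rightarrow> ('u \<Rightarrow> 'u) \<Rightarrow> ('u \<Rightarrow> 'u) \<Rightarrow> ('u \<Rightarrow> 'u) \<Rightarrow> bool" where
  "is_entwining_map R A \<mu> \<eta> C \<Delta> \<epsilon> \<psi> \<longleftrightarrow>
     \<psi> \<in> bimod_hom R R (C \<boxtimes>\<^bsub>R\<^esub> A) (A \<boxtimes>\<^bsub>R\<^esub> C) \<and>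
     (\<forall>x \<in> carrier (C \<boxtimes>\<^bsub>R\<^esub> (A \<boxtimes>\<^bsub>R\<^esub> A)).
        (\<psi> \<circ> lwhisker R C (A \<boxtimes>\<^bsub>R\<^esub> A) A \<mu>) x =
        (rwhisker R (A \<boxtimes>\<^bsub>R\<^esub> A) A C \<mu> \<circ> tensor_assoc R R A A C \<circ>
         lwhisker R A (C \<boxtimes>\<^bsub>R\<^esub> A) (A \<boxtimes>\<^bsub>R\<^esub> C) \<psi> \<circ> tensor_assoc_inv R R A C A \<circ>
         rwhisker R (C \<boxtimes>\<^bsub>R\<^esub> A) (A \<boxtimes>\<^bsub>R\<^esub> C) A \<psi> \<circ> tensor_assoc R R C A A) x) \<and>
     (\<forall>x \<in> carrier C.
        (\<psi> \<circ> lwhisker R C (ring_bimod R) A \<eta> \<circ> right_unit_inv R C) x =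
        (rwhisker R (ring_bimod R) A C \<eta> \<circ> left_unit_inv R C) x) \<and>
     (\<forall>x \<in> carrier (C \<boxtimes>\<^bsub>R\<^esub> A).
        (lwhisker R A C (C \<boxtimes>\<^bsub>R\<^esub> C) \<Delta> \<circ> \<psi>) x =
        (tensor_assoc_inv R R A C C \<circ> rwhisker R (C \<boxtimes>\<^bsub>R\<^esub> A) (A \<boxtimes>\<^bsub>R\<^esub> C) C \<psi> \<circ>
         tensor_assoc R R C A C \<circ> lwhisker R C (C \<boxtimes>\<^bsub>R\<^esub> A) (A \<boxtimes>\<^bsub>R\<^esub> C) \<psi> \<circ>
         tensor_assoc_inv R R C C A \<circ> rwhisker R C (C \<boxtimes>\<^bsub>R\<^esub> C) A \<Delta>) x) \<and>
     (\<forall>x \<in> carrier (C \<boxtimes>\<^bsub>R\<^esub> A).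
        (right_unit R A \<circ> lwhisker R A C (ring_bimod R) \<epsilon> \<circ> \<psi>) x =
        (left_unit R A \<circ> rwhisker R C (ring_bimod R) A \<epsilon>) x)"

definition is_entwining :: "'u entwining \<Rightarrow> bool" where
  "is_entwining X \<longleftrightarrow>
     ring (base X) \<and>
     is_R_ring (base X) (alg X) (amult X) (aunit X) \<and>
     is_R_coring (base X) (coalg X) (comult X) (counit X) \<and>
     is_entwining_map (base X) (alg X) (amult X) (aunit X)
       (coalg X) (comult X) (counit X) (entw_map X)"

definition is_comm_entwining :: "'u entwining \<Rightarrow> bool" where
  "is_comm_entwining X \<longleftrightarrow>
     cring (base X) \<and>
     is_R_algebra (base X) (alg X) (amult X) (aunit X) \<and>
     is_R_coalgebra (base X) (coalg X) (comult X) (counit X) \<and>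
     is_entwining_map (base X) (alg X) (amult X) (aunit X)
       (coalg X) (comult X) (counit X) (entw_map X)"


section \<open>The data of the bicategory of entwinings\<close>

record 'u entw_cell =
  cmod :: "'u bimod"
  calg :: "'u \<Rightarrow> 'u"
  ccoalg :: "'u \<Rightarrow> 'u"

definition hexagon_cond :: "'u entwining \<Rightarrow> 'u entwining \<Rightarrow> 'u entw_cell \<Rightarrow> bool" where
  "hexagon_cond X Y F \<longleftrightarrow>
     (let R = base X; A = alg X; C = coalg X; \<psi> = entw_map X;
          S = base Y; B = alg Y; D = coalg Y; \<chi> = entw_map Y;
          M = cmod F; \<alpha> = calg F; \<gamma> = ccoalg F
      in \<forall>x \<in> carrier (D \<boxtimes>\<^bsub>S\<^esub> (B \<boxtimes>\<^bsub>S\<^esub> M)).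
           (lwhisker R M (C \<boxtimes>\<^bsub>R\<^esub> A) (A \<boxtimes>\<^bsub>R\<^esub> C) \<psi> \<circ> tensor_assoc_inv R R M C A \<circ>
            rwhisker R (D \<boxtimes>\<^bsub>S\<^esub> M) (M \<boxtimes>\<^bsub>R\<^esub> C) A \<gamma> \<circ> tensor_assoc S R D M A \<circ>
            lwhisker S D (B \<boxtimes>\<^bsub>S\<^esub> M) (M \<boxtimes>\<^bsub>R\<^esub> A) \<alpha>) x =
           (tensor_assoc_inv R R M A C \<circ> rwhisker R (B \<boxtimes>\<^bsub>S\<^esub> M) (M \<boxtimes>\<^bsub>R\<^esub> A) C \<alpha> \<circ>
            tensor_assoc S R B M C \<circ> lwhisker S B (D \<boxtimes>\<^bsub>S\<^esub> M) (M \<boxtimes>\<^bsub>R\<^esub> C) \<gamma> \<circ>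
            tensor_assoc_inv S S B D M \<circ> rwhisker S (D \<boxtimes>\<^bsub>S\<^esub> B) (B \<boxtimes>\<^bsub>S\<^esub> D) M \<chi> \<circ>
            tensor_assoc S S D B M) x)"

definition alg_conds :: "'u entwining \<Rightarrow> 'u entwining \<Rightarrow> 'u entw_cell \<Rightarrow> bool" where
  "alg_conds X Y F \<longleftrightarrow>
     (let R = base X; A = alg X; S = base Y; B = alg Y; M = cmod F; \<alpha> = calg F
      in (\<forall>x \<in> carrier (B \<boxtimes>\<^bsub>S\<^esub> (B \<boxtimes>\<^bsub>S\<^esub> M)).
            (\<alpha> \<circ> rwhisker S (B \<boxtimes>\<^bsub>S\<^esub> B) B M (amult Y) \<circ> tensor_assoc S S B B M) x =
            (lwhisker R M (A \<boxtimes>\<^bsub>R\<^esub> A) A (amult X) \<circ> tensor_assoc_inv R R M A A \<circ>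
             rwhisker R (B \<boxtimes>\<^bsub>S\<^esub> M) (M \<boxtimes>\<^bsub>R\<^esub> A) A \<alpha> \<circ> tensor_assoc S R B M A \<circ>
             lwhisker S B (B \<boxtimes>\<^bsub>S\<^esub> M) (M \<boxtimes>\<^bsub>R\<^esub> A) \<alpha>) x) \<and>
         (\<forall>x \<in> carrier M.
            (\<alpha> \<circ> rwhisker S (ring_bimod S) B M (aunit Y) \<circ> left_unit_inv S M) x =
            (lwhisker R M (ring_bimod R) A (aunit X) \<circ> right_unit_inv R M) x))"

definition coalg_conds :: "'u entwining \<Rightarrow> 'u entwining \<Rightarrow> 'u entw_cell \<Rightarrow> bool" where
  "coalg_conds X Y F \<longleftrightarrow>
     (let R = base X; C = coalg X; S = base Y; D = coalg Y; M = cmod F; \<gamma> = ccoalg F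
      in (\<forall>x \<in> carrier (D \<boxtimes>\<^bsub>S\<^esub> M).
            (lwhisker R M C (C \<boxtimes>\<^bsub>R\<^esub> C) (comult X) \<circ> \<gamma>) x =
            (tensor_assoc_inv R R M C C \<circ> rwhisker R (D \<boxtimes>\<^bsub>S\<^esub> M) (M \<boxtimes>\<^bsub>R\<^esub> C) C \<gamma> \<circ>
             tensor_assoc S R D M C \<circ> lwhisker S D (D \<boxtimes>\<^bsub>S\<^esub> M) (M \<boxtimes>\<^bsub>R\<^esub> C) \<gamma> \<circ>
             tensor_assoc_inv S S D D M \<circ> rwhisker S D (D \<boxtimes>\<^bsub>S\<^esub> D) M (comult Y)) x) \<and>
         (\<forall>x \<in> carrier (D \<boxtimes>\<^bsub>S\<^esub> M).
            (right_unit R M \<circ> lwhisker R M C (ring_bimod R) (counit X) \<circ> \<gamma>) x =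
            (left_unit S M \<circ> rwhisker S D (ring_bimod S) M (counit Y)) x))"

definition entw_one_cells :: "'u entwining \<Rightarrow> 'u entwining \<Rightarrow> 'u entw_cell set" where
  "entw_one_cells X Y = {F.
     cmod F \<in> one_cells Bim (base X) (base Y) \<and>
     calg F \<in> bimod_hom (base Y) (base X)
       (alg Y \<boxtimes>\<^bsub>base Y\<^esub> cmod F) (cmod F \<boxtimes>\<^bsub>base X\<^esub> alg X) \<and>
     ccoalg F \<in> bimod_hom (base Y) (base X)
       (coalg Y \<boxtimes>\<^bsub>base Y\<^esub> cmod F) (cmod F \<boxtimes>\<^bsub>base X\<^esub> coalg X) \<and>
     hexagon_cond X Y F \<and> alg_conds X Y F \<and> coalg_conds X Y F}"

definition entw_two_cells ::
    "'u entwining \<Rightarrow> 'u entwining \<Rightarrow> 'u entw_cell \<Rightarrow> 'u entw_cell \<Rightarrow> ('u \<Rightarrow> 'u) set" where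
  "entw_two_cells X Y F G =
     (let R = base X; A = alg X; C = coalg X; S = base Y; B = alg Y; D = coalg Y;
          M = cmod F; N = cmod G
      in {\<theta> \<in> two_cells Bim R S M N.
           (\<forall>x \<in> carrier (B \<boxtimes>\<^bsub>S\<^esub> M).
              (rwhisker R M N A \<theta> \<circ> calg F) x = (calg G \<circ> lwhisker S B M N \<theta>) x) \<and>
           (\<forall>x \<in> carrier (D \<boxtimes>\<^bsub>S\<^esub> M).
              (rwhisker R M N C \<theta> \<circ> ccoalg F) x = (ccoalg G \<circ> lwhisker S D M N \<theta>) x)})"

text \<open>\<open>(P \<otimes> \<alpha>) \<circ> (\<sigma> \<otimes> M) : E \<boxtimes>\<^bsub>U\<^esub> (P \<boxtimes>\<^bsub>S\<^esub> M) \<rightarrow> (P \<boxtimes>\<^bsub>S\<^esub> M) \<boxtimes>\<^bsub>R\<^esub> A\<close> for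
  \<open>\<alpha> : B \<boxtimes>\<^bsub>S\<^esub> M \<rightarrow> M \<boxtimes>\<^bsub>R\<^esub> A\<close> and \<open>\<sigma> : E \<boxtimes>\<^bsub>U\<^esub> P \<rightarrow> P \<boxtimes>\<^bsub>S\<^esub> B\<close>.\<close>

definition paste ::
    "'u ring \<Rightarrow> 'u ring \<Rightarrow> 'u ring \<Rightarrow> 'u bimod \<Rightarrow> 'u bimod \<Rightarrow> 'u bimod \<Rightarrow>
     'u bimod \<Rightarrow> 'u bimod \<Rightarrow> ('u \<Rightarrow> 'u) \<Rightarrow> ('u \<Rightarrow> 'u) \<Rightarrow> 'u \<Rightarrow> 'u" where
  "paste R S U A B E P M \<sigma> \<alpha> =
     restrict
       (tensor_assoc S R P M A \<circ> lwhisker S P (B \<boxtimes>\<^bsub>S\<^esub> M) (M \<boxtimes>\<^bsub>R\<^esub> A) \<alpha> \<circ>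
        tensor_assoc_inv S S P B M \<circ> rwhisker S (E \<boxtimes>\<^bsub>U\<^esub> P) (P \<boxtimes>\<^bsub>S\<^esub> B) M \<sigma> \<circ>
        tensor_assoc U S E P M)
       (carrier (E \<boxtimes>\<^bsub>U\<^esub> (P \<boxtimes>\<^bsub>S\<^esub> M)))"

definition entw_comp1 ::
    "'u entwining \<Rightarrow> 'u entwining \<Rightarrow> 'u entwining \<Rightarrow> 'u entw_cell \<Rightarrow> 'u entw_cell \<Rightarrow> 'u entw_cell"
  where
  "entw_comp1 X Y Z G F =
     \<lparr>cmod = comp1 Bim (base X) (base Y) (base Z) (cmod G) (cmod F),
      calg = paste (base X) (base Y) (base Z) (alg X) (alg Y) (alg Z)
               (cmod G) (cmod F) (calg G) (calg F),
      ccoalg = paste (base X) (base Y) (base Z) (coalg X) (coalg Y) (coalg Z)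
               (cmod G) (cmod F) (ccoalg G) (ccoalg F)\<rparr>"

definition entw_id1 :: "'u entwining \<Rightarrow> 'u entw_cell" where
  "entw_id1 X =
     \<lparr>cmod = id1 Bim (base X),
      calg = compose (carrier (alg X \<boxtimes>\<^bsub>base X\<^esub> ring_bimod (base X)))
               (left_unit_inv (base X) (alg X)) (right_unit (base X) (alg X)),
      ccoalg = compose (carrier (coalg X \<boxtimes>\<^bsub>base X\<^esub> ring_bimod (base X)))
               (left_unit_inv (base X) (coalg X)) (right_unit (base X) (coalg X))\<rparr>"

definition entw :: "('u entwining, 'u entw_cell, 'u \<Rightarrow> 'u) bicat" where
  "entw =
     \<lparr>zero_cells = {X. is_entwining X},
      one_cells = entw_one_cells,
      two_cells = entw_two_cells,
      id1 = entw_id1,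
      comp1 = entw_comp1,
      id2 = (\<lambda>X Y F. id2 Bim (base X) (base Y) (cmod F)),
      vcomp = (\<lambda>X Y F G H. vcomp Bim (base X) (base Y) (cmod F) (cmod G) (cmod H)),
      hcomp = (\<lambda>X Y Z G G' F F'.
        hcomp Bim (base X) (base Y) (base Z) (cmod G) (cmod G') (cmod F) (cmod F')),
      assoc2 = (\<lambda>W X Y Z H G F.
        assoc2 Bim (base W) (base X) (base Y) (base Z) (cmod H) (cmod G) (cmod F)),
      lunit2 = (\<lambda>X Y F. lunit2 Bim (base X) (base Y) (cmod F)),
      runit2 = (\<lambda>X Y F. runit2 Bim (base X) (base Y) (cmod F))\<rparr>"

definition entw_comm :: "('u entwining, 'u entw_cell, 'u \<Rightarrow> 'u) bicat" where
  "entw_comm = entw\<lparr>zero_cells := {X. is_comm_entwining X}\<rparr>"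

end

theory Submission
  imports Defs
begin

text \<open>
  A 1-cell of \<open>entw\<close> is a bimodule with two structure maps, a 2-cell is a bimodule map that commutes
  with these maps, and all operations and constraints are those of the bicategory \<open>Bim\<close> of rings and
  bimodules. The statement therefore splits into two parts: \<open>Bim\<close> is a bicategory, and the cells
  of \<open>entw\<close> are closed under its operations and contain its constraints. The entwinings over
  commutative rings span a full sub-bicategory of \<open>entw\<close> (\<open>bicategory_full\<close>).

  For the first part (\<open>bicategory_Bim\<close>), the tensor product is shown to be a bimodule with the expected
  universal property (\<open>tensor_lift\<close>). As pure tensors generate it additively (\<open>tensor_induct\<close>),
  two additive maps that agree on iterated pure tensors are equal (\<open>tensor_ext\<close>, \<open>tensor3_ext\<close>,
  \<open>tensor4_ext\<close>), and on these the coherence laws are immediate.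

  At the heart of the second part are the axioms for the composite of 1-cells \<open>(M, \<alpha>, \<gamma>)\<close> and
  \<open>(P, \<sigma>, \<tau>)\<close>. On string diagrams each follows by applying the corresponding axiom once for \<open>P\<close> and once for \<open>M\<close>.
  In order not to carry associativity isomorphisms along, a map \<open>f : X \<otimes> Y \<rightarrow> X' \<otimes> Y'\<close> is extended to a
  map \<open>X \<otimes> (Y \<otimes> Z) \<rightarrow> X' \<otimes> (Y' \<otimes> Z)\<close> that is natural in \<open>Z\<close> (\<open>extend_map\<close>), and
  all axioms are read as equations between whiskered and extended maps. The extension of a
  composite structure map is the composite of the extensions (\<open>paste_extend\<close>), so the axioms for the
  composite reduce to those for \<open>M\<close> under \<open>P \<otimes> \<hyphen>\<close> and those for \<open>P\<close> tensored with \<open>M\<close>. The latter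
  follow from the axioms for \<open>P\<close> because \<open>x \<otimes> (y \<otimes> z)\<close> is the image of \<open>x \<otimes> y\<close> under
  \<open>X \<otimes> (\<hyphen> \<otimes> z)\<close>, and extended maps commute with this left linear map (\<open>extend_map_tensor_right\<close>,
  \<open>extend_map_natural\<close>). This gives \<open>paste_mult\<close>, \<open>paste_unit\<close>, \<open>paste_comult\<close>, \<open>paste_counit\<close>
  and \<open>paste_hexagon\<close>; the compatibility of 2-cells and constraints with composite structure maps
  (\<open>paste_two_cell\<close>, \<open>paste_assoc\<close>, \<open>paste_left_unit\<close>, \<open>paste_right_unit\<close>) is shown in the same way.
\<close>

notation tensor (\<open>(_ \<boxtimes>\<^sub>_/ _)\<close> [66, 1000, 66] 65)

abbreviation "tensor_elt3 S R X Y Z x y z \<equiv> tensor_elt S X (Y \<boxtimes>\<^sub>R Z) x (tensor_elt R Y Z y z)"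

section \<open>One-sided modules\<close>

text \<open>
  A tensor product over \<open>S\<close> involves one action on each factor, and some of the maps below, such as
  tensoring with a fixed element, are linear on one side only. The ring acting on the other side
  is therefore quantified away; this also leaves no ring undetermined when a hypothesis is
  matched against a module.
\<close>

definition lmod :: "'u ring \<Rightarrow> 'u bimod \<Rightarrow> bool" where
  "lmod S M \<longleftrightarrow> (\<exists>R. bimodule S R M)"

definition rmod :: "'u ring \<Rightarrow> 'u bimod \<Rightarrow> bool" where
  "rmod R M \<longleftrightarrow> (\<exists>S. bimodule S R M)"

lemma bimodule_lmod: "bimodule S R M \<Longrightarrow> lmod S M"
  and bimodule_rmod: "bimodule S R M \<Longrightarrow> rmod R M"
  by (auto simp: lmod_def rmod_def)

lemma bimodule_rings:
  assumes "bimodule S R M" shows "ring S" "ring R" "abelian_group M"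
proof -
  interpret bimodule S R M by fact
  show "ring S" "ring R" "abelian_group M" by unfold_locales
qed

lemma lmod_group: "lmod S M \<Longrightarrow> abelian_group M"
  and rmod_group: "rmod R M \<Longrightarrow> abelian_group M"
  and lmod_ring: "lmod S M \<Longrightarrow> ring S"
  and rmod_ring: "rmod R M \<Longrightarrow> ring R"
  by (auto simp: lmod_def rmod_def dest: bimodule_rings)

lemma lmod_closed [simp]: "\<lbrakk>lmod S M; s \<in> carrier S; x \<in> carrier M\<rbrakk> \<Longrightarrow> s \<odot>\<^bsub>M\<^esub> x \<in> carrier M"
  and rmod_closed [simp]: "\<lbrakk>rmod R M; r \<in> carrier R; x \<in> carrier M\<rbrakk> \<Longrightarrow> x \<odot>r\<^bsub>M\<^esub> r \<in> carrier M"
  by (auto simp: lmod_def rmod_def bimodule.smult_closed bimodule.rsmult_closed)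

lemma group_closed [simp]:
  assumes "abelian_group M"
  shows "\<lbrakk>x \<in> carrier M; y \<in> carrier M\<rbrakk> \<Longrightarrow> x \<oplus>\<^bsub>M\<^esub> y \<in> carrier M" "\<zero>\<^bsub>M\<^esub> \<in> carrier M"
    "x \<in> carrier M \<Longrightarrow> \<ominus>\<^bsub>M\<^esub> x \<in> carrier M"
  using abelian_group.axioms(1)[OF assms]
  by (auto intro: abelian_monoid.a_closed abelian_monoid.zero_closed
    abelian_group.a_inv_closed[OF assms])

lemma lmod_simps:
  assumes "lmod S M"
  shows "\<lbrakk>s \<in> carrier S; t \<in> carrier S; x \<in> carrier M\<rbrakk>
      \<Longrightarrow> (s \<oplus>\<^bsub>S\<^esub> t) \<odot>\<^bsub>M\<^esub> x = s \<odot>\<^bsub>M\<^esub> x \<oplus>\<^bsub>M\<^esub> t \<odot>\<^bsub>M\<^esub> x"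
    "\<lbrakk>s \<in> carrier S; x \<in> carrier M; y \<in> carrier M\<rbrakk>
      \<Longrightarrow> s \<odot>\<^bsub>M\<^esub> (x \<oplus>\<^bsub>M\<^esub> y) = s \<odot>\<^bsub>M\<^esub> x \<oplus>\<^bsub>M\<^esub> s \<odot>\<^bsub>M\<^esub> y"
    "\<lbrakk>s \<in> carrier S; t \<in> carrier S; x \<in> carrier M\<rbrakk>
      \<Longrightarrow> (s \<otimes>\<^bsub>S\<^esub> t) \<odot>\<^bsub>M\<^esub> x = s \<odot>\<^bsub>M\<^esub> (t \<odot>\<^bsub>M\<^esub> x)"
    "x \<in> carrier M \<Longrightarrow> \<one>\<^bsub>S\<^esub> \<odot>\<^bsub>M\<^esub> x = x"
  using assms unfolding lmod_def
  by (auto simp: bimodule.smult_l_distr bimodule.smult_r_distr bimodule.smult_assoc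
    bimodule.smult_one)

lemma rmod_simps:
  assumes "rmod R M"
  shows "\<lbrakk>r \<in> carrier R; t \<in> carrier R; x \<in> carrier M\<rbrakk>
      \<Longrightarrow> x \<odot>r\<^bsub>M\<^esub> (r \<oplus>\<^bsub>R\<^esub> t) = x \<odot>r\<^bsub>M\<^esub> r \<oplus>\<^bsub>M\<^esub> x \<odot>r\<^bsub>M\<^esub> t"
    "\<lbrakk>r \<in> carrier R; x \<in> carrier M; y \<in> carrier M\<rbrakk>
      \<Longrightarrow> (x \<oplus>\<^bsub>M\<^esub> y) \<odot>r\<^bsub>M\<^esub> r = x \<odot>r\<^bsub>M\<^esub> r \<oplus>\<^bsub>M\<^esub> y \<odot>r\<^bsub>M\<^esub> r"
    "\<lbrakk>r \<in> carrier R; t \<in> carrier R; x \<in> carrier M\<rbrakk>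
      \<Longrightarrow> x \<odot>r\<^bsub>M\<^esub> (r \<otimes>\<^bsub>R\<^esub> t) = (x \<odot>r\<^bsub>M\<^esub> r) \<odot>r\<^bsub>M\<^esub> t"
    "x \<in> carrier M \<Longrightarrow> x \<odot>r\<^bsub>M\<^esub> \<one>\<^bsub>R\<^esub> = x"
  using assms unfolding rmod_def
  by (auto simp: bimodule.rsmult_l_distr bimodule.rsmult_r_distr bimodule.rsmult_assoc
    bimodule.rsmult_one)

lemma ring_bimod_simps [simp]:
  "carrier (ring_bimod R) = carrier R" "s \<odot>\<^bsub>ring_bimod R\<^esub> x = s \<otimes>\<^bsub>R\<^esub> x"
  "x \<odot>r\<^bsub>ring_bimod R\<^esub> s = x \<otimes>\<^bsub>R\<^esub> s" "x \<oplus>\<^bsub>ring_bimod R\<^esub> y = x \<oplus>\<^bsub>R\<^esub> y"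
  by (simp_all add: ring_bimod_def)

lemma bimodule_ring_bimod [simp]:
  assumes "ring R" shows "bimodule R R (ring_bimod R)"
proof -
  interpret ring R by fact
  have "abelian_group (ring_bimod R)"
    by (rule abelian_groupI)
      (auto simp: ring_bimod_def a_ac intro: add.l_inv_ex)
  then show ?thesis
    by (intro bimodule.intro ring_axioms)
      (auto simp: bimodule_axioms_def l_distr r_distr m_assoc)
qed

section \<open>Additive and linear maps\<close>

text \<open>
  In contrast to the elements of \<open>bimod_hom\<close>, these maps may have any values outside the carrier, so
  that plain composites of functions are again linear maps.
\<close>

definition additive :: "'u bimod \<Rightarrow> 'u bimod \<Rightarrow> ('u \<Rightarrow> 'u) \<Rightarrow> bool" where
  "additive M N f \<longleftrightarrow> f \<in> carrier M \<rightarrow> carrier N \<and>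
     (\<forall>x \<in> carrier M. \<forall>y \<in> carrier M. f (x \<oplus>\<^bsub>M\<^esub> y) = f x \<oplus>\<^bsub>N\<^esub> f y)"

definition llin :: "'u ring \<Rightarrow> 'u bimod \<Rightarrow> 'u bimod \<Rightarrow> ('u \<Rightarrow> 'u) \<Rightarrow> bool" where
  "llin S M N f \<longleftrightarrow> additive M N f \<and>
     (\<forall>s \<in> carrier S. \<forall>x \<in> carrier M. f (s \<odot>\<^bsub>M\<^esub> x) = s \<odot>\<^bsub>N\<^esub> f x)"

definition rlin :: "'u ring \<Rightarrow> 'u bimod \<Rightarrow> 'u bimod \<Rightarrow> ('u \<Rightarrow> 'u) \<Rightarrow> bool" where
  "rlin R M N f \<longleftrightarrow> additive M N f \<and>
     (\<forall>x \<in> carrier M. \<forall>r \<in> carrier R. f (x \<odot>r\<^bsub>M\<^esub> r) = f x \<odot>r\<^bsub>N\<^esub> r)"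

lemma additive_closed: "\<lbrakk>additive M N f; x \<in> carrier M\<rbrakk> \<Longrightarrow> f x \<in> carrier N"
  and additive_add: "\<lbrakk>additive M N f; x \<in> carrier M; y \<in> carrier M\<rbrakk>
     \<Longrightarrow> f (x \<oplus>\<^bsub>M\<^esub> y) = f x \<oplus>\<^bsub>N\<^esub> f y"
  by (auto simp: additive_def)

lemma llin_additive: "llin S M N f \<Longrightarrow> additive M N f"
  and rlin_additive: "rlin R M N f \<Longrightarrow> additive M N f"
  by (auto simp: llin_def rlin_def)

lemma llin_smult: "\<lbrakk>llin S M N f; s \<in> carrier S; x \<in> carrier M\<rbrakk> \<Longrightarrow> f (s \<odot>\<^bsub>M\<^esub> x) = s \<odot>\<^bsub>N\<^esub> f x"
  and rlin_smult: "\<lbrakk>rlin R M N f; r \<in> carrier R; x \<in> carrier M\<rbrakk> \<Longrightarrow> f (x \<odot>r\<^bsub>M\<^esub> r) = f x \<odot>r\<^bsub>N\<^esub> r"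
  by (auto simp: llin_def rlin_def)

lemma bimod_hom_iff:
  "f \<in> bimod_hom S R M N \<longleftrightarrow> llin S M N f \<and> rlin R M N f \<and> f \<in> extensional (carrier M)"
  by (auto simp: bimod_hom_def additive_hom_def llin_def rlin_def additive_def PiE_def)

lemma additive_hom_iff: "f \<in> additive_hom M N \<longleftrightarrow> additive M N f \<and> f \<in> extensional (carrier M)"
  by (auto simp: additive_hom_def additive_def PiE_def)

lemma llin_comp: "\<lbrakk>llin S L M f; llin S M N g\<rbrakk> \<Longrightarrow> llin S L N (g \<circ> f)"
  and rlin_comp: "\<lbrakk>rlin R L M f; rlin R M N g\<rbrakk> \<Longrightarrow> rlin R L N (g \<circ> f)"
  by (auto simp: additive_def llin_def rlin_def Pi_iff)

lemma additive_id: "additive M M (\<lambda>x. x)"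
  by (simp add: additive_def)

lemma additive_comp: "\<lbrakk>additive L M f; additive M N g\<rbrakk> \<Longrightarrow> additive L N (\<lambda>x. g (f x))"
  by (auto simp: additive_def Pi_iff)

section \<open>Tensor products\<close>

lemma tensor_rel_uminus: "u \<in> tensor_rel S P M \<Longrightarrow> - u \<in> tensor_rel S P M"
  using tensor_rel.diff[OF tensor_rel.zero] by fastforce

lemma tensor_rel_add: "\<lbrakk>u \<in> tensor_rel S P M; v \<in> tensor_rel S P M\<rbrakk> \<Longrightarrow> u + v \<in> tensor_rel S P M"
  using tensor_rel.diff[OF _ tensor_rel_uminus] by fastforce

abbreviation (input) formal :: "'u bimod \<Rightarrow> 'u bimod \<Rightarrow> ('u \<times> 'u \<Rightarrow>\<^sub>0 int) set" where
  "formal P M \<equiv> {u. Poly_Mapping.keys u \<subseteq> carrier P \<times> carrier M}"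

lemma keys_diff_subset: "\<lbrakk>Poly_Mapping.keys u \<subseteq> A; Poly_Mapping.keys v \<subseteq> A\<rbrakk> \<Longrightarrow>
    Poly_Mapping.keys (u - v :: 'a \<Rightarrow>\<^sub>0 int) \<subseteq> A"
  using keys_diff[of u v] by blast

lemma keys_add_subset: "\<lbrakk>Poly_Mapping.keys u \<subseteq> A; Poly_Mapping.keys v \<subseteq> A\<rbrakk> \<Longrightarrow>
    Poly_Mapping.keys (u + v :: 'a \<Rightarrow>\<^sub>0 int) \<subseteq> A"
  using keys_add[of u v] by blast

lemma tensor_rel_keys:
  assumes "rmod S P" "lmod S M" "u \<in> tensor_rel S P M"
  shows "Poly_Mapping.keys u \<subseteq> carrier P \<times> carrier M"
  using assms(3)
proof induction
  case (add_left p q m)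
  then show ?case
    using rmod_group[OF assms(1)] by (intro keys_diff_subset) simp_all
next
  case (add_right p m n)
  then show ?case
    using lmod_group[OF assms(2)] by (intro keys_diff_subset) simp_all
next
  case (balanced p s m)
  then show ?case
    using assms(1,2) by (intro keys_diff_subset) simp_all
qed (simp_all add: keys_diff_subset)

text \<open>An infinite \<open>'u\<close> has as many elements as there are formal sums of pairs of its elements. This
  makes \<open>encode\<close> injective, so that a tensor can be decoded to a formal sum that represents it.\<close>

locale universe =
  fixes type_of_universe :: "'u itself"
  assumes infinite_universe: "infinite (UNIV :: 'u set)"
begin

lemma inj_encode: "inj (encode :: ('u \<times> 'u \<Rightarrow>\<^sub>0 int) \<Rightarrow> 'u)"
proof -
  have "infinite (UNIV :: ('u \<times> 'u) set)"
    using infinite_universe by (simp add: finite_prod)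
  then have "(UNIV :: ('u \<times> 'u \<Rightarrow>\<^sub>0 int) set) \<approx> (UNIV :: ('u \<times> 'u) set)"
    using eqpoll_free_Abelian_group_infinite[of "UNIV :: ('u \<times> 'u) set"]
    by (simp add: free_Abelian_group_def)
  also have "(UNIV :: ('u \<times> 'u) set) \<approx> (UNIV :: 'u set)"
    using card_of_Times_same_infinite[OF infinite_universe]
    by (simp add: eqpoll_iff_card_of_ordIso)
  finally obtain e :: "('u \<times> 'u \<Rightarrow>\<^sub>0 int) \<Rightarrow> 'u" where "inj e"
    by (auto simp: eqpoll_def bij_betw_def)
  then show ?thesis
    unfolding encode_def by (rule someI[where P = inj])
qed

lemma decode_encode [simp]: "decode (encode u :: 'u) = u"
  unfolding decode_def by (simp add: inj_encode)

lemma decode_class: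
  fixes S :: "'u ring"
  shows "decode (tensor_class S P M u) - u \<in> tensor_rel S P M"
  unfolding tensor_class_def
  by simp (rule someI[where x = u], simp add: tensor_rel.zero)

lemma class_eq:
  fixes S :: "'u ring"
  shows "tensor_class S P M u = tensor_class S P M v \<longleftrightarrow> u - v \<in> tensor_rel S P M"
proof
  assume "tensor_class S P M u = tensor_class S P M v"
  then show "u - v \<in> tensor_rel S P M"
    using tensor_rel.diff[OF decode_class[of S P M v] decode_class[of S P M u]] by simp
next
  assume uv: "u - v \<in> tensor_rel S P M"
  have "w - u \<in> tensor_rel S P M \<longleftrightarrow> w - v \<in> tensor_rel S P M" for w
    using tensor_rel_add[OF _ uv, of "w - u"] tensor_rel.diff[OF _ uv, of "w - v"] by auto
  then show "tensor_class S P M u = tensor_class S P M v"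
    by (simp add: tensor_class_def)
qed

lemma class_decode_add:
  fixes S :: "'u ring"
  shows "tensor_class S P M (decode (tensor_class S P M u) + decode (tensor_class S P M v)) =
    tensor_class S P M (u + v)"
  unfolding class_eq
  using tensor_rel_add[OF decode_class decode_class, of S P M u v] by (simp add: algebra_simps)

lemma carrier_tensor: "carrier (P \<boxtimes>\<^sub>S M) = tensor_class S P M ` formal P M"
  and add_tensor: "t \<oplus>\<^bsub>P \<boxtimes>\<^sub>S M\<^esub> t' = tensor_class S P M (decode t + decode t')"
  and zero_tensor: "\<zero>\<^bsub>P \<boxtimes>\<^sub>S M\<^esub> = tensor_class S P M 0"
  and smult_tensor: "s \<odot>\<^bsub>P \<boxtimes>\<^sub>S M\<^esub> t = tensor_class S P M
                 (frag_extend (\<lambda>(p, m). frag_of (s \<odot>\<^bsub>P\<^esub> p, m)) (decode t))"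
  and rsmult_tensor: "t \<odot>r\<^bsub>P \<boxtimes>\<^sub>S M\<^esub> r = tensor_class S P M
                 (frag_extend (\<lambda>(p, m). frag_of (p, m \<odot>r\<^bsub>M\<^esub> r)) (decode t))"
  by (simp_all add: tensor_def)

lemma add_class:
  fixes S :: "'u ring"
  shows "tensor_class S P M u \<oplus>\<^bsub>P \<boxtimes>\<^sub>S M\<^esub> tensor_class S P M v = tensor_class S P M (u + v)"
  by (simp add: add_tensor class_decode_add)

lemma decode_keys:
  fixes S :: "'u ring"
  assumes "rmod S P" "lmod S M" "t \<in> carrier (P \<boxtimes>\<^sub>S M)"
  shows "decode t \<in> formal P M"
proof -
  obtain u where u: "u \<in> formal P M" "t = tensor_class S P M u"
    using assms by (auto simp: carrier_tensor)
  have "decode t = (decode t - u) + u" by simp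
  then show ?thesis
    using tensor_rel_keys[OF assms(1,2) decode_class, of u] u
    by (metis (mono_tags, lifting) keys_add_subset mem_Collect_eq)
qed

lemma abelian_group_tensor [simp]:
  fixes S :: "'u ring"
  shows "abelian_group (P \<boxtimes>\<^sub>S M)"
proof (rule abelian_groupI)
  fix x assume "x \<in> carrier (P \<boxtimes>\<^sub>S M)"
  then obtain u where "u \<in> formal P M" "x = tensor_class S P M u"
    by (auto simp: carrier_tensor)
  then show "\<exists>y \<in> carrier (P \<boxtimes>\<^sub>S M). y \<oplus>\<^bsub>P \<boxtimes>\<^sub>S M\<^esub> x = \<zero>\<^bsub>P \<boxtimes>\<^sub>S M\<^esub>"
    by (intro bexI[of _ "tensor_class S P M (- u)"])
      (auto simp: add_class zero_tensor carrier_tensor)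
qed (auto simp: carrier_tensor add_class zero_tensor ac_simps keys_add_subset
     intro!: imageI)

lemma elt_closed [simp]:
  fixes S :: "'u ring"
  assumes "p \<in> carrier P" "m \<in> carrier M"
  shows "tensor_elt S P M p m \<in> carrier (P \<boxtimes>\<^sub>S M)"
  using assms by (auto simp: tensor_elt_def carrier_tensor)

lemma elt_add_left:
  fixes S :: "'u ring"
  assumes "p \<in> carrier P" "q \<in> carrier P" "m \<in> carrier M"
  shows "tensor_elt S P M (p \<oplus>\<^bsub>P\<^esub> q) m =
    tensor_elt S P M p m \<oplus>\<^bsub>P \<boxtimes>\<^sub>S M\<^esub> tensor_elt S P M q m"
  using tensor_rel.add_left[OF assms, of S]
  by (auto simp: tensor_elt_def add_class class_eq algebra_simps)

lemma elt_add_right: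
  fixes S :: "'u ring"
  assumes "p \<in> carrier P" "m \<in> carrier M" "n \<in> carrier M"
  shows "tensor_elt S P M p (m \<oplus>\<^bsub>M\<^esub> n) =
    tensor_elt S P M p m \<oplus>\<^bsub>P \<boxtimes>\<^sub>S M\<^esub> tensor_elt S P M p n"
  using tensor_rel.add_right[OF assms, of S]
  by (auto simp: tensor_elt_def add_class class_eq algebra_simps)

lemma elt_balanced:
  fixes S :: "'u ring"
  assumes "p \<in> carrier P" "s \<in> carrier S" "m \<in> carrier M"
  shows "tensor_elt S P M (p \<odot>r\<^bsub>P\<^esub> s) m = tensor_elt S P M p (s \<odot>\<^bsub>M\<^esub> m)"
  using tensor_rel.balanced[OF assms]
  by (auto simp: tensor_elt_def class_eq)

text \<open>As \<open>- (p \<otimes> m) = (- p) \<otimes> m\<close>, sums of pure tensors exhaust the tensor product.\<close>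

lemma tensor_induct:
  fixes S :: "'u ring"
  assumes P: "abelian_group P" and M: "abelian_group M" and t: "t \<in> carrier (P \<boxtimes>\<^sub>S M)"
    and elt: "\<And>p m. \<lbrakk>p \<in> carrier P; m \<in> carrier M\<rbrakk> \<Longrightarrow> Q (tensor_elt S P M p m)"
    and add: "\<And>x y. \<lbrakk>x \<in> carrier (P \<boxtimes>\<^sub>S M); y \<in> carrier (P \<boxtimes>\<^sub>S M); Q x; Q y\<rbrakk>
        \<Longrightarrow> Q (x \<oplus>\<^bsub>P \<boxtimes>\<^sub>S M\<^esub> y)"
  shows "Q t"
proof -
  let ?T = "P \<boxtimes>\<^sub>S M" and ?c = "tensor_class S P M"
  interpret P: abelian_group P by fact
  interpret T: abelian_group ?T by simp
  have zero: "tensor_elt S P M \<zero>\<^bsub>P\<^esub> m = \<zero>\<^bsub>?T\<^esub>" if "m \<in> carrier M" for m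
    using elt_add_left[of "\<zero>\<^bsub>P\<^esub>" P "\<zero>\<^bsub>P\<^esub>" m M S] that
    by simp
  have neg: "?c (- frag_of (p, m)) = tensor_elt S P M (\<ominus>\<^bsub>P\<^esub> p) m"
    if "p \<in> carrier P" "m \<in> carrier M" for p m
  proof -
    have "tensor_elt S P M (\<ominus>\<^bsub>P\<^esub> p) m \<oplus>\<^bsub>?T\<^esub> tensor_elt S P M p m = \<zero>\<^bsub>?T\<^esub>"
      using that elt_add_left[of "\<ominus>\<^bsub>P\<^esub> p" P p m M S] zero[of m] by (simp add: P.l_neg)
    then have "- (frag_of (\<ominus>\<^bsub>P\<^esub> p, m) + frag_of (p, m)) \<in> tensor_rel S P M"
      by (intro tensor_rel_uminus) (simp add: tensor_elt_def add_class zero_tensor class_eq)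
    moreover have "- (frag_of (\<ominus>\<^bsub>P\<^esub> p, m) + frag_of (p, m)) =
        - frag_of (p, m) - frag_of (\<ominus>\<^bsub>P\<^esub> p, m)" by simp
    ultimately show ?thesis
      by (simp only: tensor_elt_def class_eq)
  qed
  have "u \<in> formal P M \<and> (\<forall>v \<in> formal P M. Q (?c v) \<longrightarrow>
      Q (?c (v + u)) \<and> Q (?c (v - u)))"
    if "Poly_Mapping.keys u \<subseteq> carrier P \<times> carrier M" for u
    using that
  proof (induction u rule: frag_induction)
    case zero then show ?case by simp
  next
    case (one x)
    obtain p m where x: "x = (p, m)" "p \<in> carrier P" "m \<in> carrier M" using one by auto
    have "Q (?c (v + w))"
      if "v \<in> formal P M" "Q (?c v)" "w = frag_of x \<or> w = - frag_of x" for v w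
    proof -
      have "Q (?c w)" "w \<in> formal P M"
        using that(3) x neg[of p m] elt[of p m] elt[of "\<ominus>\<^bsub>P\<^esub> p" m]
        by (auto simp: tensor_elt_def)
      then show ?thesis
        using add[of "?c v" "?c w"] that
        by (auto simp: add_class carrier_tensor)
    qed
    from this[of _ "frag_of x"] this[of _ "- frag_of x"]
    have "Q (?c (v + frag_of x)) \<and> Q (?c (v - frag_of x))"
      if "v \<in> formal P M" "Q (?c v)" for v
      using that by simp
    then show ?case using one by simp
  next
    case (diff a b)
    have *: "v + a \<in> formal P M" "v - a \<in> formal P M" if "v \<in> formal P M" for v
      using diff that by (simp_all add: keys_add_subset keys_diff_subset)
    have "Q (?c (v + (a - b))) \<and> Q (?c (v - (a - b)))"
      if v: "v \<in> formal P M" "Q (?c v)" for v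
    proof -
      have "Q (?c (v + a))" "Q (?c (v - a))" 
        using diff v by blast+
      then have "Q (?c (v + a - b))" "Q (?c (v - a + b))"
        using diff *[OF v(1)] by blast+
      then show ?thesis by (simp add: algebra_simps)
    qed
    then show ?case using diff by (simp add: keys_diff_subset)
  qed
  moreover have "Q (?c 0)"
    using elt[OF P.zero_closed, of "\<zero>\<^bsub>M\<^esub>"] zero[of "\<zero>\<^bsub>M\<^esub>"] M by (simp add: zero_tensor)
  ultimately have "Q (?c (0 + u))" if "u \<in> formal P M" for u
    using that by (metis (mono_tags, lifting) empty_subsetI keys_zero mem_Collect_eq)
  then show "Q t"
    using t by (auto simp: carrier_tensor)
qed

lemma tensor_ext:
  fixes S :: "'u ring"
  assumes "abelian_group P" "abelian_group M" "t \<in> carrier (P \<boxtimes>\<^sub>S M)"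
    and "additive (P \<boxtimes>\<^sub>S M) N f" "additive (P \<boxtimes>\<^sub>S M) N g"
    and "\<And>p m. \<lbrakk>p \<in> carrier P; m \<in> carrier M\<rbrakk> \<Longrightarrow> f (tensor_elt S P M p m) = g (tensor_elt S P M p m)"
  shows "f t = g t"
  using assms(1-3) by (rule tensor_induct) (use assms(4-) in \<open>auto simp: additive_add\<close>)

lemma smult_class:
  fixes S :: "'u ring"
  assumes P: "bimodule U S P" and s: "s \<in> carrier U"
  shows "s \<odot>\<^bsub>P \<boxtimes>\<^sub>S M\<^esub> tensor_class S P M u =
    tensor_class S P M (frag_extend (\<lambda>(p, m). frag_of (s \<odot>\<^bsub>P\<^esub> p, m)) u)" (is "_ = tensor_class S P M (?F u)")
proof -
  interpret bimodule U S P by fact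
  have "?F w \<in> tensor_rel S P M" if "w \<in> tensor_rel S P M" for w
    using that
    by induction (use s in \<open>auto simp: frag_extend_diff smult_r_distr smult_rsmult[symmetric]
      smult_closed intro: tensor_rel.intros\<close>)
  from this[OF decode_class[of S P M u]] show ?thesis
    by (simp add: smult_tensor class_eq frag_extend_diff)
qed

lemma rsmult_class:
  fixes S :: "'u ring"
  assumes M: "bimodule S R M" and r: "r \<in> carrier R"
  shows "tensor_class S P M u \<odot>r\<^bsub>P \<boxtimes>\<^sub>S M\<^esub> r =
    tensor_class S P M (frag_extend (\<lambda>(p, m). frag_of (p, m \<odot>r\<^bsub>M\<^esub> r)) u)" (is "_ = tensor_class S P M (?F u)")
proof -
  interpret bimodule S R M by fact
  have "?F w \<in> tensor_rel S P M" if "w \<in> tensor_rel S P M" for w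
    using that
    by induction (use r in \<open>auto simp: frag_extend_diff rsmult_l_distr smult_rsmult
      rsmult_closed intro: tensor_rel.intros\<close>)
  from this[OF decode_class[of S P M u]] show ?thesis
    by (simp add: rsmult_tensor class_eq frag_extend_diff)
qed

lemma keys_frag_extend_subset:
  assumes "Poly_Mapping.keys u \<subseteq> A" "\<And>x. x \<in> A \<Longrightarrow> Poly_Mapping.keys (f x) \<subseteq> B"
  shows "Poly_Mapping.keys (frag_extend f u) \<subseteq> B"
  using keys_frag_extend[of f u] assms by blast

lemma smult_elt:
  fixes S :: "'u ring"
  assumes "bimodule U S P" "s \<in> carrier U"
  shows "s \<odot>\<^bsub>P \<boxtimes>\<^sub>S M\<^esub> tensor_elt S P M p m = tensor_elt S P M (s \<odot>\<^bsub>P\<^esub> p) m"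
  using assms by (simp add: tensor_elt_def smult_class)

lemma rsmult_elt:
  fixes S :: "'u ring"
  assumes "bimodule S R M" "r \<in> carrier R"
  shows "tensor_elt S P M p m \<odot>r\<^bsub>P \<boxtimes>\<^sub>S M\<^esub> r = tensor_elt S P M p (m \<odot>r\<^bsub>M\<^esub> r)"
  using assms by (simp add: tensor_elt_def rsmult_class)

lemma bimodule_tensor:
  fixes S :: "'u ring"
  assumes P: "bimodule U S P" and M: "bimodule S R M"
  shows "bimodule U R (P \<boxtimes>\<^sub>S M)"
proof -
  let ?T = "P \<boxtimes>\<^sub>S M"
  interpret P: bimodule U S P by fact
  interpret M: bimodule S R M by fact
  interpret T: abelian_group ?T by simp
  note groups = P.bimod.abelian_group_axioms M.bimod.abelian_group_axioms
  have l_closed: "s \<odot>\<^bsub>?T\<^esub> x \<in> carrier ?T"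
    if s: "s \<in> carrier U" and x: "x \<in> carrier ?T" for s x
  proof -
    obtain u where "u \<in> formal P M" "x = tensor_class S P M u"
      using x by (auto simp: carrier_tensor)
    moreover from this have "Poly_Mapping.keys (frag_extend (\<lambda>(p, m). frag_of (s \<odot>\<^bsub>P\<^esub> p, m)) u)
        \<subseteq> carrier P \<times> carrier M"
      by (intro keys_frag_extend_subset[where A = "carrier P \<times> carrier M"])
        (use s in \<open>auto simp: P.smult_closed\<close>)
    ultimately show ?thesis
      by (simp add: smult_class[OF P s] carrier_tensor)
  qed
  have r_closed: "x \<odot>r\<^bsub>?T\<^esub> s \<in> carrier ?T"
    if s: "s \<in> carrier R" and x: "x \<in> carrier ?T" for s x
  proof -
    obtain u where "u \<in> formal P M" "x = tensor_class S P M u"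
      using x by (auto simp: carrier_tensor)
    moreover from this have "Poly_Mapping.keys (frag_extend (\<lambda>(p, m). frag_of (p, m \<odot>r\<^bsub>M\<^esub> s)) u)
        \<subseteq> carrier P \<times> carrier M"
      by (intro keys_frag_extend_subset[where A = "carrier P \<times> carrier M"])
        (use s in \<open>auto simp: M.rsmult_closed\<close>)
    ultimately show ?thesis
      by (simp add: rsmult_class[OF M s] carrier_tensor)
  qed
  have l_add: "s \<odot>\<^bsub>?T\<^esub> (x \<oplus>\<^bsub>?T\<^esub> y) = s \<odot>\<^bsub>?T\<^esub> x \<oplus>\<^bsub>?T\<^esub> s \<odot>\<^bsub>?T\<^esub> y"
    if "s \<in> carrier U" "x \<in> carrier ?T" "y \<in> carrier ?T" for s x y
    using that by (auto simp: carrier_tensor add_class smult_class[OF P] frag_extend_add)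
  have r_add: "(x \<oplus>\<^bsub>?T\<^esub> y) \<odot>r\<^bsub>?T\<^esub> s = x \<odot>r\<^bsub>?T\<^esub> s \<oplus>\<^bsub>?T\<^esub> y \<odot>r\<^bsub>?T\<^esub> s"
    if "s \<in> carrier R" "x \<in> carrier ?T" "y \<in> carrier ?T" for s x y
    using that by (auto simp: carrier_tensor add_class rsmult_class[OF M] frag_extend_add)
  note [simp] = l_closed r_closed l_add r_add smult_elt[OF P] rsmult_elt[OF M]
    P.smult_closed M.rsmult_closed
  show ?thesis
  proof (intro bimodule.intro P.left.ring_axioms M.right.ring_axioms T.abelian_group_axioms
      bimodule_axioms.intro)
    fix s t x assume s: "s \<in> carrier U" "t \<in> carrier U"
      and x: "x \<in> carrier ?T"
    show "(s \<oplus>\<^bsub>U\<^esub> t) \<odot>\<^bsub>?T\<^esub> x = s \<odot>\<^bsub>?T\<^esub> x \<oplus>\<^bsub>?T\<^esub> t \<odot>\<^bsub>?T\<^esub> x"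
      using groups x by (rule tensor_induct)
        (use s in \<open>simp_all add: P.smult_l_distr elt_add_left T.a_ac\<close>)
    show "(s \<otimes>\<^bsub>U\<^esub> t) \<odot>\<^bsub>?T\<^esub> x = s \<odot>\<^bsub>?T\<^esub> (t \<odot>\<^bsub>?T\<^esub> x)"
      using groups x by (rule tensor_induct) (use s in \<open>simp_all add: P.smult_assoc\<close>)
  next
    fix x assume x: "x \<in> carrier ?T"
    show "\<one>\<^bsub>U\<^esub> \<odot>\<^bsub>?T\<^esub> x = x"
      using groups x by (rule tensor_induct) (simp_all add: P.smult_one)
    show "x \<odot>r\<^bsub>?T\<^esub> \<one>\<^bsub>R\<^esub> = x"
      using groups x by (rule tensor_induct) (simp_all add: M.rsmult_one)
  next
    fix s t x assume s: "s \<in> carrier R" "t \<in> carrier R"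
      and x: "x \<in> carrier ?T"
    show "x \<odot>r\<^bsub>?T\<^esub> (s \<oplus>\<^bsub>R\<^esub> t) = x \<odot>r\<^bsub>?T\<^esub> s \<oplus>\<^bsub>?T\<^esub> x \<odot>r\<^bsub>?T\<^esub> t"
      using groups x by (rule tensor_induct)
        (use s in \<open>simp_all add: M.rsmult_r_distr elt_add_right T.a_ac\<close>)
    show "x \<odot>r\<^bsub>?T\<^esub> (s \<otimes>\<^bsub>R\<^esub> t) = (x \<odot>r\<^bsub>?T\<^esub> s) \<odot>r\<^bsub>?T\<^esub> t"
      using groups x by (rule tensor_induct) (use s in \<open>simp_all add: M.rsmult_assoc\<close>)
  next
    fix s r x assume s: "s \<in> carrier U" "r \<in> carrier R"
      and x: "x \<in> carrier ?T"
    show "(s \<odot>\<^bsub>?T\<^esub> x) \<odot>r\<^bsub>?T\<^esub> r = s \<odot>\<^bsub>?T\<^esub> (x \<odot>r\<^bsub>?T\<^esub> r)"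
      using groups x by (rule tensor_induct) (use s in simp_all)
  qed simp_all
qed

lemma
  fixes S :: "'u ring"
  shows lmod_tensor: "\<lbrakk>bimodule U S P; lmod S M\<rbrakk> \<Longrightarrow> lmod U (P \<boxtimes>\<^sub>S M)"
  and rmod_tensor: "\<lbrakk>rmod S P; bimodule S R M\<rbrakk> \<Longrightarrow> rmod R (P \<boxtimes>\<^sub>S M)"
  by (auto simp: lmod_def rmod_def intro: bimodule_tensor)

definition balanced :: "'u ring \<Rightarrow> 'u bimod \<Rightarrow> 'u bimod \<Rightarrow> 'u bimod \<Rightarrow> ('u \<Rightarrow> 'u \<Rightarrow> 'u) \<Rightarrow> bool" where
  "balanced S P M N b \<longleftrightarrow>
     (\<forall>m \<in> carrier M. additive P N (\<lambda>p. b p m)) \<and> (\<forall>p \<in> carrier P. additive M N (b p)) \<and>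
     (\<forall>p \<in> carrier P. \<forall>s \<in> carrier S. \<forall>m \<in> carrier M. b (p \<odot>r\<^bsub>P\<^esub> s) m = b p (s \<odot>\<^bsub>M\<^esub> m))"

text \<open>
  \<open>b\<close> extends to a homomorphism \<open>h\<close> on the free abelian group, which vanishes on the relations because
  \<open>b\<close> is balanced. Hence \<open>h\<close> takes the same value on all formal sums in a class, in particular on the
  one that \<open>decode\<close> returns.
\<close>

lemma tensor_lift_exists:
  fixes S :: "'u ring"
  assumes P: "rmod S P" and M: "lmod S M" and N: "abelian_group N" and b: "balanced S P M N b"
  shows "\<exists>f \<in> additive_hom (P \<boxtimes>\<^sub>S M) N.
     \<forall>p \<in> carrier P. \<forall>m \<in> carrier M. f (tensor_elt S P M p m) = b p m"
proof -
  interpret N: abelian_group N by fact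
  have b_closed: "b p m \<in> carrier N" if "p \<in> carrier P" "m \<in> carrier M" for p m
    using b that unfolding balanced_def additive_def by blast
  obtain h where hom: "h \<in> hom (free_Abelian_group (carrier P \<times> carrier M)) (add_monoid N)"
    and h: "\<And>x. x \<in> carrier P \<times> carrier M \<Longrightarrow> h (frag_of x) = (case x of (p, m) \<Rightarrow> b p m)"
  proof (rule comm_group.free_Abelian_group_universal[OF N.a_comm_group,
        of "\<lambda>(p, m). b p m" "carrier P \<times> carrier M"])
  qed (use b_closed in auto)
  have h_closed: "h u \<in> carrier N" if "u \<in> formal P M" for u
    using hom that by (auto simp: hom_def)
  have h_add: "h (u + v) = h u \<oplus>\<^bsub>N\<^esub> h v" if "u \<in> formal P M" "v \<in> formal P M" for u v
    using hom that by (auto simp: hom_def)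
  have h_diff: "h (u - v) = h u \<ominus>\<^bsub>N\<^esub> h v" if "u \<in> formal P M" "v \<in> formal P M" for u v
  proof -
    have uv: "u - v \<in> formal P M" using that by (simp add: keys_diff_subset)
    have "h u = h (u - v) \<oplus>\<^bsub>N\<^esub> h v" using h_add[OF uv that(2)] by simp
    then show ?thesis
      using h_closed[OF uv] h_closed[OF that(2)]
      by (simp add: N.minus_eq N.a_assoc N.r_neg)
  qed
  have cancel: "(x \<oplus>\<^bsub>N\<^esub> y) \<ominus>\<^bsub>N\<^esub> x \<ominus>\<^bsub>N\<^esub> y = \<zero>\<^bsub>N\<^esub>"
    if "x \<in> carrier N" "y \<in> carrier N" for x y
    using that N.a_assoc[of "x \<oplus>\<^bsub>N\<^esub> y" "\<ominus>\<^bsub>N\<^esub> x" "\<ominus>\<^bsub>N\<^esub> y"]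
    by (simp add: N.minus_eq N.minus_add[symmetric] N.r_neg)
  have h_rel: "h u = \<zero>\<^bsub>N\<^esub>" if "u \<in> tensor_rel S P M" for u
    using that
  proof induction
    case zero
    show ?case using h_diff[of 0 0] h_closed[of 0] by (simp add: N.minus_eq N.r_neg)
  next
    case (diff u v)
    then show ?case
      using h_diff[of u v] tensor_rel_keys[OF P M] by (simp add: N.minus_eq)
  next
    case (add_left p q m)
    moreover have "b (p \<oplus>\<^bsub>P\<^esub> q) m = b p m \<oplus>\<^bsub>N\<^esub> b q m"
      using b add_left by (simp add: balanced_def additive_def)
    ultimately show ?case
      using rmod_group[OF P]
      by (simp add: h_diff keys_diff_subset h b_closed cancel)
  next
    case (add_right p m n)
    moreover have "b p (m \<oplus>\<^bsub>M\<^esub> n) = b p m \<oplus>\<^bsub>N\<^esub> b p n"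
      using b add_right by (simp add: balanced_def additive_def)
    ultimately show ?case
      using lmod_group[OF M]
      by (simp add: h_diff keys_diff_subset h b_closed cancel)
  next
    case (balanced p s m)
    moreover have "b (p \<odot>r\<^bsub>P\<^esub> s) m = b p (s \<odot>\<^bsub>M\<^esub> m)"
      using b balanced by (simp add: balanced_def)
    ultimately show ?case
      using P M by (simp add: h_diff keys_diff_subset h b_closed N.minus_eq N.r_neg)
  qed
  have h_class: "h (decode (tensor_class S P M u)) = h u" if u: "u \<in> formal P M" for u
  proof -
    let ?d = "decode (tensor_class S P M u)"
    have d: "?d \<in> formal P M"
      using u by (intro decode_keys[OF P M]) (auto simp: carrier_tensor)
    have "h ?d = h (?d - u) \<oplus>\<^bsub>N\<^esub> h u"
      using h_add[of "?d - u" u] d u by (simp add: keys_diff_subset)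
    then show ?thesis
      using h_rel[OF decode_class] h_closed[OF u] by simp
  qed
  let ?f = "\<lambda>t \<in> carrier (P \<boxtimes>\<^sub>S M). h (decode t)"
  have "?f \<in> additive_hom (P \<boxtimes>\<^sub>S M) N"
    by (auto simp: additive_hom_def carrier_tensor add_class h_class h_closed h_add
        keys_add_subset)
  moreover have "?f (tensor_elt S P M p m) = b p m" if "p \<in> carrier P" "m \<in> carrier M" for p m
    using that by (simp add: elt_closed) (simp add: tensor_elt_def h_class h)
  ultimately show ?thesis by blast
qed

lemma tensor_lift:
  fixes S :: "'u ring"
  assumes P: "rmod S P" and M: "lmod S M" and N: "abelian_group N" and b: "balanced S P M N b"
  shows tensor_lift_additive: "additive (P \<boxtimes>\<^sub>S M) N (tensor_lift S P M N b)"
    and tensor_lift_extensional: "tensor_lift S P M N b \<in> extensional (carrier (P \<boxtimes>\<^sub>S M))"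
    and tensor_lift_elt: "\<lbrakk>p \<in> carrier P; m \<in> carrier M\<rbrakk>
      \<Longrightarrow> tensor_lift S P M N b (tensor_elt S P M p m) = b p m"
proof -
  let ?Q = "\<lambda>f. f \<in> additive_hom (P \<boxtimes>\<^sub>S M) N \<and>
     (\<forall>p \<in> carrier P. \<forall>m \<in> carrier M. f (tensor_elt S P M p m) = b p m)"
  have "f = g" if f: "?Q f" and g: "?Q g" for f g
  proof (rule extensionalityI)
    show "f \<in> extensional (carrier (P \<boxtimes>\<^sub>S M))" "g \<in> extensional (carrier (P \<boxtimes>\<^sub>S M))"
      using f g by (auto simp: additive_hom_iff)
    show "f t = g t" if "t \<in> carrier (P \<boxtimes>\<^sub>S M)" for t
      using rmod_group[OF P] lmod_group[OF M] that
      by (rule tensor_ext) (use f g in \<open>auto simp: additive_hom_iff\<close>)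
  qed
  moreover obtain f where "?Q f"
    using tensor_lift_exists[OF assms] by blast
  ultimately have "?Q (tensor_lift S P M N b)"
    unfolding tensor_lift_def by (intro theI[where P = ?Q and a = f]) blast+
  then show "additive (P \<boxtimes>\<^sub>S M) N (tensor_lift S P M N b)"
    "tensor_lift S P M N b \<in> extensional (carrier (P \<boxtimes>\<^sub>S M))"
    "\<lbrakk>p \<in> carrier P; m \<in> carrier M\<rbrakk> \<Longrightarrow> tensor_lift S P M N b (tensor_elt S P M p m) = b p m"
    by (auto simp: additive_hom_iff)
qed

lemma additive_smult: "lmod S M \<Longrightarrow> s \<in> carrier S \<Longrightarrow> additive M M (\<lambda>x. s \<odot>\<^bsub>M\<^esub> x)"
  and additive_rsmult: "rmod R M \<Longrightarrow> r \<in> carrier R \<Longrightarrow> additive M M (\<lambda>x. x \<odot>r\<^bsub>M\<^esub> r)"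
  by (auto simp: additive_def lmod_simps rmod_simps)

lemma llin_tensorI:
  fixes S :: "'u ring"
  assumes P: "bimodule U S P" and M: "lmod S M" and N: "lmod U N"
    and f: "additive (P \<boxtimes>\<^sub>S M) N f"
    and "\<And>u p m. \<lbrakk>u \<in> carrier U; p \<in> carrier P; m \<in> carrier M\<rbrakk> \<Longrightarrow>
      f (tensor_elt S P M (u \<odot>\<^bsub>P\<^esub> p) m) = u \<odot>\<^bsub>N\<^esub> f (tensor_elt S P M p m)"
  shows "llin U (P \<boxtimes>\<^sub>S M) N f"
proof -
  have "f (u \<odot>\<^bsub>P \<boxtimes>\<^sub>S M\<^esub> t) = u \<odot>\<^bsub>N\<^esub> f t"
    if u: "u \<in> carrier U" and t: "t \<in> carrier (P \<boxtimes>\<^sub>S M)" for u t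
    using bimodule_rings(3)[OF P] lmod_group[OF M] t
      additive_comp[OF additive_smult[OF lmod_tensor[OF P M] u] f]
      additive_comp[OF f additive_smult[OF N u]]
    by (rule tensor_ext) (use u P assms(5) in \<open>simp add: smult_elt\<close>)
  then show ?thesis using f by (simp add: llin_def)
qed

lemma rlin_tensorI:
  fixes S :: "'u ring"
  assumes P: "rmod S P" and M: "bimodule S R M" and N: "rmod R N"
    and f: "additive (P \<boxtimes>\<^sub>S M) N f"
    and "\<And>r p m. \<lbrakk>r \<in> carrier R; p \<in> carrier P; m \<in> carrier M\<rbrakk> \<Longrightarrow>
      f (tensor_elt S P M p (m \<odot>r\<^bsub>M\<^esub> r)) = f (tensor_elt S P M p m) \<odot>r\<^bsub>N\<^esub> r"
  shows "rlin R (P \<boxtimes>\<^sub>S M) N f"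
proof -
  have "f (t \<odot>r\<^bsub>P \<boxtimes>\<^sub>S M\<^esub> r) = f t \<odot>r\<^bsub>N\<^esub> r"
    if r: "r \<in> carrier R" and t: "t \<in> carrier (P \<boxtimes>\<^sub>S M)" for r t
    using rmod_group[OF P] bimodule_rings(3)[OF M] t
      additive_comp[OF additive_rsmult[OF rmod_tensor[OF P M] r] f]
      additive_comp[OF f additive_rsmult[OF N r]]
    by (rule tensor_ext) (use r M assms(5) in \<open>simp add: rsmult_elt\<close>)
  then show ?thesis using f by (simp add: rlin_def)
qed

section \<open>Tensor products of maps\<close>

lemma balanced_elt:
  fixes S :: "'u ring"
  assumes "rmod S P" "lmod S M" "rlin S P P' f" "llin S M M' g"
  shows "balanced S P M (P' \<boxtimes>\<^sub>S M') (\<lambda>p m. tensor_elt S P' M' (f p) (g m))"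
proof -
  have f: "additive P P' f" and g: "additive M M' g"
    using assms by (simp_all add: rlin_additive llin_additive)
  then show ?thesis
    using assms unfolding balanced_def
    by (simp add: additive_def Pi_iff elt_add_left elt_add_right rlin_smult llin_smult elt_balanced)
qed

context
  fixes S :: "'u ring" and P P' M M' f g
  assumes mods: "rmod S P" "lmod S M" "rmod S P'" "lmod S M'"
    and lin: "rlin S P P' f" "llin S M M' g"
begin

lemma tensor_map_additive: "additive (P \<boxtimes>\<^sub>S M) (P' \<boxtimes>\<^sub>S M') (tensor_map S P P' M M' f g)"
  and tensor_map_extensional:
    "tensor_map S P P' M M' f g \<in> extensional (carrier (P \<boxtimes>\<^sub>S M))"
  and tensor_map_elt: "\<lbrakk>p \<in> carrier P; m \<in> carrier M\<rbrakk> \<Longrightarrow>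
    tensor_map S P P' M M' f g (tensor_elt S P M p m) = tensor_elt S P' M' (f p) (g m)"
  unfolding tensor_map_def
  using tensor_lift[OF mods(1,2) abelian_group_tensor balanced_elt[OF mods(1,2) lin]]
  by auto

lemma tensor_map_llin:
  assumes "bimodule U S P" "bimodule U S P'" "llin U P P' f"
  shows "llin U (P \<boxtimes>\<^sub>S M) (P' \<boxtimes>\<^sub>S M') (tensor_map S P P' M M' f g)"
  using assms(1) mods(2) lmod_tensor[OF assms(2) mods(4)] tensor_map_additive
  by (rule llin_tensorI)
    (use assms bimodule_lmod[OF assms(1)] in \<open>simp add: tensor_map_elt llin_smult smult_elt\<close>)

lemma tensor_map_rlin:
  assumes "bimodule S R M" "bimodule S R M'" "rlin R M M' g"
  shows "rlin R (P \<boxtimes>\<^sub>S M) (P' \<boxtimes>\<^sub>S M') (tensor_map S P P' M M' f g)"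
  using mods(1) assms(1) rmod_tensor[OF mods(3) assms(2)] tensor_map_additive
  by (rule rlin_tensorI)
    (use assms bimodule_rmod[OF assms(1)] in \<open>simp add: tensor_map_elt rlin_smult rsmult_elt\<close>)

end

lemma llin_id_map: "lmod S M \<Longrightarrow> llin S M M (id_map M)"
  by (simp add: llin_def additive_def id_map_def lmod_group)

lemma rlin_id_map: "rmod S M \<Longrightarrow> rlin S M M (id_map M)"
  by (simp add: rlin_def additive_def id_map_def rmod_group)

lemma id_map_apply: "x \<in> carrier M \<Longrightarrow> id_map M x = x"
  by (simp add: id_map_def)

context
  fixes S :: "'u ring" and P M M' g
  assumes mods: "rmod S P" "lmod S M" "lmod S M'" and lin: "llin S M M' g"
begin

lemma lwhisker_additive: "additive (P \<boxtimes>\<^sub>S M) (P \<boxtimes>\<^sub>S M') (lwhisker S P M M' g)"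
  and lwhisker_elt: "\<lbrakk>p \<in> carrier P; m \<in> carrier M\<rbrakk> \<Longrightarrow>
    lwhisker S P M M' g (tensor_elt S P M p m) = tensor_elt S P M' p (g m)"
  unfolding lwhisker_def
  using mods lin by (simp_all add: tensor_map_additive tensor_map_elt rlin_id_map id_map_apply)

lemma lwhisker_llin:
  assumes "bimodule U S P"
  shows "llin U (P \<boxtimes>\<^sub>S M) (P \<boxtimes>\<^sub>S M') (lwhisker S P M M' g)"
  unfolding lwhisker_def using mods lin assms
  by (simp add: tensor_map_llin rlin_id_map llin_id_map bimodule_lmod)

lemma lwhisker_rlin:
  assumes "bimodule S R M" "bimodule S R M'" "rlin R M M' g"
  shows "rlin R (P \<boxtimes>\<^sub>S M) (P \<boxtimes>\<^sub>S M') (lwhisker S P M M' g)"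
  unfolding lwhisker_def using mods lin assms
  by (simp add: tensor_map_rlin rlin_id_map)

end

context
  fixes S :: "'u ring" and P P' M f
  assumes mods: "rmod S P" "rmod S P'" "lmod S M" and lin: "rlin S P P' f"
begin

lemma rwhisker_additive: "additive (P \<boxtimes>\<^sub>S M) (P' \<boxtimes>\<^sub>S M) (rwhisker S P P' M f)"
  and rwhisker_elt: "\<lbrakk>p \<in> carrier P; m \<in> carrier M\<rbrakk> \<Longrightarrow>
    rwhisker S P P' M f (tensor_elt S P M p m) = tensor_elt S P' M (f p) m"
  unfolding rwhisker_def
  using mods lin by (simp_all add: tensor_map_additive tensor_map_elt llin_id_map id_map_apply)

lemma rwhisker_llin:
  assumes "bimodule U S P" "bimodule U S P'" "llin U P P' f"
  shows "llin U (P \<boxtimes>\<^sub>S M) (P' \<boxtimes>\<^sub>S M) (rwhisker S P P' M f)"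
  unfolding rwhisker_def using mods lin assms
  by (simp add: tensor_map_llin llin_id_map)

lemma rwhisker_rlin:
  assumes "bimodule S R M"
  shows "rlin R (P \<boxtimes>\<^sub>S M) (P' \<boxtimes>\<^sub>S M) (rwhisker S P P' M f)"
  unfolding rwhisker_def using mods lin assms
  by (simp add: tensor_map_rlin rlin_id_map llin_id_map bimodule_rmod)

end

section \<open>Associativity and unit isomorphisms\<close>

lemma additive_elt_left:
  fixes S :: "'u ring"
  assumes "abelian_group P" "m \<in> carrier M" shows "additive P (P \<boxtimes>\<^sub>S M) (\<lambda>p. tensor_elt S P M p m)"
  using assms by (auto simp: additive_def elt_add_left)

lemma additive_elt_right:
  fixes S :: "'u ring"
  assumes "abelian_group M" "p \<in> carrier P" shows "additive M (P \<boxtimes>\<^sub>S M) (tensor_elt S P M p)"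
  using assms by (auto simp: additive_def elt_add_right)

lemma additive_plus:
  assumes "abelian_group N" "additive M N f" "additive M N g"
  shows "additive M N (\<lambda>x. f x \<oplus>\<^bsub>N\<^esub> g x)"
proof -
  interpret abelian_group N by fact
  show ?thesis using assms(2,3) by (auto simp: additive_def Pi_iff a_ac)
qed

context
  fixes S R :: "'u ring" and X Y Z
  assumes X: "rmod S X" and Y: "bimodule S R Y" and Z: "lmod R Z"
begin

lemma balanced_assoc_inner:
  assumes "x \<in> carrier X"
  shows "balanced R Y Z ((X \<boxtimes>\<^sub>S Y) \<boxtimes>\<^sub>R Z)
    (\<lambda>y z. tensor_elt R (X \<boxtimes>\<^sub>S Y) Z (tensor_elt S X Y x y) z)"
  using assms Y Z bimodule_rings(3)[OF Y] lmod_group[OF Z]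
  by (auto simp: balanced_def additive_def elt_add_left elt_add_right
      elt_balanced[symmetric] rsmult_elt)

lemmas assoc_inner = tensor_lift[OF bimodule_rmod[OF Y] Z abelian_group_tensor balanced_assoc_inner]

lemma balanced_assoc:
  "balanced S X (Y \<boxtimes>\<^sub>R Z) ((X \<boxtimes>\<^sub>S Y) \<boxtimes>\<^sub>R Z)
    (\<lambda>x. tensor_lift R Y Z ((X \<boxtimes>\<^sub>S Y) \<boxtimes>\<^sub>R Z)
         (\<lambda>y z. tensor_elt R (X \<boxtimes>\<^sub>S Y) Z (tensor_elt S X Y x y) z))"
  (is "balanced S X ?YZ ?N ?f")
proof -
  note groups = rmod_group[OF X] bimodule_rings(3)[OF Y] lmod_group[OF Z]
  have add: "?f (x \<oplus>\<^bsub>X\<^esub> x') t = ?f x t \<oplus>\<^bsub>?N\<^esub> ?f x' t"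
    if x: "x \<in> carrier X" "x' \<in> carrier X" and t: "t \<in> carrier ?YZ" for x x' t
    using groups(2,3) t
  proof (rule tensor_ext)
    show "additive ?YZ ?N (?f (x \<oplus>\<^bsub>X\<^esub> x'))" using x groups by (simp add: assoc_inner)
    show "additive ?YZ ?N (\<lambda>t. ?f x t \<oplus>\<^bsub>?N\<^esub> ?f x' t)"
      using x by (simp add: assoc_inner additive_plus)
  qed (use x groups in \<open>simp add: assoc_inner elt_add_left\<close>)
  have bal: "?f (x \<odot>r\<^bsub>X\<^esub> s) t = ?f x (s \<odot>\<^bsub>?YZ\<^esub> t)"
    if x: "x \<in> carrier X" "s \<in> carrier S" and t: "t \<in> carrier ?YZ" for x s t
    using groups(2,3) t
  proof (rule tensor_ext)
    show "additive ?YZ ?N (?f (x \<odot>r\<^bsub>X\<^esub> s))" using x X by (simp add: assoc_inner)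
    show "additive ?YZ ?N (\<lambda>t. ?f x (s \<odot>\<^bsub>?YZ\<^esub> t))"
      using additive_comp[OF additive_smult[OF lmod_tensor[OF Y Z]] assoc_inner(1)] x
      by (simp add: comp_def)
  qed (use x X bimodule_lmod[OF Y] in \<open>simp add: assoc_inner elt_balanced smult_elt[OF Y]\<close>)
  have "additive X ?N (\<lambda>p. ?f p m)" if "m \<in> carrier ?YZ" for m
    using that add additive_closed[OF assoc_inner(1)] by (simp add: additive_def)
  then show ?thesis
    using bal assoc_inner(1) by (auto simp: balanced_def)
qed

lemmas assoc_lift = tensor_lift[OF X lmod_tensor[OF Y Z] abelian_group_tensor balanced_assoc,
    folded tensor_assoc_def]

lemma assoc_additive: "additive (X \<boxtimes>\<^sub>S (Y \<boxtimes>\<^sub>R Z)) ((X \<boxtimes>\<^sub>S Y) \<boxtimes>\<^sub>R Z) (tensor_assoc S R X Y Z)"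
  and assoc_extensional: "tensor_assoc S R X Y Z \<in> extensional (carrier (X \<boxtimes>\<^sub>S (Y \<boxtimes>\<^sub>R Z)))"
  and assoc_elt: "\<lbrakk>x \<in> carrier X; y \<in> carrier Y; z \<in> carrier Z\<rbrakk> \<Longrightarrow>
    tensor_assoc S R X Y Z (tensor_elt3 S R X Y Z x y z) =
    tensor_elt R (X \<boxtimes>\<^sub>S Y) Z (tensor_elt S X Y x y) z"
  by (simp_all add: assoc_lift assoc_inner)

lemma balanced_assoc_inv_inner:
  assumes "z \<in> carrier Z"
  shows "balanced S X Y (X \<boxtimes>\<^sub>S (Y \<boxtimes>\<^sub>R Z))
    (\<lambda>x y. tensor_elt3 S R X Y Z x y z)"
  using assms Y X bimodule_rings(3)[OF Y] rmod_group[OF X]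
  by (auto simp: balanced_def additive_def elt_add_left elt_add_right
      elt_balanced smult_elt)

lemmas assoc_inv_inner = tensor_lift[OF X bimodule_lmod[OF Y] abelian_group_tensor balanced_assoc_inv_inner]

lemma balanced_assoc_inv:
  "balanced R (X \<boxtimes>\<^sub>S Y) Z (X \<boxtimes>\<^sub>S (Y \<boxtimes>\<^sub>R Z))
    (\<lambda>t z. tensor_lift S X Y (X \<boxtimes>\<^sub>S (Y \<boxtimes>\<^sub>R Z))
         (\<lambda>x y. tensor_elt3 S R X Y Z x y z) t)"
  (is "balanced R ?XY Z ?N ?f")
proof -
  note groups = rmod_group[OF X] bimodule_rings(3)[OF Y] lmod_group[OF Z]
  have add: "?f t (z \<oplus>\<^bsub>Z\<^esub> z') = ?f t z \<oplus>\<^bsub>?N\<^esub> ?f t z'"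
    if z: "z \<in> carrier Z" "z' \<in> carrier Z" and t: "t \<in> carrier ?XY" for z z' t
    using groups(1,2) t
  proof (rule tensor_ext)
    show "additive ?XY ?N (\<lambda>t. ?f t (z \<oplus>\<^bsub>Z\<^esub> z'))" using z groups by (simp add: assoc_inv_inner)
    show "additive ?XY ?N (\<lambda>t. ?f t z \<oplus>\<^bsub>?N\<^esub> ?f t z')"
      using z by (simp add: assoc_inv_inner additive_plus)
  qed (use z groups in \<open>simp add: assoc_inv_inner elt_add_right\<close>)
  have bal: "?f (t \<odot>r\<^bsub>?XY\<^esub> r) z = ?f t (r \<odot>\<^bsub>Z\<^esub> z)"
    if z: "z \<in> carrier Z" "r \<in> carrier R" and t: "t \<in> carrier ?XY" for z r t
    using groups(1,2) t
  proof (rule tensor_ext)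
    show "additive ?XY ?N (\<lambda>t. ?f t (r \<odot>\<^bsub>Z\<^esub> z))" using z Z by (simp add: assoc_inv_inner)
    show "additive ?XY ?N (\<lambda>t. ?f (t \<odot>r\<^bsub>?XY\<^esub> r) z)"
      using additive_comp[OF additive_rsmult[OF rmod_tensor[OF X Y]] assoc_inv_inner(1)] z
      by (simp add: comp_def)
  qed (use z Z bimodule_rmod[OF Y] in \<open>simp add: assoc_inv_inner elt_balanced rsmult_elt[OF Y]\<close>)
  have "additive Z ?N (?f t)" if "t \<in> carrier ?XY" for t
    using that add additive_closed[OF assoc_inv_inner(1)] by (simp add: additive_def)
  then show ?thesis
    using bal assoc_inv_inner(1) by (auto simp: balanced_def)
qed

lemmas assoc_inv_lift = tensor_lift[OF rmod_tensor[OF X Y] Z abelian_group_tensor balanced_assoc_inv,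
    folded tensor_assoc_inv_def]

lemma assoc_inv_additive:
    "additive ((X \<boxtimes>\<^sub>S Y) \<boxtimes>\<^sub>R Z) (X \<boxtimes>\<^sub>S (Y \<boxtimes>\<^sub>R Z)) (tensor_assoc_inv S R X Y Z)"
  and assoc_inv_extensional: "tensor_assoc_inv S R X Y Z \<in> extensional (carrier ((X \<boxtimes>\<^sub>S Y) \<boxtimes>\<^sub>R Z))"
  and assoc_inv_elt: "\<lbrakk>x \<in> carrier X; y \<in> carrier Y; z \<in> carrier Z\<rbrakk> \<Longrightarrow>
    tensor_assoc_inv S R X Y Z (tensor_elt R (X \<boxtimes>\<^sub>S Y) Z (tensor_elt S X Y x y) z) =
    tensor_elt3 S R X Y Z x y z"
  by (simp_all add: assoc_inv_lift assoc_inv_inner)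

end

end

lemma bimodule_group: "bimodule S R M \<Longrightarrow> abelian_group M"
  by (rule bimodule_rings)

context universe begin

lemmas bimodule_facts = bimodule_lmod bimodule_rmod bimodule_group

declare bimodule_tensor [simp] lmod_tensor [simp] rmod_tensor [simp]

lemma ring_bimod_modules [simp]:
  assumes "ring R"
  shows "lmod R (ring_bimod R)" "rmod R (ring_bimod R)" "abelian_group (ring_bimod R)"
  using bimodule_ring_bimod[OF assms] by (auto intro: bimodule_facts)

text \<open>Three- and fourfold tensor products are spanned by iterated pure tensors.\<close>

lemma tensor3_ext:
  fixes S R :: "'u ring"
  assumes groups: "abelian_group X" "abelian_group Y" "abelian_group Z"
    and t: "t \<in> carrier (X \<boxtimes>\<^sub>S (Y \<boxtimes>\<^sub>R Z))"
    and f: "additive (X \<boxtimes>\<^sub>S (Y \<boxtimes>\<^sub>R Z)) N f" and g: "additive (X \<boxtimes>\<^sub>S (Y \<boxtimes>\<^sub>R Z)) N g"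
    and eq: "\<And>x y z. \<lbrakk>x \<in> carrier X; y \<in> carrier Y; z \<in> carrier Z\<rbrakk> \<Longrightarrow>
      f (tensor_elt3 S R X Y Z x y z) =
      g (tensor_elt3 S R X Y Z x y z)"
  shows "f t = g t"
proof (rule tensor_ext[OF groups(1) abelian_group_tensor t f g])
  fix x u assume x: "x \<in> carrier X" and u: "u \<in> carrier (Y \<boxtimes>\<^sub>R Z)"
  show "f (tensor_elt S X (Y \<boxtimes>\<^sub>R Z) x u) = g (tensor_elt S X (Y \<boxtimes>\<^sub>R Z) x u)"
    using groups(2,3) u
      additive_comp[OF additive_elt_right[OF abelian_group_tensor x] f]
      additive_comp[OF additive_elt_right[OF abelian_group_tensor x] g]
    by (rule tensor_ext) (use x eq in simp)
qed

lemma tensor3_ext_left: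
  fixes S R :: "'u ring"
  assumes groups: "abelian_group X" "abelian_group Y" "abelian_group Z"
    and t: "t \<in> carrier ((X \<boxtimes>\<^sub>S Y) \<boxtimes>\<^sub>R Z)"
    and f: "additive ((X \<boxtimes>\<^sub>S Y) \<boxtimes>\<^sub>R Z) N f" and g: "additive ((X \<boxtimes>\<^sub>S Y) \<boxtimes>\<^sub>R Z) N g"
    and eq: "\<And>x y z. \<lbrakk>x \<in> carrier X; y \<in> carrier Y; z \<in> carrier Z\<rbrakk> \<Longrightarrow>
      f (tensor_elt R (X \<boxtimes>\<^sub>S Y) Z (tensor_elt S X Y x y) z) =
      g (tensor_elt R (X \<boxtimes>\<^sub>S Y) Z (tensor_elt S X Y x y) z)"
  shows "f t = g t"
proof (rule tensor_ext[OF abelian_group_tensor groups(3) t f g])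
  fix u z assume u: "u \<in> carrier (X \<boxtimes>\<^sub>S Y)" and z: "z \<in> carrier Z"
  show "f (tensor_elt R (X \<boxtimes>\<^sub>S Y) Z u z) = g (tensor_elt R (X \<boxtimes>\<^sub>S Y) Z u z)"
    using groups(1,2) u
      additive_comp[OF additive_elt_left[OF abelian_group_tensor z] f]
      additive_comp[OF additive_elt_left[OF abelian_group_tensor z] g]
    by (rule tensor_ext) (use z eq in simp)
qed

lemma tensor4_ext:
  fixes S R T :: "'u ring"
  assumes groups: "abelian_group W" "abelian_group X" "abelian_group Y" "abelian_group Z"
    and t: "t \<in> carrier (W \<boxtimes>\<^sub>T (X \<boxtimes>\<^sub>S (Y \<boxtimes>\<^sub>R Z)))"
    and f: "additive (W \<boxtimes>\<^sub>T (X \<boxtimes>\<^sub>S (Y \<boxtimes>\<^sub>R Z))) N f"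
    and g: "additive (W \<boxtimes>\<^sub>T (X \<boxtimes>\<^sub>S (Y \<boxtimes>\<^sub>R Z))) N g"
    and eq: "\<And>w x y z. \<lbrakk>w \<in> carrier W; x \<in> carrier X; y \<in> carrier Y; z \<in> carrier Z\<rbrakk> \<Longrightarrow>
      f (tensor_elt T W (X \<boxtimes>\<^sub>S (Y \<boxtimes>\<^sub>R Z)) w (tensor_elt3 S R X Y Z x y z)) =
      g (tensor_elt T W (X \<boxtimes>\<^sub>S (Y \<boxtimes>\<^sub>R Z)) w (tensor_elt3 S R X Y Z x y z))"
  shows "f t = g t"
proof (rule tensor_ext[OF groups(1) abelian_group_tensor t f g])
  fix w u assume w: "w \<in> carrier W" and u: "u \<in> carrier (X \<boxtimes>\<^sub>S (Y \<boxtimes>\<^sub>R Z))"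
  show "f (tensor_elt T W (X \<boxtimes>\<^sub>S (Y \<boxtimes>\<^sub>R Z)) w u) = g (tensor_elt T W (X \<boxtimes>\<^sub>S (Y \<boxtimes>\<^sub>R Z)) w u)"
    using groups(2-4) u
      additive_comp[OF additive_elt_right[OF abelian_group_tensor w] f]
      additive_comp[OF additive_elt_right[OF abelian_group_tensor w] g]
    by (rule tensor3_ext) (use w eq in simp)
qed

declare lwhisker_llin [simp] lwhisker_rlin [simp] rwhisker_llin [simp] rwhisker_rlin [simp]
  tensor_map_llin [simp] tensor_map_rlin [simp]

lemma lin_assoc [simp]:
  fixes S R :: "'u ring"
  shows "\<lbrakk>bimodule U S X; bimodule S R Y; lmod R Z\<rbrakk> \<Longrightarrow>
    llin U (X \<boxtimes>\<^sub>S (Y \<boxtimes>\<^sub>R Z)) ((X \<boxtimes>\<^sub>S Y) \<boxtimes>\<^sub>R Z) (tensor_assoc S R X Y Z)"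
  "\<lbrakk>rmod S X; bimodule S R Y; bimodule R V Z\<rbrakk> \<Longrightarrow>
    rlin V (X \<boxtimes>\<^sub>S (Y \<boxtimes>\<^sub>R Z)) ((X \<boxtimes>\<^sub>S Y) \<boxtimes>\<^sub>R Z) (tensor_assoc S R X Y Z)"
proof -
  assume X: "bimodule U S X" and Y: "bimodule S R Y" and Z: "lmod R Z"
  note [simp] = bimodule_facts[OF X] bimodule_facts[OF Y] lmod_group[OF Z] X Y Z
  have "tensor_assoc S R X Y Z (u \<odot>\<^bsub>X \<boxtimes>\<^sub>S (Y \<boxtimes>\<^sub>R Z)\<^esub> t) =
      u \<odot>\<^bsub>(X \<boxtimes>\<^sub>S Y) \<boxtimes>\<^sub>R Z\<^esub> tensor_assoc S R X Y Z t"
    if u: "u \<in> carrier U" and t: "t \<in> carrier (X \<boxtimes>\<^sub>S (Y \<boxtimes>\<^sub>R Z))" for u t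
    by (rule tensor3_ext[OF _ _ _ t
        additive_comp[OF additive_smult[OF lmod_tensor[OF X lmod_tensor[OF Y Z]] u] assoc_additive]
        additive_comp[OF assoc_additive additive_smult[OF lmod_tensor[OF bimodule_tensor[OF X Y] Z] u]]])
      (use u in \<open>simp_all add: assoc_elt smult_elt[OF X] smult_elt[OF bimodule_tensor[OF X Y]]
        lmod_closed[OF bimodule_lmod[OF X]]\<close>)
  then show "llin U (X \<boxtimes>\<^sub>S (Y \<boxtimes>\<^sub>R Z)) ((X \<boxtimes>\<^sub>S Y) \<boxtimes>\<^sub>R Z) (tensor_assoc S R X Y Z)"
    by (simp add: llin_def assoc_additive)
next
  assume X: "rmod S X" and Y: "bimodule S R Y" and Z: "bimodule R V Z"
  note [simp] = bimodule_facts[OF Z] bimodule_facts[OF Y] rmod_group[OF X] X Y Z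
  have "tensor_assoc S R X Y Z (t \<odot>r\<^bsub>X \<boxtimes>\<^sub>S (Y \<boxtimes>\<^sub>R Z)\<^esub> u) =
      tensor_assoc S R X Y Z t \<odot>r\<^bsub>(X \<boxtimes>\<^sub>S Y) \<boxtimes>\<^sub>R Z\<^esub> u"
    if u: "u \<in> carrier V" and t: "t \<in> carrier (X \<boxtimes>\<^sub>S (Y \<boxtimes>\<^sub>R Z))" for u t
    by (rule tensor3_ext[OF _ _ _ t
        additive_comp[OF additive_rsmult[OF rmod_tensor[OF X bimodule_tensor[OF Y Z]] u] assoc_additive]
        additive_comp[OF assoc_additive additive_rsmult[OF rmod_tensor[OF rmod_tensor[OF X Y] Z] u]]])
      (use u in \<open>simp_all add: assoc_elt rsmult_elt[OF Z] rsmult_elt[OF bimodule_tensor[OF Y Z]]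
        rmod_closed[OF bimodule_rmod[OF Z]]\<close>)
  then show "rlin V (X \<boxtimes>\<^sub>S (Y \<boxtimes>\<^sub>R Z)) ((X \<boxtimes>\<^sub>S Y) \<boxtimes>\<^sub>R Z) (tensor_assoc S R X Y Z)"
    by (simp add: rlin_def assoc_additive)
qed

lemma assoc_inverse:
  fixes S R :: "'u ring"
  assumes X: "rmod S X" and Y: "bimodule S R Y" and Z: "lmod R Z"
  shows assoc_inv_assoc: "t \<in> carrier (X \<boxtimes>\<^sub>S (Y \<boxtimes>\<^sub>R Z)) \<Longrightarrow>
      tensor_assoc_inv S R X Y Z (tensor_assoc S R X Y Z t) = t"
    and assoc_assoc_inv: "t \<in> carrier ((X \<boxtimes>\<^sub>S Y) \<boxtimes>\<^sub>R Z) \<Longrightarrow>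
      tensor_assoc S R X Y Z (tensor_assoc_inv S R X Y Z t) = t"
proof -
  note groups = rmod_group[OF X] bimodule_group[OF Y] lmod_group[OF Z]
  note f = assoc_additive[OF X Y Z] note g = assoc_inv_additive[OF X Y Z]
  have id: "additive M M (\<lambda>x. x)" for M by (simp add: additive_def)
  show "tensor_assoc_inv S R X Y Z (tensor_assoc S R X Y Z t) = t"
    if "t \<in> carrier (X \<boxtimes>\<^sub>S (Y \<boxtimes>\<^sub>R Z))" for t
    by (rule tensor3_ext[OF groups that additive_comp[OF f g] id])
      (simp add: assoc_elt[OF X Y Z] assoc_inv_elt[OF X Y Z])
  show "tensor_assoc S R X Y Z (tensor_assoc_inv S R X Y Z t) = t"
    if "t \<in> carrier ((X \<boxtimes>\<^sub>S Y) \<boxtimes>\<^sub>R Z)" for t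
    by (rule tensor3_ext_left[OF groups that additive_comp[OF g f] id])
      (simp add: assoc_elt[OF X Y Z] assoc_inv_elt[OF X Y Z])
qed

lemma inverse_linear:
  assumes g: "additive N M g" and gf: "\<And>x. x \<in> carrier M \<Longrightarrow> g (f x) = x"
    and fg: "\<And>y. y \<in> carrier N \<Longrightarrow> f (g y) = y"
  shows inverse_llin: "llin S M N f \<Longrightarrow> lmod S M \<Longrightarrow> llin S N M g"
    and inverse_rlin: "rlin R M N f \<Longrightarrow> rmod R M \<Longrightarrow> rlin R N M g"
proof -
  show "llin S N M g" if f: "llin S M N f" and M: "lmod S M"
  proof -
    have "g (s \<odot>\<^bsub>N\<^esub> y) = s \<odot>\<^bsub>M\<^esub> g y" if "s \<in> carrier S" "y \<in> carrier N" for s y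
      using gf[of "s \<odot>\<^bsub>M\<^esub> g y"] llin_smult[OF f, of s "g y"] that additive_closed[OF g]
        lmod_closed[OF M] by (simp add: fg)
    then show ?thesis using g by (simp add: llin_def)
  qed
  show "rlin R N M g" if f: "rlin R M N f" and M: "rmod R M"
  proof -
    have "g (y \<odot>r\<^bsub>N\<^esub> s) = g y \<odot>r\<^bsub>M\<^esub> s" if "s \<in> carrier R" "y \<in> carrier N" for s y
      using gf[of "g y \<odot>r\<^bsub>M\<^esub> s"] rlin_smult[OF f, of s "g y"] that additive_closed[OF g]
        rmod_closed[OF M] by (simp add: fg)
    then show ?thesis using g by (simp add: rlin_def)
  qed
qed

lemma lin_assoc_inv [simp]:
  fixes S R :: "'u ring"
  shows "\<lbrakk>bimodule U S X; bimodule S R Y; lmod R Z\<rbrakk> \<Longrightarrow>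
    llin U ((X \<boxtimes>\<^sub>S Y) \<boxtimes>\<^sub>R Z) (X \<boxtimes>\<^sub>S (Y \<boxtimes>\<^sub>R Z)) (tensor_assoc_inv S R X Y Z)"
  "\<lbrakk>rmod S X; bimodule S R Y; bimodule R V Z\<rbrakk> \<Longrightarrow>
    rlin V ((X \<boxtimes>\<^sub>S Y) \<boxtimes>\<^sub>R Z) (X \<boxtimes>\<^sub>S (Y \<boxtimes>\<^sub>R Z)) (tensor_assoc_inv S R X Y Z)"
  by (rule inverse_llin[OF assoc_inv_additive assoc_inv_assoc assoc_assoc_inv];
      simp add: bimodule_facts)
    (rule inverse_rlin[OF assoc_inv_additive assoc_inv_assoc assoc_assoc_inv];
      simp add: bimodule_facts)

lemma left_unit:
  fixes S :: "'u ring"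
  assumes M: "lmod S M"
  shows left_unit_additive: "additive (ring_bimod S \<boxtimes>\<^sub>S M) M (left_unit S M)"
    and left_unit_extensional: "left_unit S M \<in> extensional (carrier (ring_bimod S \<boxtimes>\<^sub>S M))"
    and left_unit_elt: "\<lbrakk>s \<in> carrier S; m \<in> carrier M\<rbrakk>
      \<Longrightarrow> left_unit S M (tensor_elt S (ring_bimod S) M s m) = s \<odot>\<^bsub>M\<^esub> m"
proof -
  have S: "ring S" using M by (rule lmod_ring)
  have "balanced S (ring_bimod S) M M (\<lambda>s m. s \<odot>\<^bsub>M\<^esub> m)"
    using M by (auto simp: balanced_def additive_def lmod_simps)
  note lift = tensor_lift[OF _ M lmod_group[OF M] this, folded left_unit_def]
  show "additive (ring_bimod S \<boxtimes>\<^sub>S M) M (left_unit S M)"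
    "left_unit S M \<in> extensional (carrier (ring_bimod S \<boxtimes>\<^sub>S M))"
    "\<lbrakk>s \<in> carrier S; m \<in> carrier M\<rbrakk>
      \<Longrightarrow> left_unit S M (tensor_elt S (ring_bimod S) M s m) = s \<odot>\<^bsub>M\<^esub> m"
    using lift S by simp_all
qed

lemma right_unit:
  fixes R :: "'u ring"
  assumes M: "rmod R M"
  shows right_unit_additive: "additive (M \<boxtimes>\<^sub>R ring_bimod R) M (right_unit R M)"
    and right_unit_extensional: "right_unit R M \<in> extensional (carrier (M \<boxtimes>\<^sub>R ring_bimod R))"
    and right_unit_elt: "\<lbrakk>r \<in> carrier R; m \<in> carrier M\<rbrakk>
      \<Longrightarrow> right_unit R M (tensor_elt R M (ring_bimod R) m r) = m \<odot>r\<^bsub>M\<^esub> r"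
proof -
  have R: "ring R" using M by (rule rmod_ring)
  have "balanced R M (ring_bimod R) M (\<lambda>m r. m \<odot>r\<^bsub>M\<^esub> r)"
    using M by (auto simp: balanced_def additive_def rmod_simps)
  note lift = tensor_lift[OF M _ rmod_group[OF M] this, folded right_unit_def]
  show "additive (M \<boxtimes>\<^sub>R ring_bimod R) M (right_unit R M)"
    "right_unit R M \<in> extensional (carrier (M \<boxtimes>\<^sub>R ring_bimod R))"
    "\<lbrakk>r \<in> carrier R; m \<in> carrier M\<rbrakk>
      \<Longrightarrow> right_unit R M (tensor_elt R M (ring_bimod R) m r) = m \<odot>r\<^bsub>M\<^esub> r"
    using lift R by simp_all
qed

lemma lin_left_unit [simp]:
  fixes S :: "'u ring"
  shows "lmod S M \<Longrightarrow> llin S (ring_bimod S \<boxtimes>\<^sub>S M) M (left_unit S M)"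
    "bimodule S R M \<Longrightarrow> rlin R (ring_bimod S \<boxtimes>\<^sub>S M) M (left_unit S M)"
proof -
  assume M: "lmod S M"
  have S: "ring S" using M by (rule lmod_ring)
  interpret ring S by fact
  show "llin S (ring_bimod S \<boxtimes>\<^sub>S M) M (left_unit S M)"
    by (rule llin_tensorI) (use S M in \<open>simp_all add: left_unit lmod_simps\<close>)
next
  assume M: "bimodule S R M"
  then interpret bimodule S R M .
  note [simp] = bimodule_facts[OF M]
  show "rlin R (ring_bimod S \<boxtimes>\<^sub>S M) M (left_unit S M)"
    by (rule rlin_tensorI) (use M in \<open>simp_all add: left_unit left.ring_axioms smult_rsmult rsmult_closed\<close>)
qed

lemma lin_right_unit [simp]:
  fixes R :: "'u ring"
  shows "rmod R M \<Longrightarrow> rlin R (M \<boxtimes>\<^sub>R ring_bimod R) M (right_unit R M)"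
    "bimodule S R M \<Longrightarrow> llin S (M \<boxtimes>\<^sub>R ring_bimod R) M (right_unit R M)"
proof -
  assume M: "rmod R M"
  have R: "ring R" using M by (rule rmod_ring)
  interpret ring R by fact
  show "rlin R (M \<boxtimes>\<^sub>R ring_bimod R) M (right_unit R M)"
    by (rule rlin_tensorI) (use R M in \<open>simp_all add: right_unit rmod_simps\<close>)
next
  assume M: "bimodule S R M"
  then interpret bimodule S R M .
  note [simp] = bimodule_facts[OF M]
  show "llin S (M \<boxtimes>\<^sub>R ring_bimod R) M (right_unit R M)"
    by (rule llin_tensorI) (use M in \<open>simp_all add: right_unit right.ring_axioms smult_rsmult smult_closed\<close>)
qed

lemma left_unit_inverse:
  fixes S :: "'u ring"
  assumes M: "lmod S M"
  shows left_unit_inv_additive: "additive M (ring_bimod S \<boxtimes>\<^sub>S M) (left_unit_inv S M)"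
    and left_unit_left_unit_inv: "m \<in> carrier M \<Longrightarrow> left_unit S M (left_unit_inv S M m) = m"
    and left_unit_inv_left_unit: "t \<in> carrier (ring_bimod S \<boxtimes>\<^sub>S M) \<Longrightarrow>
      left_unit_inv S M (left_unit S M t) = t"
proof -
  have S: "ring S" using M by (rule lmod_ring)
  then interpret ring S .
  note groups = ring_bimod_modules(3)[OF S] lmod_group[OF M]
  show add: "additive M (ring_bimod S \<boxtimes>\<^sub>S M) (left_unit_inv S M)"
    using groups by (simp add: left_unit_inv_def additive_def elt_add_right)
  show "m \<in> carrier M \<Longrightarrow> left_unit S M (left_unit_inv S M m) = m"
    by (simp add: left_unit_inv_def left_unit[OF M] lmod_simps[OF M])
  have id: "additive N N (\<lambda>x. x)" for N by (simp add: additive_def)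
  show "left_unit_inv S M (left_unit S M t) = t" if "t \<in> carrier (ring_bimod S \<boxtimes>\<^sub>S M)" for t
    by (rule tensor_ext[OF groups that additive_comp[OF left_unit_additive[OF M] add] id])
      (use M in \<open>simp add: left_unit[OF M] left_unit_inv_def flip: elt_balanced\<close>)
qed

lemma right_unit_inverse:
  fixes R :: "'u ring"
  assumes M: "rmod R M"
  shows right_unit_inv_additive: "additive M (M \<boxtimes>\<^sub>R ring_bimod R) (right_unit_inv R M)"
    and right_unit_right_unit_inv: "m \<in> carrier M \<Longrightarrow> right_unit R M (right_unit_inv R M m) = m"
    and right_unit_inv_right_unit: "t \<in> carrier (M \<boxtimes>\<^sub>R ring_bimod R) \<Longrightarrow>
      right_unit_inv R M (right_unit R M t) = t"
proof -
  have R: "ring R" using M by (rule rmod_ring)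
  then interpret ring R .
  note groups = rmod_group[OF M] ring_bimod_modules(3)[OF R]
  show add: "additive M (M \<boxtimes>\<^sub>R ring_bimod R) (right_unit_inv R M)"
    using groups by (simp add: right_unit_inv_def additive_def elt_add_left)
  show "m \<in> carrier M \<Longrightarrow> right_unit R M (right_unit_inv R M m) = m"
    by (simp add: right_unit_inv_def right_unit[OF M] rmod_simps[OF M])
  have id: "additive N N (\<lambda>x. x)" for N by (simp add: additive_def)
  show "right_unit_inv R M (right_unit R M t) = t" if "t \<in> carrier (M \<boxtimes>\<^sub>R ring_bimod R)" for t
    by (rule tensor_ext[OF groups that additive_comp[OF right_unit_additive[OF M] add] id])
      (use M in \<open>simp add: right_unit[OF M] right_unit_inv_def elt_balanced\<close>)
qed

lemma lin_left_unit_inv [simp]: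
  fixes S :: "'u ring"
  shows "lmod S M \<Longrightarrow> llin S M (ring_bimod S \<boxtimes>\<^sub>S M) (left_unit_inv S M)"
    "bimodule S R M \<Longrightarrow> rlin R M (ring_bimod S \<boxtimes>\<^sub>S M) (left_unit_inv S M)"
  using inverse_llin[OF left_unit_inv_additive left_unit_inv_left_unit left_unit_left_unit_inv,
      of S M S]
    inverse_rlin[OF left_unit_inv_additive left_unit_inv_left_unit left_unit_left_unit_inv,
      of S M R]
  by (auto simp: bimodule_facts lmod_ring[of S M] bimodule_rings(1)[of S R M]
      intro: rmod_tensor lmod_tensor)

lemma lin_right_unit_inv [simp]:
  fixes R :: "'u ring"
  shows "rmod R M \<Longrightarrow> rlin R M (M \<boxtimes>\<^sub>R ring_bimod R) (right_unit_inv R M)"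
    "bimodule S R M \<Longrightarrow> llin S M (M \<boxtimes>\<^sub>R ring_bimod R) (right_unit_inv R M)"
  using inverse_rlin[OF right_unit_inv_additive right_unit_inv_right_unit right_unit_right_unit_inv,
      of R M R]
    inverse_llin[OF right_unit_inv_additive right_unit_inv_right_unit right_unit_right_unit_inv,
      of R M S]
  by (auto simp: bimodule_facts rmod_ring[of R M] bimodule_rings(2)[of S R M]
      intro: rmod_tensor lmod_tensor)

section \<open>The bicategory of rings and bimodules\<close>

lemma id_map_hom: "bimodule S R M \<Longrightarrow> id_map M \<in> bimod_hom S R M M"
  by (simp add: bimod_hom_iff llin_id_map rlin_id_map bimodule_facts) (simp add: id_map_def)

lemma compose_hom:
  assumes L: "bimodule S R L" and f: "f \<in> bimod_hom S R L M" and g: "g \<in> bimod_hom S R M N"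
  shows "compose (carrier L) g f \<in> bimod_hom S R L N"
proof -
  note [simp] = bimodule_group[OF L] lmod_closed[OF bimodule_lmod[OF L]]
    rmod_closed[OF bimodule_rmod[OF L]]
  show ?thesis
    using f g unfolding bimod_hom_def additive_hom_def
    by (auto simp: compose_def PiE_def Pi_iff)
qed

lemma hom_closed: "\<lbrakk>f \<in> bimod_hom S R M N; x \<in> carrier M\<rbrakk> \<Longrightarrow> f x \<in> carrier N"
  by (auto simp: bimod_hom_def additive_hom_def)

lemma hom_lin:
  assumes "f \<in> bimod_hom S R M N"
  shows "llin S M N f" "rlin R M N f" "additive M N f"
  using assms by (auto simp: bimod_hom_iff llin_additive)

lemma hom_eqI:
  assumes "f \<in> bimod_hom S R M N" "g \<in> bimod_hom S R M N" "\<And>x. x \<in> carrier M \<Longrightarrow> f x = g x"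
  shows "f = g"
  using assms by (intro extensionalityI[where A = "carrier M"]) (auto simp: bimod_hom_iff)

lemma tensor_map_hom:
  fixes S :: "'u ring"
  assumes "bimodule U S P" "bimodule U S P'" "bimodule S R M" "bimodule S R M'"
    "f \<in> bimod_hom U S P P'" "g \<in> bimod_hom S R M M'"
  shows "tensor_map S P P' M M' f g \<in> bimod_hom U R (P \<boxtimes>\<^sub>S M) (P' \<boxtimes>\<^sub>S M')"
  using assms bimodule_facts[OF assms(1)] bimodule_facts[OF assms(2)]
    bimodule_facts[OF assms(3)] bimodule_facts[OF assms(4)]
  by (simp add: bimod_hom_iff tensor_map_extensional)

lemma assoc_hom:
  fixes S :: "'u ring"
  assumes "bimodule U S X" "bimodule S R Y" "bimodule R V Z"
  shows "tensor_assoc S R X Y Z \<in> bimod_hom U V (X \<boxtimes>\<^sub>S (Y \<boxtimes>\<^sub>R Z)) ((X \<boxtimes>\<^sub>S Y) \<boxtimes>\<^sub>R Z)"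
    "tensor_assoc_inv S R X Y Z \<in> bimod_hom U V ((X \<boxtimes>\<^sub>S Y) \<boxtimes>\<^sub>R Z) (X \<boxtimes>\<^sub>S (Y \<boxtimes>\<^sub>R Z))"
  using assms bimodule_facts[OF assms(1)] bimodule_facts[OF assms(2)] bimodule_facts[OF assms(3)]
  by (simp_all add: bimod_hom_iff assoc_extensional assoc_inv_extensional)

lemma unit_hom:
  fixes S :: "'u ring"
  assumes "bimodule S R M"
  shows "left_unit S M \<in> bimod_hom S R (ring_bimod S \<boxtimes>\<^sub>S M) M"
    "right_unit R M \<in> bimod_hom S R (M \<boxtimes>\<^sub>R ring_bimod R) M"
    "left_unit_inv S M \<in> bimod_hom S R M (ring_bimod S \<boxtimes>\<^sub>S M)"
    "right_unit_inv R M \<in> bimod_hom S R M (M \<boxtimes>\<^sub>R ring_bimod R)"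
  using assms bimodule_facts[OF assms]
  by (simp_all add: bimod_hom_iff left_unit_extensional right_unit_extensional)
    (simp_all add: left_unit_inv_def right_unit_inv_def)

context
  fixes S R :: "'u ring" and X Y Z :: "'u bimod"
  assumes groups: "abelian_group X" "abelian_group Y" "abelian_group Z"
begin

lemma tensor_hom_eqI:
  assumes fg: "f \<in> bimod_hom U V (X \<boxtimes>\<^sub>S Y) N" "g \<in> bimod_hom U V (X \<boxtimes>\<^sub>S Y) N"
    and "\<And>x y. \<lbrakk>x \<in> carrier X; y \<in> carrier Y\<rbrakk> \<Longrightarrow>
      f (tensor_elt S X Y x y) = g (tensor_elt S X Y x y)"
  shows "f = g"
  by (rule hom_eqI[OF fg], rule tensor_ext[OF groups(1,2) _ fg[THEN hom_lin(3)]]) (use assms in auto)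

lemma tensor3_hom_eqI:
  assumes fg: "f \<in> bimod_hom U V (X \<boxtimes>\<^sub>S (Y \<boxtimes>\<^sub>R Z)) N"
      "g \<in> bimod_hom U V (X \<boxtimes>\<^sub>S (Y \<boxtimes>\<^sub>R Z)) N"
    and "\<And>x y z. \<lbrakk>x \<in> carrier X; y \<in> carrier Y; z \<in> carrier Z\<rbrakk> \<Longrightarrow>
      f (tensor_elt3 S R X Y Z x y z) =
      g (tensor_elt3 S R X Y Z x y z)"
  shows "f = g"
  by (rule hom_eqI[OF fg], rule tensor3_ext[OF groups _ fg[THEN hom_lin(3)]]) (use assms in auto)

end

lemma tensor4_hom_eqI:
  fixes T S R :: "'u ring" and W X Y Z :: "'u bimod"
  assumes groups: "abelian_group W" "abelian_group X" "abelian_group Y" "abelian_group Z"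
    and fg: "f \<in> bimod_hom U V (W \<boxtimes>\<^sub>T (X \<boxtimes>\<^sub>S (Y \<boxtimes>\<^sub>R Z))) N"
      "g \<in> bimod_hom U V (W \<boxtimes>\<^sub>T (X \<boxtimes>\<^sub>S (Y \<boxtimes>\<^sub>R Z))) N"
    and "\<And>w x y z. \<lbrakk>w \<in> carrier W; x \<in> carrier X; y \<in> carrier Y; z \<in> carrier Z\<rbrakk> \<Longrightarrow>
      f (tensor_elt T W (X \<boxtimes>\<^sub>S (Y \<boxtimes>\<^sub>R Z)) w (tensor_elt3 S R X Y Z x y z)) =
      g (tensor_elt T W (X \<boxtimes>\<^sub>S (Y \<boxtimes>\<^sub>R Z)) w (tensor_elt3 S R X Y Z x y z))"
  shows "f = g"
  by (rule hom_eqI[OF fg], rule tensor4_ext[OF groups _ fg[THEN hom_lin(3)]]) (use assms in auto)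

lemma Bim_simps [simp]:
  "zero_cells Bim = {R. ring R}" "one_cells Bim R S = {M. bimodule S R M}"
  "two_cells Bim R S M N = bimod_hom S R M N" "id1 Bim = ring_bimod"
  "comp1 Bim R S U P M = P \<boxtimes>\<^sub>S M" "id2 Bim R S M = id_map M"
  "vcomp Bim R S M N K \<theta>' \<theta> = compose (carrier M) \<theta>' \<theta>"
  "hcomp Bim R S U P P' M M' \<eta> \<theta> = tensor_map S P P' M M' \<eta> \<theta>"
  "assoc2 Bim R S U V Q P M = tensor_assoc U S Q P M"
  "lunit2 Bim R S M = left_unit S M" "runit2 Bim R S M = right_unit R M"
  by (simp_all add: Bim_def)

lemma hom_elt_simps:
  fixes S :: "'u ring"
  shows "\<lbrakk>bimodule U S P; bimodule U S P'; bimodule S R M; bimodule S R M';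
      f \<in> bimod_hom U S P P'; g \<in> bimod_hom S R M M'; p \<in> carrier P; m \<in> carrier M\<rbrakk> \<Longrightarrow>
      tensor_map S P P' M M' f g (tensor_elt S P M p m) = tensor_elt S P' M' (f p) (g m)"
  by (auto simp: tensor_map_elt bimodule_facts hom_lin)

text \<open>Each coherence law equates two bimodule maps out of an iterated tensor product, and both sides
  only rebracket, or act on the factors of, an iterated pure tensor.\<close>

lemma bicategory_Bim: "bicategory (Bim :: ('u ring, 'u bimod, 'u \<Rightarrow> 'u) bicat)"
proof (rule bicategory.intro; (simp only: Bim_simps mem_Collect_eq iso2_def)?)
  note hom_intros = bimodule_tensor bimodule_ring_bimod compose_hom tensor_map_hom assoc_hom
    unit_hom id_map_hom
  show "id_map M \<in> bimod_hom S R M M" if "bimodule S R M" for S R and M :: "'u bimod"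
    using that by (rule id_map_hom)
  show "compose (carrier L) g f \<in> bimod_hom S R L N"
    if "bimodule S R L" "f \<in> bimod_hom S R L M" "g \<in> bimod_hom S R M N"
    for S R and L M N :: "'u bimod" and f g
    using that by (rule compose_hom)
  show "compose (carrier M) (id_map N) f = f" if "f \<in> bimod_hom S R M N"
    for S R and M N :: "'u bimod" and f
    using that hom_closed[OF that]
    by (intro extensionalityI[where A = "carrier M"])
      (auto simp: bimod_hom_iff compose_eq id_map_apply)
  show "compose (carrier M) f (id_map M) = f" if "f \<in> bimod_hom S R M N"
    for S R and M N :: "'u bimod" and f
    using that
    by (intro extensionalityI[where A = "carrier M"])
      (auto simp: bimod_hom_iff compose_eq id_map_apply)
  show "compose (carrier K) h (compose (carrier K) g f) = compose (carrier K) (compose (carrier L) h g) f"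
    if "f \<in> bimod_hom S R K L" for S R and K L :: "'u bimod" and f g h
    using that hom_closed[OF that]
    by (intro extensionalityI[where A = "carrier K"]) (auto simp: compose_eq)
  show "bimodule R R (ring_bimod R)" if "ring R" for R :: "'u ring"
    using that by (rule bimodule_ring_bimod)
  show "bimodule U R (P \<boxtimes>\<^sub>S M)" if "bimodule S R M" "bimodule U S P"
    for U S R :: "'u ring" and P M
    using that(2,1) by (rule bimodule_tensor)
  show "tensor_map S P P' M M' \<eta> \<theta> \<in> bimod_hom U R (P \<boxtimes>\<^sub>S M) (P' \<boxtimes>\<^sub>S M')"
    if "bimodule S R M" "bimodule S R M'" "bimodule U S P" "bimodule U S P'"
      "\<theta> \<in> bimod_hom S R M M'" "\<eta> \<in> bimod_hom U S P P'" for U S R :: "'u ring" and P P' M M' \<eta> \<theta>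
    using that by (intro tensor_map_hom)
  show "tensor_map S P P M M (id_map P) (id_map M) = id_map (P \<boxtimes>\<^sub>S M)"
    if "bimodule S R M" "bimodule U S P" for U S R :: "'u ring" and P M
    by (rule tensor_hom_eqI[where U = U and V = R and S = S and X = P and Y = M and N = "P \<boxtimes>\<^sub>S M"])
      (use that in \<open>auto intro!: hom_intros bimodule_group
      simp: hom_elt_simps[OF that(2,2,1,1)] id_map_hom id_map_apply\<close>)
  show "tensor_map S P P'' M M'' (compose (carrier P) \<eta>' \<eta>) (compose (carrier M) \<theta>' \<theta>) =
      compose (carrier (P \<boxtimes>\<^sub>S M)) (tensor_map S P' P'' M' M'' \<eta>' \<theta>') (tensor_map S P P' M M' \<eta> \<theta>)"
    if "bimodule S R M" "bimodule S R M'" "bimodule S R M''"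
      "bimodule U S P" "bimodule U S P'" "bimodule U S P''"
      "\<theta> \<in> bimod_hom S R M M'" "\<theta>' \<in> bimod_hom S R M' M''" "\<eta> \<in> bimod_hom U S P P'" "\<eta>' \<in> bimod_hom U S P' P''"
    for U S R :: "'u ring" and P P' P'' M M' M'' \<eta> \<theta> \<eta>' \<theta>'
    by (rule tensor_hom_eqI[where U = U and V = R and S = S and X = P and Y = M and
        N = "P'' \<boxtimes>\<^sub>S M''"], insert that)
      (auto intro: hom_intros bimodule_group simp: hom_elt_simps[where U = U and R = R] compose_hom compose_eq
        hom_closed)
  show "tensor_assoc U S Q P M \<in> bimod_hom V R (Q \<boxtimes>\<^sub>U (P \<boxtimes>\<^sub>S M)) ((Q \<boxtimes>\<^sub>U P) \<boxtimes>\<^sub>S M) \<and>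
      (\<exists>g \<in> bimod_hom V R ((Q \<boxtimes>\<^sub>U P) \<boxtimes>\<^sub>S M) (Q \<boxtimes>\<^sub>U (P \<boxtimes>\<^sub>S M)).
        compose (carrier (Q \<boxtimes>\<^sub>U (P \<boxtimes>\<^sub>S M))) g (tensor_assoc U S Q P M) = id_map (Q \<boxtimes>\<^sub>U (P \<boxtimes>\<^sub>S M)) \<and>
        compose (carrier ((Q \<boxtimes>\<^sub>U P) \<boxtimes>\<^sub>S M)) (tensor_assoc U S Q P M) g = id_map ((Q \<boxtimes>\<^sub>U P) \<boxtimes>\<^sub>S M))"
    if "bimodule S R M" "bimodule U S P" "bimodule V U Q"
    for V U S R :: "'u ring" and Q P M
    using assoc_hom[OF that(3,2,1)]
    by (intro conjI bexI[of _ "tensor_assoc_inv U S Q P M"])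
      (auto simp: compose_def id_map_def fun_eq_iff assoc_inverse that[THEN bimodule_lmod]
        that[THEN bimodule_rmod] that(2))
  show "compose (carrier (Q \<boxtimes>\<^sub>U (P \<boxtimes>\<^sub>S M))) (tensor_assoc U S Q' P' M')
        (tensor_map U Q Q' (P \<boxtimes>\<^sub>S M) (P' \<boxtimes>\<^sub>S M') \<zeta> (tensor_map S P P' M M' \<eta> \<theta>)) =
      compose (carrier (Q \<boxtimes>\<^sub>U (P \<boxtimes>\<^sub>S M)))
        (tensor_map S (Q \<boxtimes>\<^sub>U P) (Q' \<boxtimes>\<^sub>U P') M M' (tensor_map U Q Q' P P' \<zeta> \<eta>) \<theta>)
        (tensor_assoc U S Q P M)"
    if M: "bimodule S R M" "bimodule S R M'" and P: "bimodule U S P" "bimodule U S P'"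
      and Q: "bimodule V U Q" "bimodule V U Q'" and \<theta>: "\<theta> \<in> bimod_hom S R M M'"
      and \<eta>: "\<eta> \<in> bimod_hom U S P P'" and \<zeta>: "\<zeta> \<in> bimod_hom V U Q Q'"
    for V U S R :: "'u ring" and Q Q' P P' M M' \<theta> \<eta> \<zeta>
    by (rule tensor3_hom_eqI[where U = V and V = R and S = U and R = S and X = Q and Y = P and Z = M and N = "(Q' \<boxtimes>\<^sub>U P') \<boxtimes>\<^sub>S M'"])
      (use that in \<open>auto intro: hom_intros bimodule_group
        simp: hom_elt_simps[OF Q bimodule_tensor[OF P(1) M(1)] bimodule_tensor[OF P(2) M(2)] \<zeta>]
          hom_elt_simps[OF P M \<eta> \<theta>] hom_elt_simps[OF Q P \<zeta> \<eta>]
          hom_elt_simps[OF bimodule_tensor[OF Q(1) P(1)] bimodule_tensor[OF Q(2) P(2)] M _ \<theta>]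
          tensor_map_hom[OF P M \<eta> \<theta>] tensor_map_hom[OF Q P \<zeta> \<eta>] compose_eq
          hom_closed[OF \<zeta>] hom_closed[OF \<eta>] hom_closed[OF \<theta>] assoc_elt bimodule_facts\<close>)
  show "left_unit S M \<in> bimod_hom S R (ring_bimod S \<boxtimes>\<^sub>S M) M \<and>
      (\<exists>g \<in> bimod_hom S R M (ring_bimod S \<boxtimes>\<^sub>S M).
        compose (carrier (ring_bimod S \<boxtimes>\<^sub>S M)) g (left_unit S M) = id_map (ring_bimod S \<boxtimes>\<^sub>S M) \<and>
        compose (carrier M) (left_unit S M) g = id_map M)"
    if "bimodule S R M" for S R :: "'u ring" and M
    using unit_hom[OF that]
    by (intro conjI bexI[of _ "left_unit_inv S M"])
      (auto simp: compose_def id_map_def fun_eq_iff left_unit_inverse that[THEN bimodule_lmod])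
  show "right_unit R M \<in> bimod_hom S R (M \<boxtimes>\<^sub>R ring_bimod R) M \<and>
      (\<exists>g \<in> bimod_hom S R M (M \<boxtimes>\<^sub>R ring_bimod R).
        compose (carrier (M \<boxtimes>\<^sub>R ring_bimod R)) g (right_unit R M) = id_map (M \<boxtimes>\<^sub>R ring_bimod R) \<and>
        compose (carrier M) (right_unit R M) g = id_map M)"
    if "bimodule S R M" for S R :: "'u ring" and M
    using unit_hom[OF that]
    by (intro conjI bexI[of _ "right_unit_inv R M"])
      (auto simp: compose_def id_map_def fun_eq_iff right_unit_inverse that[THEN bimodule_rmod])
  show "compose (carrier (ring_bimod S \<boxtimes>\<^sub>S M)) (left_unit S M')
        (tensor_map S (ring_bimod S) (ring_bimod S) M M' (id_map (ring_bimod S)) \<theta>) =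
      compose (carrier (ring_bimod S \<boxtimes>\<^sub>S M)) \<theta> (left_unit S M)"
    if S: "ring S" and M: "bimodule S R M" "bimodule S R M'" and \<theta>: "\<theta> \<in> bimod_hom S R M M'"
    for S R :: "'u ring" and M M' \<theta>
    by (rule tensor_hom_eqI[where U = S and V = R and S = S and X = "ring_bimod S" and Y = M and N = M'])
      (use that in \<open>auto intro: hom_intros bimodule_group
        simp: hom_elt_simps[OF bimodule_ring_bimod[OF S] bimodule_ring_bimod[OF S] M] id_map_hom
          compose_eq id_map_apply left_unit_elt bimodule_facts hom_closed[OF \<theta>]
          llin_smult[OF hom_lin(1)[OF \<theta>]]\<close>)
  show "compose (carrier (M \<boxtimes>\<^sub>R ring_bimod R)) (right_unit R M')
        (tensor_map R M M' (ring_bimod R) (ring_bimod R) \<theta> (id_map (ring_bimod R))) =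
      compose (carrier (M \<boxtimes>\<^sub>R ring_bimod R)) \<theta> (right_unit R M)"
    if R: "ring R" and M: "bimodule S R M" "bimodule S R M'" and \<theta>: "\<theta> \<in> bimod_hom S R M M'"
    for S R :: "'u ring" and M M' \<theta>
    by (rule tensor_hom_eqI[where U = S and V = R and S = R and X = M and Y = "ring_bimod R" and N = M'])
      (use that in \<open>auto intro: hom_intros bimodule_group
        simp: hom_elt_simps[OF M bimodule_ring_bimod[OF R] bimodule_ring_bimod[OF R]] id_map_hom
          compose_eq id_map_apply right_unit_elt bimodule_facts hom_closed[OF \<theta>]
          rlin_smult[OF hom_lin(2)[OF \<theta>]]\<close>)
  show "compose (carrier (K \<boxtimes>\<^sub>V (Q \<boxtimes>\<^sub>U (P \<boxtimes>\<^sub>S M))))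
        (tensor_assoc U S (K \<boxtimes>\<^sub>V Q) P M) (tensor_assoc V U K Q (P \<boxtimes>\<^sub>S M)) =
      compose (carrier (K \<boxtimes>\<^sub>V (Q \<boxtimes>\<^sub>U (P \<boxtimes>\<^sub>S M))))
        (tensor_map S (K \<boxtimes>\<^sub>V (Q \<boxtimes>\<^sub>U P)) ((K \<boxtimes>\<^sub>V Q) \<boxtimes>\<^sub>U P) M M
          (tensor_assoc V U K Q P) (id_map M))
        (compose (carrier (K \<boxtimes>\<^sub>V (Q \<boxtimes>\<^sub>U (P \<boxtimes>\<^sub>S M))))
          (tensor_assoc V S K (Q \<boxtimes>\<^sub>U P) M)
          (tensor_map V K K (Q \<boxtimes>\<^sub>U (P \<boxtimes>\<^sub>S M)) ((Q \<boxtimes>\<^sub>U P) \<boxtimes>\<^sub>S M)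
            (id_map K) (tensor_assoc U S Q P M)))"
    (is "?lhs = ?rhs")
    if M: "bimodule S R M" and P: "bimodule U S P" and Q: "bimodule V U Q" and K: "bimodule W V K"
    for W V U S R :: "'u ring" and K Q P M
  proof (rule tensor4_hom_eqI[where U = W and V = R and T = V and S = U and R = S and W = K and
        X = Q and Y = P and Z = M and N = "((K \<boxtimes>\<^sub>V Q) \<boxtimes>\<^sub>U P) \<boxtimes>\<^sub>S M"])
    note [simp] = that bimodule_facts[OF M] bimodule_facts[OF P] bimodule_facts[OF Q]
      bimodule_facts[OF K] id_map_hom assoc_hom
    show "?lhs \<in> bimod_hom W R (K \<boxtimes>\<^sub>V (Q \<boxtimes>\<^sub>U (P \<boxtimes>\<^sub>S M))) (((K \<boxtimes>\<^sub>V Q) \<boxtimes>\<^sub>U P) \<boxtimes>\<^sub>S M)"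
      by (rule compose_hom[OF _ assoc_hom(1) assoc_hom(1)]) simp_all
    show "?rhs \<in> bimod_hom W R (K \<boxtimes>\<^sub>V (Q \<boxtimes>\<^sub>U (P \<boxtimes>\<^sub>S M))) (((K \<boxtimes>\<^sub>V Q) \<boxtimes>\<^sub>U P) \<boxtimes>\<^sub>S M)"
      by (rule compose_hom[OF _ compose_hom[OF _ tensor_map_hom assoc_hom(1)] tensor_map_hom])
        simp_all
  qed (use that in \<open>auto simp: hom_elt_simps[where U = W and R = R] id_map_hom assoc_hom
          compose_eq id_map_apply assoc_elt bimodule_facts hom_closed[OF assoc_hom(1)]\<close>)
  show "compose (carrier (P \<boxtimes>\<^sub>S (ring_bimod S \<boxtimes>\<^sub>S M)))
        (tensor_map S (P \<boxtimes>\<^sub>S ring_bimod S) P M M (right_unit S P) (id_map M))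
        (tensor_assoc S S P (ring_bimod S) M) =
      tensor_map S P P (ring_bimod S \<boxtimes>\<^sub>S M) M (id_map P) (left_unit S M)"
    if S: "ring S" and M: "bimodule S R M" and P: "bimodule U S P"
    for U S R :: "'u ring" and P M
    by (rule tensor3_hom_eqI[where U = U and V = R and S = S and R = S and X = P and Y = "ring_bimod S" and
        Z = M and N = "P \<boxtimes>\<^sub>S M"])
      (use that in \<open>auto intro: hom_intros bimodule_group
        simp: hom_elt_simps[where U = U and R = R] id_map_hom unit_hom compose_eq id_map_apply
          assoc_elt bimodule_facts left_unit_elt right_unit_elt elt_balanced\<close>)
qed

section \<open>A calculus of whiskered maps\<close>

lemma tensor_lift_cong:
  "(\<And>p m. \<lbrakk>p \<in> carrier P; m \<in> carrier M\<rbrakk> \<Longrightarrow> b p m = b' p m) \<Longrightarrow>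
    tensor_lift S P M N b = tensor_lift S P M N b'"
  by (simp add: tensor_lift_def)

lemma lwhisker_cong:
  "(\<And>m. m \<in> carrier M \<Longrightarrow> g m = g' m) \<Longrightarrow> lwhisker S P M M' g = lwhisker S P M M' g'"
  unfolding lwhisker_def tensor_map_def by (rule tensor_lift_cong) simp

lemma whisker_closed [simp]:
  fixes S :: "'u ring"
  shows "\<lbrakk>rmod S P; lmod S M; lmod S M'; llin S M M' g; t \<in> carrier (P \<boxtimes>\<^sub>S M)\<rbrakk>
    \<Longrightarrow> lwhisker S P M M' g t \<in> carrier (P \<boxtimes>\<^sub>S M')"
  "\<lbrakk>rmod S P; rmod S P'; lmod S M; rlin S P P' f; t \<in> carrier (P \<boxtimes>\<^sub>S M)\<rbrakk>
    \<Longrightarrow> rwhisker S P P' M f t \<in> carrier (P' \<boxtimes>\<^sub>S M)"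
  by (auto intro: additive_closed[OF lwhisker_additive] additive_closed[OF rwhisker_additive])

lemma assoc_closed [simp]:
  fixes S R :: "'u ring"
  shows "\<lbrakk>rmod S X; bimodule S R Y; lmod R Z; t \<in> carrier (X \<boxtimes>\<^sub>S (Y \<boxtimes>\<^sub>R Z))\<rbrakk> \<Longrightarrow>
    tensor_assoc S R X Y Z t \<in> carrier ((X \<boxtimes>\<^sub>S Y) \<boxtimes>\<^sub>R Z)"
  "\<lbrakk>rmod S X; bimodule S R Y; lmod R Z; t \<in> carrier ((X \<boxtimes>\<^sub>S Y) \<boxtimes>\<^sub>R Z)\<rbrakk> \<Longrightarrow>
    tensor_assoc_inv S R X Y Z t \<in> carrier (X \<boxtimes>\<^sub>S (Y \<boxtimes>\<^sub>R Z))"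
  by (auto intro: additive_closed[OF assoc_additive] additive_closed[OF assoc_inv_additive])

lemma lwhisker_comp:
  fixes S :: "'u ring"
  assumes P: "rmod S P" and M: "lmod S M" "lmod S M'" "lmod S M''"
    and g: "llin S M M' g" "llin S M' M'' g'" and t: "t \<in> carrier (P \<boxtimes>\<^sub>S M)"
  shows "lwhisker S P M' M'' g' (lwhisker S P M M' g t) = lwhisker S P M M'' (\<lambda>m. g' (g m)) t"
  by (rule tensor_ext[OF rmod_group[OF P] lmod_group[OF M(1)] t
      additive_comp[OF lwhisker_additive lwhisker_additive] lwhisker_additive])
    (use P M g llin_comp[OF g] additive_closed[OF llin_additive[OF g(1)]]
      in \<open>simp_all add: lwhisker_elt comp_def\<close>)

text \<open>Tensoring with an element on the right is left linear, natural, and compatible with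
  associativity. As the pure tensor \<open>x \<otimes> (y \<otimes> z)\<close> is the image of \<open>x \<otimes> y\<close> under
  \<open>X \<otimes> (\<hyphen> \<otimes> z)\<close>, it reduces statements about \<open>X \<otimes> (Y \<otimes> Z)\<close> to statements about \<open>X \<otimes> Y\<close>.\<close>

definition tensor_right :: "'u ring \<Rightarrow> 'u bimod \<Rightarrow> 'u bimod \<Rightarrow> 'u \<Rightarrow> 'u \<Rightarrow> 'u" where
  "tensor_right R Y Z z = (\<lambda>y. tensor_elt R Y Z y z)"

lemma tensor_right_apply: "tensor_right R Y Z z y = tensor_elt R Y Z y z"
  by (simp add: tensor_right_def)

lemma llin_tensor_right [simp]:
  fixes S R :: "'u ring"
  shows "\<lbrakk>bimodule S R Y; z \<in> carrier Z\<rbrakk> \<Longrightarrow> llin S Y (Y \<boxtimes>\<^sub>R Z) (tensor_right R Y Z z)"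
  by (auto simp: llin_def tensor_right_def smult_elt intro: additive_elt_left bimodule_group)

context
  fixes S R :: "'u ring" and X Y Z :: "'u bimod"
  assumes X: "rmod S X" and Y: "bimodule S R Y" and Z: "lmod R Z"
begin

lemmas assoc_facts = X Y Z bimodule_facts[OF Y] rmod_group[OF X] lmod_group[OF Z]

lemma lwhisker_tensor_right:
  assumes "x \<in> carrier X" "y \<in> carrier Y" "z \<in> carrier Z"
  shows "lwhisker S X Y (Y \<boxtimes>\<^sub>R Z) (tensor_right R Y Z z) (tensor_elt S X Y x y) =
    tensor_elt3 S R X Y Z x y z"
  using assms assoc_facts lwhisker_elt[OF X, of Y "Y \<boxtimes>\<^sub>R Z" "tensor_right R Y Z z" x y]
  by (simp add: lmod_tensor[OF Y Z]) (simp add: tensor_right_def)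

lemma assoc_tensor_right:
  assumes "t \<in> carrier (X \<boxtimes>\<^sub>S Y)" "z \<in> carrier Z"
  shows "tensor_assoc S R X Y Z (lwhisker S X Y (Y \<boxtimes>\<^sub>R Z) (tensor_right R Y Z z) t) =
    tensor_elt R (X \<boxtimes>\<^sub>S Y) Z t z"
  by (rule tensor_ext[OF _ _ assms(1)
      additive_comp[OF lwhisker_additive assoc_additive] additive_elt_left])
    (use assms assoc_facts in \<open>simp_all add: lwhisker_tensor_right assoc_elt\<close>)

lemma assoc_inv_tensor_right:
  assumes "t \<in> carrier (X \<boxtimes>\<^sub>S Y)" "z \<in> carrier Z"
  shows "tensor_assoc_inv S R X Y Z (tensor_elt R (X \<boxtimes>\<^sub>S Y) Z t z) =
    lwhisker S X Y (Y \<boxtimes>\<^sub>R Z) (tensor_right R Y Z z) t"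
  using assms assoc_facts by (simp add: assoc_inv_assoc flip: assoc_tensor_right)

end

lemma assoc_natural:
  fixes S R :: "'u ring"
  assumes X: "rmod S X" and Y: "bimodule S R Y" and Z: "lmod R Z" "lmod R Z'" and g: "llin R Z Z' g"
    and t: "t \<in> carrier (X \<boxtimes>\<^sub>S (Y \<boxtimes>\<^sub>R Z))"
  shows "lwhisker R (X \<boxtimes>\<^sub>S Y) Z Z' g (tensor_assoc S R X Y Z t) =
    tensor_assoc S R X Y Z' (lwhisker S X (Y \<boxtimes>\<^sub>R Z) (Y \<boxtimes>\<^sub>R Z') (lwhisker R Y Z Z' g) t)"
  by (rule tensor3_ext[OF _ _ _ t
      additive_comp[OF assoc_additive lwhisker_additive]
      additive_comp[OF lwhisker_additive assoc_additive]])
    (use assoc_facts[OF X Y Z(1)] assoc_facts[OF X Y Z(2)] g additive_closed[OF llin_additive[OF g]]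
    in \<open>auto simp: lwhisker_elt assoc_elt\<close>)

text \<open>\<open>f \<otimes> Z\<close> with both sides rebracketed to the right, for a map \<open>f\<close> with two factors in its
  source and target, in its source only, and in its target only. In \<open>Z\<close> all three are natural
  with respect to left linear maps, so that no further associativity isomorphisms occur in
  calculations with them.\<close>

definition extend_map ::
    "'u ring \<Rightarrow> 'u bimod \<Rightarrow> 'u bimod \<Rightarrow> 'u ring \<Rightarrow> 'u bimod \<Rightarrow> 'u bimod \<Rightarrow> 'u ring \<Rightarrow> 'u bimod \<Rightarrow>
      ('u \<Rightarrow> 'u) \<Rightarrow> 'u \<Rightarrow> 'u" where
  "extend_map S X Y T X' Y' R Z f t =
     tensor_assoc_inv T R X' Y' Z
       (rwhisker R (X \<boxtimes>\<^sub>S Y) (X' \<boxtimes>\<^sub>T Y') Z f (tensor_assoc S R X Y Z t))"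

definition extend_mult ::
    "'u ring \<Rightarrow> 'u bimod \<Rightarrow> 'u bimod \<Rightarrow> 'u bimod \<Rightarrow> 'u ring \<Rightarrow> 'u bimod \<Rightarrow>
      ('u \<Rightarrow> 'u) \<Rightarrow> 'u \<Rightarrow> 'u" where
  "extend_mult S X Y X' R Z f t = rwhisker R (X \<boxtimes>\<^sub>S Y) X' Z f (tensor_assoc S R X Y Z t)"

definition extend_comult ::
    "'u bimod \<Rightarrow> 'u ring \<Rightarrow> 'u bimod \<Rightarrow> 'u bimod \<Rightarrow> 'u ring \<Rightarrow> 'u bimod \<Rightarrow>
      ('u \<Rightarrow> 'u) \<Rightarrow> 'u \<Rightarrow> 'u" where
  "extend_comult X T X' Y' R Z f t =
     tensor_assoc_inv T R X' Y' Z (rwhisker R X (X' \<boxtimes>\<^sub>T Y') Z f t)"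

context
  fixes S T R :: "'u ring" and X Y X' Y' :: "'u bimod" and f
  assumes X: "rmod S X" and Y: "bimodule S R Y" and X': "rmod T X'" and Y': "bimodule T R Y'"
    and f: "rlin R (X \<boxtimes>\<^sub>S Y) (X' \<boxtimes>\<^sub>T Y') f"
begin

lemmas extend_map_facts = X Y X' Y' f bimodule_facts[OF Y] bimodule_facts[OF Y']
  rmod_group[OF X] rmod_group[OF X'] additive_closed[OF rlin_additive[OF f]]

lemma extend_map_additive:
  assumes "lmod R Z"
  shows "additive (X \<boxtimes>\<^sub>S (Y \<boxtimes>\<^sub>R Z)) (X' \<boxtimes>\<^sub>T (Y' \<boxtimes>\<^sub>R Z)) (extend_map S X Y T X' Y' R Z f)"
  unfolding extend_map_def
  by (rule additive_comp[OF additive_comp[OF assoc_additive rwhisker_additive] assoc_inv_additive])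
    (use assms extend_map_facts in auto)

lemma extend_map_tensor_right:
  assumes "lmod R Z" "z \<in> carrier Z" "t \<in> carrier (X \<boxtimes>\<^sub>S Y)"
  shows "extend_map S X Y T X' Y' R Z f (lwhisker S X Y (Y \<boxtimes>\<^sub>R Z) (tensor_right R Y Z z) t) =
    lwhisker T X' Y' (Y' \<boxtimes>\<^sub>R Z) (tensor_right R Y' Z z) (f t)"
  unfolding extend_map_def using assms extend_map_facts
  by (simp add: assoc_tensor_right rwhisker_elt assoc_inv_tensor_right)

lemma extend_map_elt:
  assumes "lmod R Z" "x \<in> carrier X" "y \<in> carrier Y" "z \<in> carrier Z"
  shows "extend_map S X Y T X' Y' R Z f (tensor_elt3 S R X Y Z x y z) =
    lwhisker T X' Y' (Y' \<boxtimes>\<^sub>R Z) (tensor_right R Y' Z z) (f (tensor_elt S X Y x y))"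
  using extend_map_tensor_right[OF assms(1,4), of "tensor_elt S X Y x y"] assms extend_map_facts
  by (simp add: lwhisker_tensor_right)

lemma extend_map_natural:
  assumes Z: "lmod R Z" "lmod R Z'" and g: "llin R Z Z' g"
    and t: "t \<in> carrier (X \<boxtimes>\<^sub>S (Y \<boxtimes>\<^sub>R Z))"
  shows "extend_map S X Y T X' Y' R Z' f
      (lwhisker S X (Y \<boxtimes>\<^sub>R Z) (Y \<boxtimes>\<^sub>R Z') (lwhisker R Y Z Z' g) t) =
    lwhisker T X' (Y' \<boxtimes>\<^sub>R Z) (Y' \<boxtimes>\<^sub>R Z') (lwhisker R Y' Z Z' g)
      (extend_map S X Y T X' Y' R Z f t)"
proof (rule tensor3_ext[OF _ _ _ t
    additive_comp[OF lwhisker_additive extend_map_additive]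
    additive_comp[OF extend_map_additive lwhisker_additive]])
  note [simp] = extend_map_facts Z g lmod_group[OF Z(1)]
  fix x y z assume xyz: "x \<in> carrier X" "y \<in> carrier Y" "z \<in> carrier Z"
  note [simp] = additive_closed[OF llin_additive[OF g]]
  have "lwhisker T X' (Y' \<boxtimes>\<^sub>R Z) (Y' \<boxtimes>\<^sub>R Z') (lwhisker R Y' Z Z' g)
      (lwhisker T X' Y' (Y' \<boxtimes>\<^sub>R Z) (tensor_right R Y' Z z) (f (tensor_elt S X Y x y))) =
    lwhisker T X' Y' (Y' \<boxtimes>\<^sub>R Z') (\<lambda>m. lwhisker R Y' Z Z' g (tensor_right R Y' Z z m)) (f (tensor_elt S X Y x y))"
    by (rule lwhisker_comp) (use xyz in auto)
  also have "lwhisker T X' Y' (Y' \<boxtimes>\<^sub>R Z') (\<lambda>m. lwhisker R Y' Z Z' g (tensor_right R Y' Z z m)) =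
      lwhisker T X' Y' (Y' \<boxtimes>\<^sub>R Z') (tensor_right R Y' Z' (g z))"
    by (rule lwhisker_cong) (use xyz in \<open>simp add: tensor_right_apply lwhisker_elt\<close>)
  finally show "extend_map S X Y T X' Y' R Z' f
      (lwhisker S X (Y \<boxtimes>\<^sub>R Z) (Y \<boxtimes>\<^sub>R Z') (lwhisker R Y Z Z' g) (tensor_elt3 S R X Y Z x y z)) =
    lwhisker T X' (Y' \<boxtimes>\<^sub>R Z) (Y' \<boxtimes>\<^sub>R Z') (lwhisker R Y' Z Z' g)
      (extend_map S X Y T X' Y' R Z f (tensor_elt3 S R X Y Z x y z))"
    using xyz by (simp add: lwhisker_elt extend_map_elt)
qed (use extend_map_facts Z g lmod_group[OF Z(1)] in auto)

end

lemma extend_map_closed [simp]: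
  fixes S R T :: "'u ring"
  shows "\<lbrakk>rmod S X; bimodule S R Y; rmod T X'; bimodule T R Y'; lmod R Z;
    rlin R (X \<boxtimes>\<^sub>S Y) (X' \<boxtimes>\<^sub>T Y') f; t \<in> carrier (X \<boxtimes>\<^sub>S (Y \<boxtimes>\<^sub>R Z))\<rbrakk> \<Longrightarrow>
    extend_map S X Y T X' Y' R Z f t \<in> carrier (X' \<boxtimes>\<^sub>T (Y' \<boxtimes>\<^sub>R Z))"
  by (rule additive_closed[OF extend_map_additive])

lemma extend_map_llin [simp]:
  fixes S R T U :: "'u ring"
  assumes "bimodule U S X" "bimodule S R Y" "bimodule U T X'" "bimodule T R Y'" "lmod R Z"
    "llin U (X \<boxtimes>\<^sub>S Y) (X' \<boxtimes>\<^sub>T Y') f" "rlin R (X \<boxtimes>\<^sub>S Y) (X' \<boxtimes>\<^sub>T Y') f"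
  shows "llin U (X \<boxtimes>\<^sub>S (Y \<boxtimes>\<^sub>R Z)) (X' \<boxtimes>\<^sub>T (Y' \<boxtimes>\<^sub>R Z)) (extend_map S X Y T X' Y' R Z f)"
proof -
  have "llin U (X \<boxtimes>\<^sub>S (Y \<boxtimes>\<^sub>R Z)) (X' \<boxtimes>\<^sub>T (Y' \<boxtimes>\<^sub>R Z))
      (tensor_assoc_inv T R X' Y' Z \<circ> (rwhisker R (X \<boxtimes>\<^sub>S Y) (X' \<boxtimes>\<^sub>T Y') Z f \<circ> tensor_assoc S R X Y Z))"
    by (rule llin_comp[OF llin_comp[OF lin_assoc(1) rwhisker_llin] lin_assoc_inv(1)])
      (use assms in \<open>auto simp: bimodule_facts\<close>)
  then show ?thesis
    by (simp add: comp_def extend_map_def[abs_def])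
qed

lemma extend_map_rlin [simp]:
  fixes S R T U :: "'u ring"
  assumes "rmod S X" "bimodule S R Y" "rmod T X'" "bimodule T R Y'" "bimodule R V Z"
    "rlin R (X \<boxtimes>\<^sub>S Y) (X' \<boxtimes>\<^sub>T Y') f"
  shows "rlin V (X \<boxtimes>\<^sub>S (Y \<boxtimes>\<^sub>R Z)) (X' \<boxtimes>\<^sub>T (Y' \<boxtimes>\<^sub>R Z)) (extend_map S X Y T X' Y' R Z f)"
proof -
  have "rlin V (X \<boxtimes>\<^sub>S (Y \<boxtimes>\<^sub>R Z)) (X' \<boxtimes>\<^sub>T (Y' \<boxtimes>\<^sub>R Z))
      (tensor_assoc_inv T R X' Y' Z \<circ> (rwhisker R (X \<boxtimes>\<^sub>S Y) (X' \<boxtimes>\<^sub>T Y') Z f \<circ> tensor_assoc S R X Y Z))"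
    by (rule rlin_comp[OF rlin_comp[OF lin_assoc(2) rwhisker_rlin] lin_assoc_inv(2)])
      (use assms in \<open>auto simp: bimodule_facts\<close>)
  then show ?thesis
    by (simp add: comp_def extend_map_def[abs_def])
qed

context
  fixes S R :: "'u ring" and X Y X' :: "'u bimod" and f
  assumes X: "rmod S X" and Y: "bimodule S R Y" and X': "rmod R X'"
    and f: "rlin R (X \<boxtimes>\<^sub>S Y) X' f"
begin

lemmas extend_mult_facts = X Y X' f bimodule_facts[OF Y] rmod_group[OF X] rmod_group[OF X']
  additive_closed[OF rlin_additive[OF f]]

lemma extend_mult_additive:
  assumes "lmod R Z"
  shows "additive (X \<boxtimes>\<^sub>S (Y \<boxtimes>\<^sub>R Z)) (X' \<boxtimes>\<^sub>R Z) (extend_mult S X Y X' R Z f)"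
  unfolding extend_mult_def
  by (rule additive_comp[OF assoc_additive rwhisker_additive]) (use assms extend_mult_facts in auto)

lemma extend_mult_tensor_right:
  assumes "lmod R Z" "z \<in> carrier Z" "t \<in> carrier (X \<boxtimes>\<^sub>S Y)"
  shows "extend_mult S X Y X' R Z f (lwhisker S X Y (Y \<boxtimes>\<^sub>R Z) (tensor_right R Y Z z) t) =
    tensor_elt R X' Z (f t) z"
  unfolding extend_mult_def using assms extend_mult_facts
  by (simp add: assoc_tensor_right rwhisker_elt)

lemma extend_mult_elt:
  assumes "lmod R Z" "x \<in> carrier X" "y \<in> carrier Y" "z \<in> carrier Z"
  shows "extend_mult S X Y X' R Z f (tensor_elt3 S R X Y Z x y z) =
    tensor_elt R X' Z (f (tensor_elt S X Y x y)) z"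
  unfolding extend_mult_def using assms extend_mult_facts
  by (simp add: assoc_elt rwhisker_elt)

end

lemma extend_mult_closed [simp]:
  fixes S R :: "'u ring"
  shows "\<lbrakk>rmod S X; bimodule S R Y; rmod R X'; lmod R Z;
    rlin R (X \<boxtimes>\<^sub>S Y) X' f; t \<in> carrier (X \<boxtimes>\<^sub>S (Y \<boxtimes>\<^sub>R Z))\<rbrakk> \<Longrightarrow>
    extend_mult S X Y X' R Z f t \<in> carrier (X' \<boxtimes>\<^sub>R Z)"
  by (rule additive_closed[OF extend_mult_additive])

lemma extend_mult_llin [simp]:
  fixes S R U :: "'u ring"
  assumes "bimodule U S X" "bimodule S R Y" "bimodule U R X'" "lmod R Z"
    "llin U (X \<boxtimes>\<^sub>S Y) X' f" "rlin R (X \<boxtimes>\<^sub>S Y) X' f"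
  shows "llin U (X \<boxtimes>\<^sub>S (Y \<boxtimes>\<^sub>R Z)) (X' \<boxtimes>\<^sub>R Z) (extend_mult S X Y X' R Z f)"
proof -
  have "llin U (X \<boxtimes>\<^sub>S (Y \<boxtimes>\<^sub>R Z)) (X' \<boxtimes>\<^sub>R Z)
      (rwhisker R (X \<boxtimes>\<^sub>S Y) X' Z f \<circ> tensor_assoc S R X Y Z)"
    by (rule llin_comp[OF lin_assoc(1) rwhisker_llin]) (use assms in \<open>auto simp: bimodule_facts\<close>)
  then show ?thesis
    by (simp add: comp_def extend_mult_def[abs_def])
qed

context
  fixes T R :: "'u ring" and X X' Y' :: "'u bimod" and f
  assumes X: "rmod R X" and X': "rmod T X'" and Y': "bimodule T R Y'"
    and f: "rlin R X (X' \<boxtimes>\<^sub>T Y') f"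
begin

lemmas extend_comult_facts = X X' Y' f bimodule_facts[OF Y'] rmod_group[OF X] rmod_group[OF X']
  additive_closed[OF rlin_additive[OF f]]

lemma extend_comult_additive:
  assumes "lmod R Z"
  shows "additive (X \<boxtimes>\<^sub>R Z) (X' \<boxtimes>\<^sub>T (Y' \<boxtimes>\<^sub>R Z)) (extend_comult X T X' Y' R Z f)"
  unfolding extend_comult_def
  by (rule additive_comp[OF rwhisker_additive assoc_inv_additive])
    (use assms extend_comult_facts in auto)

lemma extend_comult_elt:
  assumes "lmod R Z" "x \<in> carrier X" "z \<in> carrier Z"
  shows "extend_comult X T X' Y' R Z f (tensor_elt R X Z x z) =
    lwhisker T X' Y' (Y' \<boxtimes>\<^sub>R Z) (tensor_right R Y' Z z) (f x)"
  unfolding extend_comult_def using assms extend_comult_facts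
  by (simp add: rwhisker_elt assoc_inv_tensor_right)

end

lemma extend_comult_closed [simp]:
  fixes R T :: "'u ring"
  shows "\<lbrakk>rmod R X; rmod T X'; bimodule T R Y'; lmod R Z;
    rlin R X (X' \<boxtimes>\<^sub>T Y') f; t \<in> carrier (X \<boxtimes>\<^sub>R Z)\<rbrakk> \<Longrightarrow>
    extend_comult X T X' Y' R Z f t \<in> carrier (X' \<boxtimes>\<^sub>T (Y' \<boxtimes>\<^sub>R Z))"
  by (rule additive_closed[OF extend_comult_additive])

lemma extend_comult_llin [simp]:
  fixes R T U :: "'u ring"
  assumes "bimodule U R X" "bimodule U T X'" "bimodule T R Y'" "lmod R Z"
    "llin U X (X' \<boxtimes>\<^sub>T Y') f" "rlin R X (X' \<boxtimes>\<^sub>T Y') f"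
  shows "llin U (X \<boxtimes>\<^sub>R Z) (X' \<boxtimes>\<^sub>T (Y' \<boxtimes>\<^sub>R Z)) (extend_comult X T X' Y' R Z f)"
proof -
  have "llin U (X \<boxtimes>\<^sub>R Z) (X' \<boxtimes>\<^sub>T (Y' \<boxtimes>\<^sub>R Z))
      (tensor_assoc_inv T R X' Y' Z \<circ> rwhisker R X (X' \<boxtimes>\<^sub>T Y') Z f)"
    by (rule llin_comp[OF rwhisker_llin lin_assoc_inv(1)]) (use assms in \<open>auto simp: bimodule_facts\<close>)
  then show ?thesis
    by (simp add: comp_def extend_comult_def[abs_def])
qed

lemma lwhisker_comp3:
  fixes S :: "'u ring"
  assumes P: "rmod S P" and M: "lmod S M" "lmod S M'" "lmod S M''" "lmod S M'''"
    and g: "llin S M M' g" "llin S M' M'' g'" "llin S M'' M''' g''"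
    and t: "t \<in> carrier (P \<boxtimes>\<^sub>S M)"
  shows "lwhisker S P M'' M''' g'' (lwhisker S P M' M'' g' (lwhisker S P M M' g t)) =
    lwhisker S P M M''' (\<lambda>m. g'' (g' (g m))) t"
  using lwhisker_comp[OF P M(1,2,3) g(1,2) t]
    lwhisker_comp[OF P M(1,3,4) llin_comp[OF g(1,2), unfolded comp_def] g(3) t] by simp

lemma llin_cong:
  assumes "lmod S M" "\<And>x. x \<in> carrier M \<Longrightarrow> f x = g x" "llin S M N g"
  shows "llin S M N f"
  using assms(1,3) lmod_group[OF assms(1)]
  by (auto simp: llin_def additive_def assms(2) Pi_iff)

lemma rlin_cong:
  assumes "rmod S M" "\<And>x. x \<in> carrier M \<Longrightarrow> f x = g x" "rlin S M N g"
  shows "rlin S M N f"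
  using assms(1,3) rmod_group[OF assms(1)]
  by (auto simp: rlin_def additive_def assms(2) Pi_iff)

end

section \<open>Pasting the structure maps of composable 1-cells\<close>

text \<open>
  Two composable 1-cells \<open>M\<close> and \<open>P\<close>, of whose two structure maps only one is considered: \<open>A\<close>, \<open>B\<close>, \<open>E\<close>
  are either the three algebras or the three coalgebras, since the composite is formed in the same
  way for both. The names below stand for tensor products that are nested to the right, so \<open>EPM\<close> is
  \<open>E \<otimes> (P \<otimes> M)\<close>; \<open>ext_f Z\<close> is \<open>f \<otimes> Z\<close>, rebracketed, and \<open>\<pi>\<close> is the pasted map.
\<close>

locale pasting = universe type_of_universe
  for type_of_universe :: "'u itself" +
  fixes R S U :: "'u ring" and A B E P M :: "'u bimod" and \<sigma> \<alpha> :: "'u \<Rightarrow> 'u"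
  assumes A: "bimodule R R A" and B: "bimodule S S B" and E: "bimodule U U E"
    and M: "bimodule S R M" and P: "bimodule U S P"
    and \<sigma>: "\<sigma> \<in> bimod_hom U S (E \<boxtimes>\<^sub>U P) (P \<boxtimes>\<^sub>S B)"
    and \<alpha>: "\<alpha> \<in> bimod_hom S R (B \<boxtimes>\<^sub>S M) (M \<boxtimes>\<^sub>R A)"
begin

lemmas bimodules [simp] = A B E M P
  bimodule_facts[OF A] bimodule_facts[OF B] bimodule_facts[OF E] bimodule_facts[OF M]
  bimodule_facts[OF P] hom_lin[OF \<sigma>] hom_lin[OF \<alpha>] hom_closed[OF \<sigma>] hom_closed[OF \<alpha>]
  bimodule_rings[OF P] bimodule_rings[OF M]
  lmod_closed[OF bimodule_lmod[OF A]] lmod_closed[OF bimodule_lmod[OF B]]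
  lmod_closed[OF bimodule_lmod[OF E]] lmod_closed[OF bimodule_lmod[OF M]]
  lmod_closed[OF bimodule_lmod[OF P]]
  rmod_closed[OF bimodule_rmod[OF A]] rmod_closed[OF bimodule_rmod[OF B]]
  rmod_closed[OF bimodule_rmod[OF E]] rmod_closed[OF bimodule_rmod[OF M]]
  rmod_closed[OF bimodule_rmod[OF P]]

abbreviation "PM \<equiv> P \<boxtimes>\<^sub>S M"
abbreviation "BM \<equiv> B \<boxtimes>\<^sub>S M"
abbreviation "MA \<equiv> M \<boxtimes>\<^sub>R A"
abbreviation "EP \<equiv> E \<boxtimes>\<^sub>U P"
abbreviation "PB \<equiv> P \<boxtimes>\<^sub>S B"
abbreviation "EPM \<equiv> E \<boxtimes>\<^sub>U PM"
abbreviation "AA \<equiv> A \<boxtimes>\<^sub>R A"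
abbreviation "BB \<equiv> B \<boxtimes>\<^sub>S B"
abbreviation "PBM \<equiv> P \<boxtimes>\<^sub>S BM"
abbreviation "BBM \<equiv> B \<boxtimes>\<^sub>S BM"
abbreviation "BMA \<equiv> B \<boxtimes>\<^sub>S MA"
abbreviation "PMA \<equiv> P \<boxtimes>\<^sub>S MA"
abbreviation "MAA \<equiv> M \<boxtimes>\<^sub>R AA"
abbreviation "assocPM \<equiv> tensor_assoc S R P M"
abbreviation "ext_\<alpha> Z \<equiv> extend_map S B M R M A R Z \<alpha>"
abbreviation "ext_\<sigma> Z \<equiv> extend_map U E P S P B S Z \<sigma>"
abbreviation "\<pi> \<equiv> paste R S U A B E P M \<sigma> \<alpha>"
abbreviation "ext_\<pi> Z \<equiv> extend_map U E PM R PM A R Z \<pi>"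

lemma paste_apply:
  "x \<in> carrier EPM \<Longrightarrow>
    \<pi> x = assocPM A (lwhisker S P BM MA \<alpha> (ext_\<sigma> M x))"
  by (simp add: paste_def extend_map_def)

lemma paste_llin: "llin U EPM (PM \<boxtimes>\<^sub>R A) \<pi>"
  and paste_rlin: "rlin R EPM (PM \<boxtimes>\<^sub>R A) \<pi>"
proof -
  let ?f = "assocPM A \<circ> (lwhisker S P BM MA \<alpha> \<circ> ext_\<sigma> M)"
  have l: "llin U EPM (PM \<boxtimes>\<^sub>R A) ?f"
    by (rule llin_comp[OF llin_comp[OF extend_map_llin lwhisker_llin] lin_assoc(1)]) simp_all
  have r: "rlin R EPM (PM \<boxtimes>\<^sub>R A) ?f"
    by (rule rlin_comp[OF rlin_comp[OF extend_map_rlin lwhisker_rlin] lin_assoc(2)]) simp_all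
  show "llin U EPM (PM \<boxtimes>\<^sub>R A) \<pi>"
    by (rule llin_cong[OF _ _ l]) (simp_all add: paste_apply)
  show "rlin R EPM (PM \<boxtimes>\<^sub>R A) \<pi>"
    by (rule rlin_cong[OF _ _ r]) (simp_all add: paste_apply)
qed

lemma paste_hom: "\<pi> \<in> bimod_hom U R EPM (PM \<boxtimes>\<^sub>R A)"
  unfolding bimod_hom_iff using paste_llin paste_rlin by (auto simp: paste_def)

declare hom_lin[OF paste_hom, simp] hom_closed[OF paste_hom, simp]

lemma lwhisker_paste:
  assumes V: "rmod U V" and x: "x \<in> carrier (V \<boxtimes>\<^sub>U EPM)"
  shows "lwhisker U V EPM (PM \<boxtimes>\<^sub>R A) \<pi> x =
    lwhisker U V PMA (PM \<boxtimes>\<^sub>R A) (assocPM A)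
      (lwhisker U V PBM PMA
        (lwhisker S P BM MA \<alpha>)
        (lwhisker U V EPM PBM (ext_\<sigma> M) x))"
  using V x
  by (subst lwhisker_comp3) (auto intro!: fun_cong[OF lwhisker_cong] simp: paste_apply)

text \<open>
  Extending a pasted map by \<open>Z\<close> is pasting the extended maps. Both sides send
  \<open>e \<otimes> (p \<otimes> (m \<otimes> z))\<close> to the image of \<open>\<sigma> (e \<otimes> p)\<close> under \<open>b \<mapsto> \<alpha> (b \<otimes> m) \<otimes> z\<close>. This lemma lets
  the axioms of the composite 1-cell be split into those of its two factors.
\<close>

lemma paste_extend:
  assumes Z: "lmod R Z" and t: "t \<in> carrier (E \<boxtimes>\<^sub>U (P \<boxtimes>\<^sub>S (M \<boxtimes>\<^sub>R Z)))"
  shows "ext_\<pi> Z (lwhisker U E (P \<boxtimes>\<^sub>S (M \<boxtimes>\<^sub>R Z)) (PM \<boxtimes>\<^sub>R Z) (assocPM Z) t) =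
    assocPM (A \<boxtimes>\<^sub>R Z)
      (lwhisker S P (B \<boxtimes>\<^sub>S (M \<boxtimes>\<^sub>R Z)) (M \<boxtimes>\<^sub>R (A \<boxtimes>\<^sub>R Z)) (ext_\<alpha> Z) (ext_\<sigma> (M \<boxtimes>\<^sub>R Z) t))"
proof (rule tensor4_ext[OF _ _ _ _ t
    additive_comp[OF lwhisker_additive extend_map_additive]
    additive_comp[OF additive_comp[OF extend_map_additive lwhisker_additive] assoc_additive]])
  note [simp] = Z lmod_group[OF Z]
  fix e p m z assume gens: "e \<in> carrier E" "p \<in> carrier P" "m \<in> carrier M" "z \<in> carrier Z"
  let ?u = "\<sigma> (tensor_elt U E P e p)"
  let ?w = "lwhisker S P BM MA \<alpha> (lwhisker S P B BM (tensor_right S B M m) ?u)"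
  have "lwhisker S P MA (M \<boxtimes>\<^sub>R (A \<boxtimes>\<^sub>R Z)) (lwhisker R M A (A \<boxtimes>\<^sub>R Z) (tensor_right R A Z z)) ?w =
    lwhisker S P B (M \<boxtimes>\<^sub>R (A \<boxtimes>\<^sub>R Z)) (\<lambda>b. lwhisker R M A (A \<boxtimes>\<^sub>R Z) (tensor_right R A Z z)
        (\<alpha> (tensor_right S B M m b))) ?u"
    by (rule lwhisker_comp3) (use gens in simp_all)
  also have "\<dots> = lwhisker S P B (M \<boxtimes>\<^sub>R (A \<boxtimes>\<^sub>R Z))
      (\<lambda>b. ext_\<alpha> Z (tensor_right S B (M \<boxtimes>\<^sub>R Z) (tensor_elt R M Z m z) b)) ?u"
    by (rule fun_cong[OF lwhisker_cong]) (use gens in \<open>simp add: tensor_right_def extend_map_elt\<close>)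
  also have "\<dots> = lwhisker S P (B \<boxtimes>\<^sub>S (M \<boxtimes>\<^sub>R Z)) (M \<boxtimes>\<^sub>R (A \<boxtimes>\<^sub>R Z)) (ext_\<alpha> Z)
      (lwhisker S P B (B \<boxtimes>\<^sub>S (M \<boxtimes>\<^sub>R Z)) (tensor_right S B (M \<boxtimes>\<^sub>R Z) (tensor_elt R M Z m z)) ?u)"
    by (rule lwhisker_comp[symmetric]) (use gens in simp_all)
  finally show "ext_\<pi> Z (lwhisker U E (P \<boxtimes>\<^sub>S (M \<boxtimes>\<^sub>R Z)) (PM \<boxtimes>\<^sub>R Z) (assocPM Z)
        (tensor_elt U E (P \<boxtimes>\<^sub>S (M \<boxtimes>\<^sub>R Z)) e (tensor_elt3 S R P M Z p m z))) =
    assocPM (A \<boxtimes>\<^sub>R Z)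
      (lwhisker S P (B \<boxtimes>\<^sub>S (M \<boxtimes>\<^sub>R Z)) (M \<boxtimes>\<^sub>R (A \<boxtimes>\<^sub>R Z)) (ext_\<alpha> Z) (ext_\<sigma> (M \<boxtimes>\<^sub>R Z)
        (tensor_elt U E (P \<boxtimes>\<^sub>S (M \<boxtimes>\<^sub>R Z)) e (tensor_elt3 S R P M Z p m z))))"
    using gens
    by (simp add: lwhisker_elt assoc_elt extend_map_elt paste_apply assoc_natural)
qed (use Z lmod_group in simp_all)

end

context universe begin

lemma lwhisker_square:
  fixes S :: "'u ring"
  assumes P: "rmod S P" and M: "lmod S M" "lmod S N" "lmod S N'" "lmod S M'"
    and lin: "llin S M N g" "llin S N M' g'" "llin S M N' h" "llin S N' M' h'"
    and t: "t \<in> carrier (P \<boxtimes>\<^sub>S M)" and eq: "\<And>m. m \<in> carrier M \<Longrightarrow> g' (g m) = h' (h m)"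
  shows "lwhisker S P N M' g' (lwhisker S P M N g t) = lwhisker S P N' M' h' (lwhisker S P M N' h t)"
  using lwhisker_comp[OF P M(1,2,4) lin(1,2) t] lwhisker_comp[OF P M(1,3,4) lin(3,4) t]
    lwhisker_cong[of M "\<lambda>m. g' (g m)" "\<lambda>m. h' (h m)", OF eq] by simp

lemma lwhisker_pentagon:
  fixes S :: "'u ring"
  assumes P: "rmod S P" and M: "lmod S M" "lmod S N" "lmod S L" "lmod S L'" "lmod S M'"
    and lin: "llin S M N g" "llin S N M' g'" "llin S M L h" "llin S L L' h'" "llin S L' M' h''"
    and t: "t \<in> carrier (P \<boxtimes>\<^sub>S M)" and eq: "\<And>m. m \<in> carrier M \<Longrightarrow> g' (g m) = h'' (h' (h m))"
  shows "lwhisker S P N M' g' (lwhisker S P M N g t) =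
    lwhisker S P L' M' h'' (lwhisker S P L L' h' (lwhisker S P M L h t))"
  using lwhisker_comp[OF P M(1,2,5) lin(1,2) t] lwhisker_comp3[OF P M(1,3,4,5) lin(3-5) t]
    lwhisker_cong[of M "\<lambda>m. g' (g m)" "\<lambda>m. h'' (h' (h m))", OF eq] by simp

lemma lwhisker_hexagon:
  fixes S :: "'u ring"
  assumes P: "rmod S P" and M: "lmod S M" "lmod S N" "lmod S N'" "lmod S L" "lmod S L'" "lmod S M'"
    and lin: "llin S M N g" "llin S N N' g'" "llin S N' M' g''"
      "llin S M L h" "llin S L L' h'" "llin S L' M' h''"
    and t: "t \<in> carrier (P \<boxtimes>\<^sub>S M)"
    and eq: "\<And>m. m \<in> carrier M \<Longrightarrow> g'' (g' (g m)) = h'' (h' (h m))"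
  shows "lwhisker S P N' M' g'' (lwhisker S P N N' g' (lwhisker S P M N g t)) =
    lwhisker S P L' M' h'' (lwhisker S P L L' h' (lwhisker S P M L h t))"
  using lwhisker_comp3[OF P M(1-3,6) lin(1-3) t] lwhisker_comp3[OF P M(1,4-6) lin(4-6) t]
    lwhisker_cong[of M "\<lambda>m. g'' (g' (g m))" "\<lambda>m. h'' (h' (h m))", OF eq] by simp

lemma right_unit_assoc:
  fixes R S :: "'u ring"
  assumes P: "rmod S P" and M: "bimodule S R M"
    and t: "t \<in> carrier (P \<boxtimes>\<^sub>S (M \<boxtimes>\<^sub>R ring_bimod R))"
  shows "right_unit R (P \<boxtimes>\<^sub>S M) (tensor_assoc S R P M (ring_bimod R) t) =
    lwhisker S P (M \<boxtimes>\<^sub>R ring_bimod R) M (right_unit R M) t"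
  by (rule tensor3_ext[OF _ _ _ t
      additive_comp[OF assoc_additive right_unit_additive]
      lwhisker_additive])
    (use P M bimodule_facts[OF M] bimodule_rings[OF M] rmod_group[OF P] in
    \<open>simp_all add: assoc_elt right_unit_elt lwhisker_elt rsmult_elt\<close>)

end

context pasting begin

text \<open>
  The pentagon of \<open>\<sigma>\<close>, tensored with \<open>M\<close> (the fact \<open>key\<close>), moves the multiplication of \<open>E\<close> past \<open>P\<close>,
  where it becomes the multiplication of \<open>B\<close>; the pentagon of \<open>\<alpha>\<close> under \<open>P \<otimes> \<hyphen>\<close> then moves it
  past \<open>M\<close>. Tensoring with \<open>M\<close> means to precompose with \<open>p \<mapsto> p \<otimes> m\<close> for every \<open>m\<close>.
\<close>

lemma paste_mult:
  assumes \<mu>: "\<mu>\<^sub>A \<in> bimod_hom R R AA A" "\<mu>\<^sub>B \<in> bimod_hom S S BB B"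
      "\<mu>\<^sub>E \<in> bimod_hom U U (E \<boxtimes>\<^sub>U E) E"
    and \<alpha>_mult: "\<And>x. x \<in> carrier BBM \<Longrightarrow>
      \<alpha> (extend_mult S B B B S M \<mu>\<^sub>B x) =
      lwhisker R M AA A \<mu>\<^sub>A (ext_\<alpha> A (lwhisker S B BM MA \<alpha> x))"
    and \<sigma>_mult: "\<And>x. x \<in> carrier (E \<boxtimes>\<^sub>U EP) \<Longrightarrow>
      \<sigma> (extend_mult U E E E U P \<mu>\<^sub>E x) =
      lwhisker S P BB B \<mu>\<^sub>B (ext_\<sigma> B (lwhisker U E EP PB \<sigma> x))"
    and x: "x \<in> carrier (E \<boxtimes>\<^sub>U EPM)"
  shows "\<pi> (extend_mult U E E E U PM \<mu>\<^sub>E x) =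
    lwhisker R PM AA A \<mu>\<^sub>A (ext_\<pi> A (lwhisker U E EPM (PM \<boxtimes>\<^sub>R A) \<pi> x))"
proof -
  note [simp] = hom_lin[OF \<mu>(1)] hom_lin[OF \<mu>(2)] hom_lin[OF \<mu>(3)]
    hom_closed[OF \<mu>(1)] hom_closed[OF \<mu>(2)] hom_closed[OF \<mu>(3)]
  let ?w = "\<lambda>x. ext_\<sigma> BM (lwhisker U E EPM PBM (ext_\<sigma> M) x)"
  have key: "ext_\<sigma> M (extend_mult U E E E U PM \<mu>\<^sub>E x) =
      lwhisker S P BBM BM (extend_mult S B B B S M \<mu>\<^sub>B) (?w x)"
  proof (rule tensor4_ext[OF _ _ _ _ x
      additive_comp[OF extend_mult_additive extend_map_additive]
      additive_comp[OF additive_comp[OF lwhisker_additive extend_map_additive] lwhisker_additive]])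
    fix e e' p m assume gens: "e \<in> carrier E" "e' \<in> carrier E" "p \<in> carrier P" "m \<in> carrier M"
    let ?x = "tensor_elt U E EPM e (tensor_elt3 U S E P M e' p m)"
    let ?u = "\<sigma> (tensor_elt U E P e' p)"
    let ?v = "ext_\<sigma> B (tensor_elt U E PB e ?u)"
    have "ext_\<sigma> M (extend_mult U E E E U PM \<mu>\<^sub>E ?x) =
        lwhisker S P B BM (tensor_right S B M m) (lwhisker S P BB B \<mu>\<^sub>B ?v)"
      using gens \<sigma>_mult[of "tensor_elt3 U U E E P e e' p"]
      by (simp add: extend_mult_elt extend_map_elt lwhisker_elt)
    also have "\<dots> = lwhisker S P BBM BM (extend_mult S B B B S M \<mu>\<^sub>B)
        (lwhisker S P BB BBM
          (lwhisker S B B BM (tensor_right S B M m)) ?v)"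
      by (rule lwhisker_square) (use gens in \<open>simp_all add: extend_mult_tensor_right tensor_right_apply\<close>)
    also have "lwhisker S P BB BBM
          (lwhisker S B B BM (tensor_right S B M m)) ?v = ?w ?x"
      using gens by (simp add: lwhisker_elt extend_map_elt flip: extend_map_natural)
    finally show "ext_\<sigma> M (extend_mult U E E E U PM \<mu>\<^sub>E ?x) =
      lwhisker S P BBM BM (extend_mult S B B B S M \<mu>\<^sub>B) (?w ?x)" .
  qed simp_all
  have w: "?w x \<in> carrier (P \<boxtimes>\<^sub>S BBM)" using x by simp
  have "lwhisker S P BM MA \<alpha>
      (lwhisker S P BBM BM (extend_mult S B B B S M \<mu>\<^sub>B) (?w x)) =
    lwhisker S P MAA MA (lwhisker R M AA A \<mu>\<^sub>A)
      (lwhisker S P BMA MAA (ext_\<alpha> A)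
        (lwhisker S P BBM BMA
          (lwhisker S B BM MA \<alpha>) (?w x)))"
    by (rule lwhisker_pentagon) (use w \<alpha>_mult in simp_all)
  then show ?thesis
    using x by (simp add: lwhisker_paste paste_apply paste_extend key extend_map_natural assoc_natural)
qed

lemma paste_unit:
  assumes \<eta>: "\<eta>\<^sub>A \<in> carrier A" "\<eta>\<^sub>B \<in> carrier B" "\<eta>\<^sub>E \<in> carrier E"
    and \<alpha>_unit: "\<And>m. m \<in> carrier M \<Longrightarrow> \<alpha> (tensor_elt S B M \<eta>\<^sub>B m) = tensor_elt R M A m \<eta>\<^sub>A"
    and \<sigma>_unit: "\<And>p. p \<in> carrier P \<Longrightarrow> \<sigma> (tensor_elt U E P \<eta>\<^sub>E p) = tensor_elt S P B p \<eta>\<^sub>B"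
    and x: "x \<in> carrier PM"
  shows "\<pi> (tensor_elt U E PM \<eta>\<^sub>E x) = tensor_elt R PM A x \<eta>\<^sub>A"
proof (rule tensor_ext[OF _ _ x])
  show "additive PM (PM \<boxtimes>\<^sub>R A) (\<lambda>x. \<pi> (tensor_elt U E PM \<eta>\<^sub>E x))"
    by (rule additive_comp[OF additive_elt_right]) (use \<eta> in simp_all)
  show "additive PM (PM \<boxtimes>\<^sub>R A) (\<lambda>x. tensor_elt R PM A x \<eta>\<^sub>A)"
    using \<eta> by (simp add: additive_elt_left)
  fix p m assume "p \<in> carrier P" "m \<in> carrier M"
  then show "\<pi> (tensor_elt U E PM \<eta>\<^sub>E (tensor_elt S P M p m)) = tensor_elt R PM A (tensor_elt S P M p m) \<eta>\<^sub>A"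
    using \<eta> by (simp add: paste_apply extend_map_elt \<sigma>_unit tensor_right_apply lwhisker_elt
        \<alpha>_unit assoc_elt)
qed simp_all

text \<open>As for the multiplications, with all arrows reversed: first the pentagon of \<open>\<alpha>\<close> under
  \<open>P \<otimes> \<hyphen>\<close>, then that of \<open>\<sigma>\<close> tensored with \<open>M\<close>.\<close>

lemma paste_comult:
  assumes \<delta>: "\<delta>\<^sub>A \<in> bimod_hom R R A AA" "\<delta>\<^sub>B \<in> bimod_hom S S B BB"
      "\<delta>\<^sub>E \<in> bimod_hom U U E (E \<boxtimes>\<^sub>U E)"
    and \<alpha>_comult: "\<And>x. x \<in> carrier BM \<Longrightarrow>
      lwhisker R M A AA \<delta>\<^sub>A (\<alpha> x) =
      ext_\<alpha> A (lwhisker S B BM MA \<alpha> (extend_comult B S B B S M \<delta>\<^sub>B x))"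
    and \<sigma>_comult: "\<And>x. x \<in> carrier EP \<Longrightarrow>
      lwhisker S P B BB \<delta>\<^sub>B (\<sigma> x) =
      ext_\<sigma> B (lwhisker U E EP PB \<sigma> (extend_comult E U E E U P \<delta>\<^sub>E x))"
    and x: "x \<in> carrier EPM"
  shows "lwhisker R PM A AA \<delta>\<^sub>A (\<pi> x) =
    ext_\<pi> A (lwhisker U E EPM (PM \<boxtimes>\<^sub>R A) \<pi> (extend_comult E U E E U PM \<delta>\<^sub>E x))"
proof -
  note [simp] = hom_lin[OF \<delta>(1)] hom_lin[OF \<delta>(2)] hom_lin[OF \<delta>(3)]
    hom_closed[OF \<delta>(1)] hom_closed[OF \<delta>(2)] hom_closed[OF \<delta>(3)]
  let ?w = "\<lambda>x. ext_\<sigma> BM (lwhisker U E EPM PBM (ext_\<sigma> M)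
      (extend_comult E U E E U PM \<delta>\<^sub>E x))"
  have key: "lwhisker S P BM BBM (extend_comult B S B B S M \<delta>\<^sub>B) (ext_\<sigma> M x) = ?w x"
  proof (rule tensor3_ext[OF _ _ _ x
      additive_comp[OF extend_map_additive lwhisker_additive]
      additive_comp[OF additive_comp[OF extend_comult_additive lwhisker_additive] extend_map_additive]])
    fix e p m assume gens: "e \<in> carrier E" "p \<in> carrier P" "m \<in> carrier M"
    let ?x = "tensor_elt3 U S E P M e p m"
    let ?u = "\<sigma> (tensor_elt U E P e p)"
    let ?v = "lwhisker U E EP PB \<sigma>
      (lwhisker U E E EP (tensor_right U E P p) (\<delta>\<^sub>E e))"
    have "lwhisker S P BM BBM (extend_comult B S B B S M \<delta>\<^sub>B) (ext_\<sigma> M ?x) =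
        lwhisker S P BM BBM (extend_comult B S B B S M \<delta>\<^sub>B)
          (lwhisker S P B BM (tensor_right S B M m) ?u)"
      using gens by (simp add: extend_map_elt)
    also have "\<dots> = lwhisker S P BB BBM
        (lwhisker S B B BM (tensor_right S B M m)) (lwhisker S P B BB \<delta>\<^sub>B ?u)"
      by (rule lwhisker_square) (use gens in \<open>simp_all add: extend_comult_elt tensor_right_apply\<close>)
    also have "lwhisker S P B BB \<delta>\<^sub>B ?u = ext_\<sigma> B ?v"
      using gens by (simp add: \<sigma>_comult extend_comult_elt)
    also have "lwhisker S P BB BBM
        (lwhisker S B B BM (tensor_right S B M m)) (ext_\<sigma> B ?v) =
      ext_\<sigma> BM (lwhisker U E PB PBM
        (lwhisker S P B BM (tensor_right S B M m)) ?v)"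
      using gens by (simp add: extend_map_natural)
    also have "lwhisker U E PB PBM
        (lwhisker S P B BM (tensor_right S B M m)) ?v =
      lwhisker U E E PBM
        (\<lambda>e. lwhisker S P B BM (tensor_right S B M m) (\<sigma> (tensor_right U E P p e))) (\<delta>\<^sub>E e)"
      by (rule lwhisker_comp3) (use gens in simp_all)
    also have "\<dots> = lwhisker U E E PBM
        (\<lambda>e. ext_\<sigma> M (tensor_right U E PM (tensor_elt S P M p m) e)) (\<delta>\<^sub>E e)"
      by (rule fun_cong[OF lwhisker_cong]) (use gens in \<open>simp add: tensor_right_apply extend_map_elt\<close>)
    also have "\<dots> = lwhisker U E EPM PBM (ext_\<sigma> M)
        (lwhisker U E E EPM (tensor_right U E PM (tensor_elt S P M p m)) (\<delta>\<^sub>E e))"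
      by (rule lwhisker_comp[symmetric]) (use gens in simp_all)
    also have "lwhisker U E E EPM (tensor_right U E PM (tensor_elt S P M p m)) (\<delta>\<^sub>E e) =
        extend_comult E U E E U PM \<delta>\<^sub>E ?x"
      using gens by (simp add: extend_comult_elt)
    finally show "lwhisker S P BM BBM (extend_comult B S B B S M \<delta>\<^sub>B) (ext_\<sigma> M ?x) = ?w ?x" .
  qed simp_all
  have w: "ext_\<sigma> M x \<in> carrier PBM" using x by simp
  have "lwhisker S P MA MAA (lwhisker R M A AA \<delta>\<^sub>A)
      (lwhisker S P BM MA \<alpha> (ext_\<sigma> M x)) =
    lwhisker S P BMA MAA (ext_\<alpha> A)
      (lwhisker S P BBM BMA
          (lwhisker S B BM MA \<alpha>)
          (lwhisker S P BM BBM (extend_comult B S B B S M \<delta>\<^sub>B) (ext_\<sigma> M x)))"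
    by (rule lwhisker_pentagon) (use w \<alpha>_comult in simp_all)
  then show ?thesis
    using x by (simp add: lwhisker_paste paste_apply paste_extend key extend_map_natural assoc_natural)
qed

text \<open>
  On \<open>e \<otimes> (p \<otimes> m)\<close>, the triangle of \<open>\<alpha>\<close> turns the left-hand side into the image of \<open>\<sigma> (e \<otimes> p)\<close> under
  \<open>p' \<otimes> b \<mapsto> p' \<otimes> \<epsilon>\<^sub>B b \<cdot> m = p' \<cdot> \<epsilon>\<^sub>B b \<otimes> m\<close>, to which the triangle of \<open>\<sigma>\<close> applies.
\<close>

lemma paste_counit:
  assumes \<epsilon>: "\<epsilon>\<^sub>A \<in> bimod_hom R R A (ring_bimod R)" "\<epsilon>\<^sub>B \<in> bimod_hom S S B (ring_bimod S)"
      "\<epsilon>\<^sub>E \<in> bimod_hom U U E (ring_bimod U)"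
    and \<alpha>_counit: "\<And>x. x \<in> carrier BM \<Longrightarrow>
      right_unit R M (lwhisker R M A (ring_bimod R) \<epsilon>\<^sub>A (\<alpha> x)) =
      left_unit S M (rwhisker S B (ring_bimod S) M \<epsilon>\<^sub>B x)"
    and \<sigma>_counit: "\<And>x. x \<in> carrier EP \<Longrightarrow>
      right_unit S P (lwhisker S P B (ring_bimod S) \<epsilon>\<^sub>B (\<sigma> x)) =
      left_unit U P (rwhisker U E (ring_bimod U) P \<epsilon>\<^sub>E x)"
    and x: "x \<in> carrier EPM"
  shows "right_unit R PM (lwhisker R PM A (ring_bimod R) \<epsilon>\<^sub>A (\<pi> x)) =
      left_unit U PM (rwhisker U E (ring_bimod U) PM \<epsilon>\<^sub>E x)"
proof (rule tensor3_ext[OF _ _ _ x])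
  note [simp] = hom_lin[OF \<epsilon>(1)] hom_lin[OF \<epsilon>(2)] hom_lin[OF \<epsilon>(3)]
    hom_closed[OF \<epsilon>(1), simplified] hom_closed[OF \<epsilon>(2), simplified] hom_closed[OF \<epsilon>(3), simplified]
  show "additive EPM PM (\<lambda>x. right_unit R PM (lwhisker R PM A (ring_bimod R) \<epsilon>\<^sub>A (\<pi> x)))"
    by (rule additive_comp[OF additive_comp[OF _ lwhisker_additive] right_unit_additive]) simp_all
  show "additive EPM PM (\<lambda>x. left_unit U PM (rwhisker U E (ring_bimod U) PM \<epsilon>\<^sub>E x))"
    by (rule additive_comp[OF rwhisker_additive left_unit_additive]) simp_all
  fix e p m assume gens: "e \<in> carrier E" "p \<in> carrier P" "m \<in> carrier M"
  let ?u = "\<sigma> (tensor_elt U E P e p)"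
  let ?f = "\<lambda>b. \<epsilon>\<^sub>B b \<odot>\<^bsub>M\<^esub> m"
  have f: "llin S B M ?f"
    using gens by (simp add: llin_def additive_def Pi_iff additive_add[OF hom_lin(3)[OF \<epsilon>(2)]]
      llin_smult[OF hom_lin(1)[OF \<epsilon>(2)]] lmod_simps[OF bimodule_lmod[OF M]])
  have scalar: "lwhisker S P B M ?f u = tensor_elt S P M (right_unit S P (lwhisker S P B (ring_bimod S) \<epsilon>\<^sub>B u)) m"
    if u: "u \<in> carrier PB" for u
  proof (rule tensor_ext[OF _ _ u
      lwhisker_additive
      additive_comp[OF additive_comp[OF lwhisker_additive right_unit_additive] additive_elt_left]])
  qed (use gens f in \<open>simp_all add: lwhisker_elt right_unit_elt elt_balanced\<close>)
  have "right_unit R PM (lwhisker R PM A (ring_bimod R) \<epsilon>\<^sub>A (\<pi> (tensor_elt3 U S E P M e p m))) =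
    lwhisker S P (M \<boxtimes>\<^sub>R ring_bimod R) M (right_unit R M)
      (lwhisker S P MA (M \<boxtimes>\<^sub>R ring_bimod R) (lwhisker R M A (ring_bimod R) \<epsilon>\<^sub>A)
        (lwhisker S P BM MA \<alpha>
          (lwhisker S P B BM (tensor_right S B M m) ?u)))"
    using gens by (simp add: paste_apply extend_map_elt assoc_natural right_unit_assoc)
  also have "\<dots> = lwhisker S P BM M
        (\<lambda>t. right_unit R M (lwhisker R M A (ring_bimod R) \<epsilon>\<^sub>A (\<alpha> t)))
          (lwhisker S P B BM (tensor_right S B M m) ?u)"
    by (rule lwhisker_comp3) (use gens in simp_all)
  also have "\<dots> = lwhisker S P BM M
        (\<lambda>t. left_unit S M (rwhisker S B (ring_bimod S) M \<epsilon>\<^sub>B t))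
          (lwhisker S P B BM (tensor_right S B M m) ?u)"
    by (rule fun_cong[OF lwhisker_cong]) (rule \<alpha>_counit)
  also have "\<dots> = lwhisker S P (ring_bimod S \<boxtimes>\<^sub>S M) M (left_unit S M)
      (lwhisker S P BM (ring_bimod S \<boxtimes>\<^sub>S M) (rwhisker S B (ring_bimod S) M \<epsilon>\<^sub>B)
          (lwhisker S P B BM (tensor_right S B M m) ?u))"
    by (rule lwhisker_comp[symmetric]) (use gens in simp_all)
  also have "\<dots> = lwhisker S P B M
        (\<lambda>b. left_unit S M (rwhisker S B (ring_bimod S) M \<epsilon>\<^sub>B (tensor_right S B M m b))) ?u"
    by (rule lwhisker_comp3) (use gens in simp_all)
  also have "\<dots> = lwhisker S P B M ?f ?u"
    by (rule fun_cong[OF lwhisker_cong])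
      (use gens in \<open>simp add: tensor_right_apply rwhisker_elt left_unit_elt\<close>)
  finally show "right_unit R PM (lwhisker R PM A (ring_bimod R) \<epsilon>\<^sub>A
        (\<pi> (tensor_elt3 U S E P M e p m))) =
      left_unit U PM (rwhisker U E (ring_bimod U) PM \<epsilon>\<^sub>E (tensor_elt3 U S E P M e p m))"
    using gens by (simp add: scalar \<sigma>_counit rwhisker_elt left_unit_elt smult_elt[OF P])
qed simp_all

end

locale pasting_pair = universe type_of_universe +
  alg: pasting type_of_universe R S U A B E P M \<sigma> \<alpha> +
  coalg: pasting type_of_universe R S U C D G P M \<tau> \<gamma>
  for type_of_universe :: "'u itself" and R S U :: "'u ring" and A B E C D G P M :: "'u bimod"
    and \<sigma> \<alpha> \<tau> \<gamma> :: "'u \<Rightarrow> 'u" +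
  fixes \<psi> \<chi> \<kappa> :: "'u \<Rightarrow> 'u"
  assumes \<psi>: "\<psi> \<in> bimod_hom R R (C \<boxtimes>\<^sub>R A) (A \<boxtimes>\<^sub>R C)"
    and \<chi>: "\<chi> \<in> bimod_hom S S (D \<boxtimes>\<^sub>S B) (B \<boxtimes>\<^sub>S D)"
    and \<kappa>: "\<kappa> \<in> bimod_hom U U (G \<boxtimes>\<^sub>U E) (E \<boxtimes>\<^sub>U G)"
    and hexagon_lower: "\<And>x. x \<in> carrier (D \<boxtimes>\<^sub>S (B \<boxtimes>\<^sub>S M)) \<Longrightarrow>
      lwhisker R M (C \<boxtimes>\<^sub>R A) (A \<boxtimes>\<^sub>R C) \<psi>
        (coalg.ext_\<alpha> A (lwhisker S D (B \<boxtimes>\<^sub>S M) (M \<boxtimes>\<^sub>R A) \<alpha> x)) =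
      alg.ext_\<alpha> C (lwhisker S B (D \<boxtimes>\<^sub>S M) (M \<boxtimes>\<^sub>R C) \<gamma> (extend_map S D B S B D S M \<chi> x))"
    and hexagon_upper: "\<And>x. x \<in> carrier (G \<boxtimes>\<^sub>U (E \<boxtimes>\<^sub>U P)) \<Longrightarrow>
      lwhisker S P (D \<boxtimes>\<^sub>S B) (B \<boxtimes>\<^sub>S D) \<chi>
        (coalg.ext_\<sigma> B (lwhisker U G (E \<boxtimes>\<^sub>U P) (P \<boxtimes>\<^sub>S B) \<sigma> x)) =
      alg.ext_\<sigma> D (lwhisker U E (G \<boxtimes>\<^sub>U P) (P \<boxtimes>\<^sub>S D) \<tau> (extend_map U G E U E G U P \<kappa> x))"
begin

lemmas [simp] = hom_lin[OF \<psi>] hom_lin[OF \<chi>] hom_lin[OF \<kappa>]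
  hom_closed[OF \<psi>] hom_closed[OF \<chi>] hom_closed[OF \<kappa>]

abbreviation "ext_\<chi> Z \<equiv> extend_map S D B S B D S Z \<chi>"
abbreviation "ext_\<kappa> Z \<equiv> extend_map U G E U E G U Z \<kappa>"
abbreviation "PM \<equiv> P \<boxtimes>\<^sub>S M"
abbreviation "BM \<equiv> B \<boxtimes>\<^sub>S M"
abbreviation "DM \<equiv> D \<boxtimes>\<^sub>S M"
abbreviation "MA \<equiv> M \<boxtimes>\<^sub>R A"
abbreviation "MC \<equiv> M \<boxtimes>\<^sub>R C"
abbreviation "CA \<equiv> C \<boxtimes>\<^sub>R A"
abbreviation "AC \<equiv> A \<boxtimes>\<^sub>R C"
abbreviation "DB \<equiv> D \<boxtimes>\<^sub>S B"
abbreviation "BD \<equiv> B \<boxtimes>\<^sub>S D"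
abbreviation "PB \<equiv> P \<boxtimes>\<^sub>S B"
abbreviation "PD \<equiv> P \<boxtimes>\<^sub>S D"
abbreviation "EPM \<equiv> E \<boxtimes>\<^sub>U PM"
abbreviation "GPM \<equiv> G \<boxtimes>\<^sub>U PM"
abbreviation "PBM \<equiv> P \<boxtimes>\<^sub>S BM"
abbreviation "PDM \<equiv> P \<boxtimes>\<^sub>S DM"
abbreviation "BDM \<equiv> B \<boxtimes>\<^sub>S DM"
abbreviation "DBM \<equiv> D \<boxtimes>\<^sub>S BM"
abbreviation "DMA \<equiv> D \<boxtimes>\<^sub>S MA"
abbreviation "BMC \<equiv> B \<boxtimes>\<^sub>S MC"
abbreviation "MCA \<equiv> M \<boxtimes>\<^sub>R CA"
abbreviation "MAC \<equiv> M \<boxtimes>\<^sub>R AC"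

text \<open>
  The hexagon of \<open>P\<close>, tensored with \<open>M\<close>: on \<open>g \<otimes> (e \<otimes> (p \<otimes> m))\<close> both sides are the corresponding
  side of the hexagon at \<open>g \<otimes> (e \<otimes> p)\<close>, followed by tensoring the last factor with \<open>m\<close>, since
  every extended map commutes with that operation.
\<close>

lemma hexagon_upper_extended:
  assumes x: "x \<in> carrier (G \<boxtimes>\<^sub>U EPM)"
  shows "lwhisker S P DBM BDM (ext_\<chi> M)
        (coalg.ext_\<sigma> BM (lwhisker U G EPM PBM (alg.ext_\<sigma> M) x)) =
      alg.ext_\<sigma> DM (lwhisker U E GPM PDM (coalg.ext_\<sigma> M) (ext_\<kappa> PM x))"
    (is "?l x = ?r x")
proof (rule tensor4_ext[OF _ _ _ _ x
    additive_comp[OF additive_comp[OF lwhisker_additive extend_map_additive] lwhisker_additive]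
    additive_comp[OF additive_comp[OF extend_map_additive lwhisker_additive] extend_map_additive]])
  fix g e p m assume gens: "g \<in> carrier G" "e \<in> carrier E" "p \<in> carrier P" "m \<in> carrier M"
  let ?y = "tensor_elt3 U U G E P g e p"
  let ?x = "tensor_elt U G EPM g (tensor_elt3 U S E P M e p m)"
  let ?v = "coalg.ext_\<sigma> B (tensor_elt U G PB g (\<sigma> (tensor_elt U E P e p)))"
  let ?k = "\<kappa> (tensor_elt U G E g e)"
  let ?w = "lwhisker U E (G \<boxtimes>\<^sub>U P) PD \<tau> (lwhisker U E G (G \<boxtimes>\<^sub>U P) (tensor_right U G P p) ?k)"
  have "lwhisker U G EPM PBM (alg.ext_\<sigma> M) ?x =
      lwhisker U G PB PBM (lwhisker S P B BM (tensor_right S B M m))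
        (tensor_elt U G PB g (\<sigma> (tensor_elt U E P e p)))"
    using gens by (simp add: lwhisker_elt extend_map_elt)
  then have "?l ?x = lwhisker S P DBM BDM (ext_\<chi> M)
      (lwhisker S P DB DBM
        (lwhisker S D B BM (tensor_right S B M m)) ?v)"
    using gens by (simp add: extend_map_natural)
  also have "\<dots> = lwhisker S P BD BDM
        (lwhisker S B D DM (tensor_right S D M m))
        (lwhisker S P DB BD \<chi> ?v)"
    by (rule lwhisker_square) (use gens in \<open>simp_all add: extend_map_tensor_right\<close>)
  also have "lwhisker S P DB BD \<chi> ?v = alg.ext_\<sigma> D ?w"
    using gens hexagon_upper[of ?y] by (simp add: lwhisker_elt extend_map_elt)
  also have "lwhisker S P BD BDM
        (lwhisker S B D DM (tensor_right S D M m)) (alg.ext_\<sigma> D ?w) =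
      alg.ext_\<sigma> DM (lwhisker U E PD PDM
        (lwhisker S P D DM (tensor_right S D M m)) ?w)"
    using gens by (simp add: extend_map_natural)
  also have "lwhisker U E PD PDM
        (lwhisker S P D DM (tensor_right S D M m)) ?w =
      lwhisker U E G PDM
        (\<lambda>g. lwhisker S P D DM (tensor_right S D M m) (\<tau> (tensor_right U G P p g))) ?k"
    by (rule lwhisker_comp3) (use gens in simp_all)
  also have "\<dots> = lwhisker U E G PDM
        (\<lambda>g. coalg.ext_\<sigma> M (tensor_right U G PM (tensor_elt S P M p m) g)) ?k"
    by (rule fun_cong[OF lwhisker_cong]) (use gens in \<open>simp add: tensor_right_apply extend_map_elt\<close>)
  also have "\<dots> = lwhisker U E GPM PDM (coalg.ext_\<sigma> M)
        (lwhisker U E G GPM (tensor_right U G PM (tensor_elt S P M p m)) ?k)"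
    by (rule lwhisker_comp[symmetric]) (use gens in simp_all)
  also have "lwhisker U E G GPM (tensor_right U G PM (tensor_elt S P M p m)) ?k = ext_\<kappa> PM ?x"
    using gens by (simp add: extend_map_elt)
  finally show "?l ?x = ?r ?x" .
qed simp_all

text \<open>
  Unfolding the pasted maps on the left leaves the left-hand side of the hexagon of \<open>M\<close> under \<open>P \<otimes> \<hyphen>\<close>,
  preceded by the upper part of the hexagon of \<open>P\<close>. Exchanging first the one and then the other
  gives the right-hand side.
\<close>

lemma paste_hexagon:
  assumes x: "x \<in> carrier (G \<boxtimes>\<^sub>U EPM)"
  shows "lwhisker R PM CA AC \<psi>
        (coalg.ext_\<pi> A (lwhisker U G EPM (PM \<boxtimes>\<^sub>R A) alg.\<pi> x)) =
      alg.ext_\<pi> C (lwhisker U E GPM (PM \<boxtimes>\<^sub>R C) coalg.\<pi> (ext_\<kappa> PM x))"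
proof -
  let ?w = "coalg.ext_\<sigma> BM (lwhisker U G EPM PBM (alg.ext_\<sigma> M) x)"
  have w: "?w \<in> carrier (P \<boxtimes>\<^sub>S DBM)" using x by simp
  have "lwhisker S P MCA MAC (lwhisker R M CA AC \<psi>)
      (lwhisker S P DMA MCA (coalg.ext_\<alpha> A)
        (lwhisker S P DBM DMA
          (lwhisker S D BM MA \<alpha>) ?w)) =
    lwhisker S P BMC MAC (alg.ext_\<alpha> C)
      (lwhisker S P BDM BMC
          (lwhisker S B DM MC \<gamma>)
        (lwhisker S P DBM BDM (ext_\<chi> M) ?w))"
    by (rule lwhisker_hexagon) (use w hexagon_lower in simp_all)
  then show ?thesis
    using x by (simp add: alg.lwhisker_paste coalg.lwhisker_paste alg.paste_extend
      coalg.paste_extend hexagon_upper_extended extend_map_natural assoc_natural)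
qed

end

context universe begin

section \<open>Pasting, 2-cells and the coherence isomorphisms\<close>

lemma lwhisker_id:
  fixes S :: "'u ring"
  assumes P: "rmod S P" and M: "lmod S M" and t: "t \<in> carrier (P \<boxtimes>\<^sub>S M)"
    and f: "\<And>m. m \<in> carrier M \<Longrightarrow> f m = m"
  shows "lwhisker S P M M f t = t"
  by (rule tensor_ext[OF rmod_group[OF P] lmod_group[OF M] t lwhisker_additive additive_id])
    (use P M f lmod_closed[OF M] lmod_group[OF M] in \<open>simp_all add: lwhisker_elt llin_def additive_def\<close>)

lemma rwhisker_cong:
  "(\<And>p. p \<in> carrier P \<Longrightarrow> f p = f' p) \<Longrightarrow> rwhisker S P P' M f = rwhisker S P P' M f'"
  unfolding rwhisker_def tensor_map_def by (rule tensor_lift_cong) simp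

lemma rwhisker_id:
  fixes S :: "'u ring"
  assumes P: "rmod S P" and M: "lmod S M" and t: "t \<in> carrier (P \<boxtimes>\<^sub>S M)"
    and f: "\<And>p. p \<in> carrier P \<Longrightarrow> f p = p"
  shows "rwhisker S P P M f t = t"
  by (rule tensor_ext[OF rmod_group[OF P] lmod_group[OF M] t rwhisker_additive additive_id])
    (use P M f rmod_closed[OF P] rmod_group[OF P] in \<open>simp_all add: rwhisker_elt rlin_def additive_def\<close>)

lemma rwhisker_comp:
  fixes S :: "'u ring"
  assumes M: "lmod S M" and P: "rmod S P" "rmod S P'" "rmod S P''"
    and f: "rlin S P P' f" "rlin S P' P'' f'" and t: "t \<in> carrier (P \<boxtimes>\<^sub>S M)"
  shows "rwhisker S P' P'' M f' (rwhisker S P P' M f t) = rwhisker S P P'' M (\<lambda>p. f' (f p)) t"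
  by (rule tensor_ext[OF rmod_group[OF P(1)] lmod_group[OF M] t
      additive_comp[OF rwhisker_additive rwhisker_additive] rwhisker_additive])
    (use P M f rlin_comp[OF f] additive_closed[OF rlin_additive[OF f(1)]]
      in \<open>simp_all add: rwhisker_elt comp_def\<close>)

text \<open>By linearity in \<open>\<sigma> (e \<otimes> p)\<close> and then in \<open>\<alpha> (b \<otimes> m)\<close>, \<open>\<eta> \<otimes> \<theta>\<close> may be computed on pure tensors
  after each of the two structure maps.\<close>

lemma paste_two_cell:
  fixes R S U :: "'u ring"
  assumes "pasting R S U A B E P M \<sigma> \<alpha>"
    and "pasting R S U A B E P' M' \<sigma>' \<alpha>'"
    and \<eta>: "\<eta> \<in> bimod_hom U S P P'" and \<theta>: "\<theta> \<in> bimod_hom S R M M'"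
    and \<theta>_\<alpha>: "\<And>x. x \<in> carrier (B \<boxtimes>\<^sub>S M) \<Longrightarrow> rwhisker R M M' A \<theta> (\<alpha> x) = \<alpha>' (lwhisker S B M M' \<theta> x)"
    and \<eta>_\<sigma>: "\<And>x. x \<in> carrier (E \<boxtimes>\<^sub>U P) \<Longrightarrow> rwhisker S P P' B \<eta> (\<sigma> x) = \<sigma>' (lwhisker U E P P' \<eta> x)"
    and x: "x \<in> carrier (E \<boxtimes>\<^sub>U (P \<boxtimes>\<^sub>S M))"
  shows "rwhisker R (P \<boxtimes>\<^sub>S M) (P' \<boxtimes>\<^sub>S M') A (tensor_map S P P' M M' \<eta> \<theta>) (paste R S U A B E P M \<sigma> \<alpha> x) =
    paste R S U A B E P' M' \<sigma>' \<alpha>' (lwhisker U E (P \<boxtimes>\<^sub>S M) (P' \<boxtimes>\<^sub>S M') (tensor_map S P P' M M' \<eta> \<theta>) x)"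
proof -
  interpret F: pasting type_of_universe R S U A B E P M \<sigma> \<alpha> by fact
  interpret F': pasting type_of_universe R S U A B E P' M' \<sigma>' \<alpha>' by fact
  note [simp] = hom_lin[OF \<eta>] hom_lin[OF \<theta>] hom_closed[OF \<eta>] hom_closed[OF \<theta>]
  let ?t = "tensor_map S P P' M M' \<eta> \<theta>"
  have inner: "rwhisker R F.PM F'.PM A ?t (F.assocPM A (tensor_elt S P F.MA p v)) =
      F'.assocPM A (tensor_elt S P' F'.MA (\<eta> p) (rwhisker R M M' A \<theta> v))"
    if p: "p \<in> carrier P" and v: "v \<in> carrier F.MA" for p v
    by (rule tensor_ext[OF _ _ v
      additive_comp[OF additive_comp[OF additive_elt_right assoc_additive] rwhisker_additive]
      additive_comp[OF additive_comp[OF rwhisker_additive additive_elt_right] assoc_additive]])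
    (use p in \<open>simp_all add: assoc_elt rwhisker_elt tensor_map_elt\<close>)
  have outer: "rwhisker R F.PM F'.PM A ?t (F.assocPM A (lwhisker S P F.BM F.MA \<alpha>
        (lwhisker S P B F.BM (tensor_right S B M m) u))) =
      F'.assocPM A (lwhisker S P' F'.BM F'.MA \<alpha>'
        (lwhisker S P' B F'.BM (tensor_right S B M' (\<theta> m)) (rwhisker S P P' B \<eta> u)))"
    (is "?l u = ?r u") if m: "m \<in> carrier M" and u: "u \<in> carrier F.PB" for m u
  proof (rule tensor_ext[OF _ _ u
      additive_comp[OF additive_comp[OF additive_comp[OF lwhisker_additive lwhisker_additive] assoc_additive] rwhisker_additive]
      additive_comp[OF additive_comp[OF additive_comp[OF rwhisker_additive lwhisker_additive] lwhisker_additive] assoc_additive]])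
    fix p b assume "p \<in> carrier P" "b \<in> carrier B"
    then show "?l (tensor_elt S P B p b) = ?r (tensor_elt S P B p b)"
      using m \<theta>_\<alpha>[of "tensor_elt S B M b m"]
      by (simp add: lwhisker_elt rwhisker_elt) (simp add: tensor_right_apply lwhisker_elt inner)
  qed (use m in simp_all)
  show ?thesis
  proof (rule tensor3_ext[OF _ _ _ x
      additive_comp[OF _ rwhisker_additive]
      additive_comp[OF lwhisker_additive]])
  qed (simp_all add: F.paste_apply F'.paste_apply extend_map_elt lwhisker_elt tensor_map_elt outer \<eta>_\<sigma>)
qed

lemma assoc_pentagon:
  fixes R S U :: "'u ring"
  assumes Q: "rmod U Q" and P: "bimodule U S P" and M: "bimodule S R M" and A: "lmod R A"
    and t: "t \<in> carrier (Q \<boxtimes>\<^sub>U (P \<boxtimes>\<^sub>S (M \<boxtimes>\<^sub>R A)))"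
  shows "rwhisker R (Q \<boxtimes>\<^sub>U (P \<boxtimes>\<^sub>S M)) ((Q \<boxtimes>\<^sub>U P) \<boxtimes>\<^sub>S M) A (tensor_assoc U S Q P M)
      (tensor_assoc U R Q (P \<boxtimes>\<^sub>S M) A
        (lwhisker U Q (P \<boxtimes>\<^sub>S (M \<boxtimes>\<^sub>R A)) ((P \<boxtimes>\<^sub>S M) \<boxtimes>\<^sub>R A) (tensor_assoc S R P M A) t)) =
    tensor_assoc S R (Q \<boxtimes>\<^sub>U P) M A (tensor_assoc U S Q P (M \<boxtimes>\<^sub>R A) t)"
  by (rule tensor4_ext[OF _ _ _ _ t
      additive_comp[OF additive_comp[OF lwhisker_additive assoc_additive] rwhisker_additive]
      additive_comp[OF assoc_additive assoc_additive]])
    (use P M Q A bimodule_facts[OF P] bimodule_facts[OF M] rmod_group[OF Q] lmod_group[OF A] in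
      \<open>simp_all add: lwhisker_elt rwhisker_elt assoc_elt\<close>)

text \<open>By \<open>paste_extend\<close> both sides apply the three structure maps in the same order and then rebracket
  \<open>Q \<otimes> (P \<otimes> (M \<otimes> A))\<close>; the two ways of rebracketing form a pentagon.\<close>

lemma paste_assoc:
  fixes R S U V :: "'u ring"
  assumes GF: "pasting R S U A B E P M \<sigma> \<alpha>"
    and HG: "pasting S U V B E L Q P \<rho> \<sigma>"
    and x: "x \<in> carrier (L \<boxtimes>\<^sub>V (Q \<boxtimes>\<^sub>U (P \<boxtimes>\<^sub>S M)))"
  shows "rwhisker R (Q \<boxtimes>\<^sub>U (P \<boxtimes>\<^sub>S M)) ((Q \<boxtimes>\<^sub>U P) \<boxtimes>\<^sub>S M) A (tensor_assoc U S Q P M)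
      (paste R U V A E L Q (P \<boxtimes>\<^sub>S M) \<rho> (paste R S U A B E P M \<sigma> \<alpha>) x) =
    paste R S V A B L (Q \<boxtimes>\<^sub>U P) M (paste S U V B E L Q P \<rho> \<sigma>) \<alpha>
      (lwhisker V L (Q \<boxtimes>\<^sub>U (P \<boxtimes>\<^sub>S M)) ((Q \<boxtimes>\<^sub>U P) \<boxtimes>\<^sub>S M) (tensor_assoc U S Q P M) x)"
proof -
  interpret GF: pasting type_of_universe R S U A B E P M \<sigma> \<alpha> by fact
  interpret HG: pasting type_of_universe S U V B E L Q P \<rho> \<sigma> by fact
  interpret H_GF: pasting type_of_universe R U V A E L Q "P \<boxtimes>\<^sub>S M" \<rho> "paste R S U A B E P M \<sigma> \<alpha>"
    by (intro pasting.intro pasting_axioms.intro universe_axioms) (simp_all add: GF.paste_hom HG.\<sigma>)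
  interpret HG_F: pasting type_of_universe R S V A B L "Q \<boxtimes>\<^sub>U P" M "paste S U V B E L Q P \<rho> \<sigma>" \<alpha>
    by (intro pasting.intro pasting_axioms.intro universe_axioms) (simp_all add: HG.paste_hom GF.\<alpha>)
  show ?thesis
    using x by (simp add: H_GF.paste_apply HG_F.paste_apply GF.lwhisker_paste HG.paste_extend
      assoc_natural assoc_pentagon)
qed

text \<open>\<open>A \<otimes> R \<rightarrow> R \<otimes> A\<close>, the structure map of an identity 1-cell.\<close>

definition unit_swap :: "'u ring \<Rightarrow> 'u bimod \<Rightarrow> 'u \<Rightarrow> 'u" where
  "unit_swap R A = compose (carrier (A \<boxtimes>\<^sub>R ring_bimod R)) (left_unit_inv R A) (right_unit R A)"

lemma unit_swap_hom:
  fixes R :: "'u ring"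
  assumes "bimodule R R A"
  shows "unit_swap R A \<in> bimod_hom R R (A \<boxtimes>\<^sub>R ring_bimod R) (ring_bimod R \<boxtimes>\<^sub>R A)"
  unfolding unit_swap_def
  by (rule compose_hom[OF _ unit_hom(2) unit_hom(3)]) (use assms bimodule_rings[OF assms] in simp_all)

lemmas unit_swap_simps [simp] = hom_lin[OF unit_swap_hom] hom_closed[OF unit_swap_hom]

lemma unit_swap_elt:
  fixes R :: "'u ring"
  assumes "bimodule R R A" "a \<in> carrier A" "r \<in> carrier R"
  shows "unit_swap R A (tensor_elt R A (ring_bimod R) a r) = tensor_elt R (ring_bimod R) A \<one>\<^bsub>R\<^esub> (a \<odot>r\<^bsub>A\<^esub> r)"
  using assms bimodule_facts[OF assms(1)] rmod_closed[OF bimodule_rmod[OF assms(1)]]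
  by (simp add: unit_swap_def compose_eq right_unit_elt left_unit_inv_def)

context
  fixes R S :: "'u ring" and A B M \<alpha>
  assumes A: "bimodule R R A" and B: "bimodule S S B" and M: "bimodule S R M"
    and \<alpha>: "\<alpha> \<in> bimod_hom S R (B \<boxtimes>\<^sub>S M) (M \<boxtimes>\<^sub>R A)"
begin

lemma paste_left_unit:
  assumes x: "x \<in> carrier (B \<boxtimes>\<^sub>S (ring_bimod S \<boxtimes>\<^sub>S M))"
  shows "rwhisker R (ring_bimod S \<boxtimes>\<^sub>S M) M A (left_unit S M)
      (paste R S S A B B (ring_bimod S) M (unit_swap S B) \<alpha> x) =
    \<alpha> (lwhisker S B (ring_bimod S \<boxtimes>\<^sub>S M) M (left_unit S M) x)"
proof -
  interpret pasting type_of_universe R S S A B B "ring_bimod S" M "unit_swap S B" \<alpha>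
    by (intro pasting.intro pasting_axioms.intro universe_axioms)
      (use A B M \<alpha> bimodule_rings[OF M] in \<open>simp_all add: unit_swap_hom\<close>)
  interpret S: ring S by simp
  have unit: "rwhisker R PM M A (left_unit S M) (assocPM A (tensor_elt S (ring_bimod S) MA \<one>\<^bsub>S\<^esub> v)) = v"
    if v: "v \<in> carrier MA" for v
    by (rule tensor_ext[OF _ _ v
      additive_comp[OF additive_comp[OF additive_elt_right assoc_additive] rwhisker_additive]
      additive_id])
    (simp_all add: assoc_elt rwhisker_elt left_unit_elt lmod_simps[OF bimodule_lmod[OF M]])
  show ?thesis
  proof (rule tensor3_ext[OF _ _ _ x
      additive_comp[OF _ rwhisker_additive]
      additive_comp[OF lwhisker_additive]])
  qed (simp_all add: paste_apply extend_map_elt unit_swap_elt lwhisker_elt tensor_right_apply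
      left_unit_elt unit elt_balanced)
qed

lemma paste_right_unit:
  assumes x: "x \<in> carrier (B \<boxtimes>\<^sub>S (M \<boxtimes>\<^sub>R ring_bimod R))"
  shows "rwhisker R (M \<boxtimes>\<^sub>R ring_bimod R) M A (right_unit R M)
      (paste R R S A A B M (ring_bimod R) \<alpha> (unit_swap R A) x) =
    \<alpha> (lwhisker S B (M \<boxtimes>\<^sub>R ring_bimod R) M (right_unit R M) x)"
    (is "?lhs x = ?rhs x")
proof -
  \<comment> \<open>the interpretation rebinds both names\<close>
  note M' = M and \<alpha>' = \<alpha>
  interpret pasting type_of_universe R R S A A B M "ring_bimod R" \<alpha> "unit_swap R A"
    by (intro pasting.intro pasting_axioms.intro universe_axioms)
      (use A B M \<alpha> bimodule_rings[OF M] in \<open>simp_all add: unit_swap_hom\<close>)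
  interpret R: ring R by simp
  have unit: "rwhisker R PM M A (right_unit R M) (assocPM A
        (lwhisker R M (A \<boxtimes>\<^sub>R ring_bimod R) (ring_bimod R \<boxtimes>\<^sub>R A) (unit_swap R A)
          (lwhisker R M A (A \<boxtimes>\<^sub>R ring_bimod R) (tensor_right R A (ring_bimod R) r) u))) =
      u \<odot>r\<^bsub>M \<boxtimes>\<^sub>R A\<^esub> r"
    (is "?l u = ?r u") if r: "r \<in> carrier R" and u: "u \<in> carrier PB" for r u
  proof (rule tensor_ext[OF _ _ u
      additive_comp[OF additive_comp[OF additive_comp[OF lwhisker_additive lwhisker_additive]
        assoc_additive] rwhisker_additive] additive_rsmult[OF _ r]])
    fix p a assume pa: "p \<in> carrier M" "a \<in> carrier A"
    have "lwhisker R M A (A \<boxtimes>\<^sub>R ring_bimod R) (tensor_right R A (ring_bimod R) r) (tensor_elt R M A p a) =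
        tensor_elt3 R R M A (ring_bimod R) p a r"
      using pa r by (simp add: lwhisker_tensor_right)
    then show "?l (tensor_elt R M A p a) = ?r (tensor_elt R M A p a)"
      using pa r by (simp add: lwhisker_elt unit_swap_elt assoc_elt rwhisker_elt
        right_unit_elt rsmult_elt[OF A] rmod_simps[OF bimodule_rmod[OF M']])
  qed (use r in simp_all)
  show ?thesis
  proof (rule tensor3_ext[OF _ _ _ x
      additive_comp[OF _ rwhisker_additive]
      additive_comp[OF lwhisker_additive]])
    fix b m r assume "b \<in> carrier B" "m \<in> carrier M" "r \<in> carrier (ring_bimod R)"
    then show "?lhs (tensor_elt3 S R B M (ring_bimod R) b m r) =
        ?rhs (tensor_elt3 S R B M (ring_bimod R) b m r)"
      using rlin_smult[OF hom_lin(2)[OF \<alpha>'], of r "tensor_elt S B M b m"]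
      by (simp add: paste_apply extend_map_elt lwhisker_elt right_unit_elt unit rsmult_elt[OF M'])
  qed simp_all
qed

end

section \<open>Identity 1-cells\<close>

text \<open>Moving a scalar past \<open>X \<otimes> Y\<close> one factor at a time is acting with it on \<open>X \<otimes> Y\<close>. The axioms of
  the identity 1-cell thereby reduce to the right linearity of the structure maps.\<close>

lemma unit_swap_pair:
  fixes R :: "'u ring"
  assumes X: "bimodule R R X" and Y: "bimodule R R Y" and r: "r \<in> carrier R"
    and u: "u \<in> carrier (X \<boxtimes>\<^sub>R Y)"
  shows "extend_map R X (ring_bimod R) R (ring_bimod R) X R Y (unit_swap R X)
      (lwhisker R X (Y \<boxtimes>\<^sub>R ring_bimod R) (ring_bimod R \<boxtimes>\<^sub>R Y) (unit_swap R Y)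
        (lwhisker R X Y (Y \<boxtimes>\<^sub>R ring_bimod R) (tensor_right R Y (ring_bimod R) r) u)) =
    tensor_elt R (ring_bimod R) (X \<boxtimes>\<^sub>R Y) \<one>\<^bsub>R\<^esub> (u \<odot>r\<^bsub>X \<boxtimes>\<^sub>R Y\<^esub> r)" (is "?l u = ?r u")
proof -
  have R: "ring R" using X by (rule bimodule_rings)
  interpret R: ring R by fact
  note [simp] = R X Y bimodule_facts[OF X] bimodule_facts[OF Y] r
    rmod_closed[OF bimodule_rmod[OF X]] rmod_closed[OF bimodule_rmod[OF Y]]
  show ?thesis
  proof (rule tensor_ext[OF _ _ u
      additive_comp[OF additive_comp[OF lwhisker_additive lwhisker_additive] extend_map_additive]
      additive_comp[OF additive_rsmult[where R = R] additive_elt_right]])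
    fix x y assume xy: "x \<in> carrier X" "y \<in> carrier Y"
    have "lwhisker R X Y (Y \<boxtimes>\<^sub>R ring_bimod R) (tensor_right R Y (ring_bimod R) r) (tensor_elt R X Y x y) =
      tensor_elt3 R R X Y (ring_bimod R) x y r"
      using xy by (simp add: lwhisker_tensor_right)
    then have "?l (tensor_elt R X Y x y) = lwhisker R (ring_bimod R) X (X \<boxtimes>\<^sub>R Y)
        (tensor_right R X Y (y \<odot>r\<^bsub>Y\<^esub> r)) (tensor_elt R (ring_bimod R) X \<one>\<^bsub>R\<^esub> x)"
      using xy by (simp add: lwhisker_elt unit_swap_elt extend_map_elt rmod_simps[OF bimodule_rmod[OF X]])
    then show "?l (tensor_elt R X Y x y) = ?r (tensor_elt R X Y x y)"
      using xy by (simp add: lwhisker_tensor_right rsmult_elt[OF Y])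
  qed simp_all
qed

lemma unit_swap_hexagon:
  fixes R :: "'u ring"
  assumes A: "bimodule R R A" and C: "bimodule R R C"
    and \<psi>: "\<psi> \<in> bimod_hom R R (C \<boxtimes>\<^sub>R A) (A \<boxtimes>\<^sub>R C)"
    and x: "x \<in> carrier (C \<boxtimes>\<^sub>R (A \<boxtimes>\<^sub>R ring_bimod R))"
  shows "lwhisker R (ring_bimod R) (C \<boxtimes>\<^sub>R A) (A \<boxtimes>\<^sub>R C) \<psi>
      (extend_map R C (ring_bimod R) R (ring_bimod R) C R A (unit_swap R C)
        (lwhisker R C (A \<boxtimes>\<^sub>R ring_bimod R) (ring_bimod R \<boxtimes>\<^sub>R A) (unit_swap R A) x)) =
    extend_map R A (ring_bimod R) R (ring_bimod R) A R C (unit_swap R A)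
      (lwhisker R A (C \<boxtimes>\<^sub>R ring_bimod R) (ring_bimod R \<boxtimes>\<^sub>R C) (unit_swap R C)
        (extend_map R C A R A C R (ring_bimod R) \<psi> x))" (is "?l x = ?r x")
proof -
  have R: "ring R" using A by (rule bimodule_rings)
  interpret R: ring R by fact
  note [simp] = R A C bimodule_facts[OF A] bimodule_facts[OF C]
    rmod_closed[OF bimodule_rmod[OF A]] rmod_closed[OF bimodule_rmod[OF C]]
    hom_lin[OF \<psi>] hom_closed[OF \<psi>]
  show ?thesis
  proof (rule tensor3_ext[OF _ _ _ x
      additive_comp[OF additive_comp[OF lwhisker_additive extend_map_additive] lwhisker_additive]
      additive_comp[OF additive_comp[OF extend_map_additive lwhisker_additive] extend_map_additive]])
    fix c a r assume "c \<in> carrier C" "a \<in> carrier A" "r \<in> carrier (ring_bimod R)"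
    then show "?l (tensor_elt3 R R C A (ring_bimod R) c a r) =
        ?r (tensor_elt3 R R C A (ring_bimod R) c a r)"
      using rlin_smult[OF hom_lin(2)[OF \<psi>], of r "tensor_elt R C A c a"]
      by (simp add: extend_map_elt unit_swap_pair lwhisker_elt unit_swap_elt tensor_right_apply
          rsmult_elt[OF A] rmod_simps[OF bimodule_rmod[OF C]])
  qed simp_all
qed

lemma unit_swap_mult:
  fixes R :: "'u ring"
  assumes A: "bimodule R R A" and \<mu>: "\<mu> \<in> bimod_hom R R (A \<boxtimes>\<^sub>R A) A"
    and x: "x \<in> carrier (A \<boxtimes>\<^sub>R (A \<boxtimes>\<^sub>R ring_bimod R))"
  shows "unit_swap R A (extend_mult R A A A R (ring_bimod R) \<mu> x) =
    lwhisker R (ring_bimod R) (A \<boxtimes>\<^sub>R A) A \<mu>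
      (extend_map R A (ring_bimod R) R (ring_bimod R) A R A (unit_swap R A)
        (lwhisker R A (A \<boxtimes>\<^sub>R ring_bimod R) (ring_bimod R \<boxtimes>\<^sub>R A) (unit_swap R A) x))" (is "?l x = ?r x")
proof -
  have R: "ring R" using A by (rule bimodule_rings)
  interpret R: ring R by fact
  note [simp] = R A bimodule_facts[OF A]
    rmod_closed[OF bimodule_rmod[OF A]] hom_lin[OF \<mu>] hom_closed[OF \<mu>]
  show ?thesis
  proof (rule tensor3_ext[OF _ _ _ x
      additive_comp[OF extend_mult_additive]
      additive_comp[OF additive_comp[OF lwhisker_additive extend_map_additive] lwhisker_additive]])
    fix a b r assume "a \<in> carrier A" "b \<in> carrier A" "r \<in> carrier (ring_bimod R)"
    then show "?l (tensor_elt3 R R A A (ring_bimod R) a b r) =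
        ?r (tensor_elt3 R R A A (ring_bimod R) a b r)"
      using rlin_smult[OF hom_lin(2)[OF \<mu>], of r "tensor_elt R A A a b"]
      by (simp add: extend_map_elt extend_mult_elt lwhisker_elt unit_swap_elt tensor_right_apply
          rsmult_elt[OF A] rmod_simps[OF bimodule_rmod[OF A]])
  qed simp_all
qed

lemma unit_swap_comult:
  fixes R :: "'u ring"
  assumes C: "bimodule R R C" and \<delta>: "\<delta> \<in> bimod_hom R R C (C \<boxtimes>\<^sub>R C)"
    and x: "x \<in> carrier (C \<boxtimes>\<^sub>R ring_bimod R)"
  shows "lwhisker R (ring_bimod R) C (C \<boxtimes>\<^sub>R C) \<delta> (unit_swap R C x) =
    extend_map R C (ring_bimod R) R (ring_bimod R) C R C (unit_swap R C)
      (lwhisker R C (C \<boxtimes>\<^sub>R ring_bimod R) (ring_bimod R \<boxtimes>\<^sub>R C) (unit_swap R C)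
        (extend_comult C R C C R (ring_bimod R) \<delta> x))" (is "?l x = ?r x")
proof -
  have R: "ring R" using C by (rule bimodule_rings)
  interpret R: ring R by fact
  note [simp] = R C bimodule_facts[OF C]
    rmod_closed[OF bimodule_rmod[OF C]] hom_lin[OF \<delta>] hom_closed[OF \<delta>]
  show ?thesis
  proof (rule tensor_ext[OF _ _ x
      additive_comp[OF _ lwhisker_additive]
      additive_comp[OF additive_comp[OF extend_comult_additive lwhisker_additive] extend_map_additive]])
    fix c r assume "c \<in> carrier C" "r \<in> carrier (ring_bimod R)"
    then show "?l (tensor_elt R C (ring_bimod R) c r) = ?r (tensor_elt R C (ring_bimod R) c r)"
      by (simp add: extend_comult_elt unit_swap_pair unit_swap_elt lwhisker_elt
        rlin_smult[OF hom_lin(2)[OF \<delta>]])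
  qed simp_all
qed

lemma unit_swap_counit:
  fixes R :: "'u ring"
  assumes C: "bimodule R R C" and \<epsilon>: "\<epsilon> \<in> bimod_hom R R C (ring_bimod R)"
    and x: "x \<in> carrier (C \<boxtimes>\<^sub>R ring_bimod R)"
  shows "right_unit R (ring_bimod R) (lwhisker R (ring_bimod R) C (ring_bimod R) \<epsilon> (unit_swap R C x)) =
    left_unit R (ring_bimod R) (rwhisker R C (ring_bimod R) (ring_bimod R) \<epsilon> x)" (is "?l x = ?r x")
proof -
  have R: "ring R" using C by (rule bimodule_rings)
  interpret R: ring R by fact
  note [simp] = R C bimodule_facts[OF C]
    rmod_closed[OF bimodule_rmod[OF C]] hom_lin[OF \<epsilon>] hom_closed[OF \<epsilon>, simplified]
  show ?thesis
  proof (rule tensor_ext[OF _ _ x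
      additive_comp[OF additive_comp[OF _ lwhisker_additive] right_unit_additive]
      additive_comp[OF rwhisker_additive left_unit_additive]])
    fix c r assume "c \<in> carrier C" "r \<in> carrier (ring_bimod R)"
    then show "?l (tensor_elt R C (ring_bimod R) c r) = ?r (tensor_elt R C (ring_bimod R) c r)"
      by (simp add: unit_swap_elt lwhisker_elt rwhisker_elt left_unit_elt right_unit_elt
        rlin_smult[OF hom_lin(2)[OF \<epsilon>]])
  qed simp_all
qed

section \<open>The bicategory of entwinings\<close>

lemma entwining_facts:
  assumes "is_entwining X"
  shows "ring (base X)" "bimodule (base X) (base X) (alg X)" "bimodule (base X) (base X) (coalg X)"
    "amult X \<in> bimod_hom (base X) (base X) (alg X \<boxtimes>\<^bsub>base X\<^esub> alg X) (alg X)"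
    "aunit X \<in> bimod_hom (base X) (base X) (ring_bimod (base X)) (alg X)"
    "comult X \<in> bimod_hom (base X) (base X) (coalg X) (coalg X \<boxtimes>\<^bsub>base X\<^esub> coalg X)"
    "counit X \<in> bimod_hom (base X) (base X) (coalg X) (ring_bimod (base X))"
    "entw_map X \<in> bimod_hom (base X) (base X) (coalg X \<boxtimes>\<^bsub>base X\<^esub> alg X) (alg X \<boxtimes>\<^bsub>base X\<^esub> coalg X)"
  using assms unfolding is_entwining_def is_R_ring_def is_R_coring_def is_entwining_map_def by auto

lemmas entwining_modules [simp] =
  bimodule_facts[OF entwining_facts(2)] bimodule_facts[OF entwining_facts(3)] entwining_facts(1-3)

text \<open>Every associativity isomorphism in the conditions on a 1-cell is part of an extended map. The
  triangle for the unit is evaluated at \<open>\<one> \<otimes> m\<close>.\<close>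

lemma entw_one_cells_iff:
  fixes X Y :: "'u entwining"
  assumes X: "is_entwining X" and Y: "is_entwining Y"
  shows "F \<in> entw_one_cells X Y \<longleftrightarrow>
    (let R = base X; A = alg X; C = coalg X; S = base Y; B = alg Y; D = coalg Y;
         M = cmod F; \<alpha> = calg F; \<gamma> = ccoalg F
     in bimodule S R M \<and>
        \<alpha> \<in> bimod_hom S R (B \<boxtimes>\<^sub>S M) (M \<boxtimes>\<^sub>R A) \<and> \<gamma> \<in> bimod_hom S R (D \<boxtimes>\<^sub>S M) (M \<boxtimes>\<^sub>R C) \<and>
        (\<forall>x \<in> carrier (D \<boxtimes>\<^sub>S (B \<boxtimes>\<^sub>S M)).
          lwhisker R M (C \<boxtimes>\<^sub>R A) (A \<boxtimes>\<^sub>R C) (entw_map X)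
            (extend_map S D M R M C R A \<gamma> (lwhisker S D (B \<boxtimes>\<^sub>S M) (M \<boxtimes>\<^sub>R A) \<alpha> x)) =
          extend_map S B M R M A R C \<alpha> (lwhisker S B (D \<boxtimes>\<^sub>S M) (M \<boxtimes>\<^sub>R C) \<gamma>
            (extend_map S D B S B D S M (entw_map Y) x))) \<and>
        (\<forall>x \<in> carrier (B \<boxtimes>\<^sub>S (B \<boxtimes>\<^sub>S M)).
          \<alpha> (extend_mult S B B B S M (amult Y) x) =
          lwhisker R M (A \<boxtimes>\<^sub>R A) A (amult X)
            (extend_map S B M R M A R A \<alpha> (lwhisker S B (B \<boxtimes>\<^sub>S M) (M \<boxtimes>\<^sub>R A) \<alpha> x))) \<and>
        (\<forall>m \<in> carrier M. \<alpha> (tensor_elt S B M (aunit Y \<one>\<^bsub>S\<^esub>) m) = tensor_elt R M A m (aunit X \<one>\<^bsub>R\<^esub>)) \<and>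
        (\<forall>x \<in> carrier (D \<boxtimes>\<^sub>S M).
          lwhisker R M C (C \<boxtimes>\<^sub>R C) (comult X) (\<gamma> x) =
          extend_map S D M R M C R C \<gamma> (lwhisker S D (D \<boxtimes>\<^sub>S M) (M \<boxtimes>\<^sub>R C) \<gamma>
            (extend_comult D S D D S M (comult Y) x))) \<and>
        (\<forall>x \<in> carrier (D \<boxtimes>\<^sub>S M).
          right_unit R M (lwhisker R M C (ring_bimod R) (counit X) (\<gamma> x)) =
          left_unit S M (rwhisker S D (ring_bimod S) M (counit Y) x)))"
proof (cases "bimodule (base Y) (base X) (cmod F)")
  case True
  interpret RX: ring "base X" using entwining_facts(1)[OF X] .
  interpret RY: ring "base Y" using entwining_facts(1)[OF Y] .
  note [simp] = X Y True bimodule_facts[OF True]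
    hom_lin[OF entwining_facts(5)[OF X]] hom_lin[OF entwining_facts(5)[OF Y]]
    hom_closed[OF entwining_facts(5)[OF X], simplified] hom_closed[OF entwining_facts(5)[OF Y], simplified]
  show ?thesis
    by (simp add: entw_one_cells_def hexagon_cond_def alg_conds_def coalg_conds_def Let_def
      extend_map_def extend_mult_def extend_comult_def left_unit_inv_def right_unit_inv_def
      rwhisker_elt lwhisker_elt)
qed (simp add: entw_one_cells_def)

lemma entw_two_cells_iff:
  fixes X Y :: "'u entwining"
  shows "\<theta> \<in> entw_two_cells X Y F G \<longleftrightarrow>
    \<theta> \<in> bimod_hom (base Y) (base X) (cmod F) (cmod G) \<and>
    (\<forall>x \<in> carrier (alg Y \<boxtimes>\<^bsub>base Y\<^esub> cmod F).
      rwhisker (base X) (cmod F) (cmod G) (alg X) \<theta> (calg F x) =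
      calg G (lwhisker (base Y) (alg Y) (cmod F) (cmod G) \<theta> x)) \<and>
    (\<forall>x \<in> carrier (coalg Y \<boxtimes>\<^bsub>base Y\<^esub> cmod F).
      rwhisker (base X) (cmod F) (cmod G) (coalg X) \<theta> (ccoalg F x) =
      ccoalg G (lwhisker (base Y) (coalg Y) (cmod F) (cmod G) \<theta> x))"
  by (simp add: entw_two_cells_def Let_def)

lemma entw_comp1_sel [simp]:
  "cmod (entw_comp1 X Y Z G F) = cmod G \<boxtimes>\<^bsub>base Y\<^esub> cmod F"
  "calg (entw_comp1 X Y Z G F) = paste (base X) (base Y) (base Z) (alg X) (alg Y) (alg Z)
    (cmod G) (cmod F) (calg G) (calg F)"
  "ccoalg (entw_comp1 X Y Z G F) = paste (base X) (base Y) (base Z) (coalg X) (coalg Y) (coalg Z)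
    (cmod G) (cmod F) (ccoalg G) (ccoalg F)"
  by (simp_all add: entw_comp1_def)

lemma entw_id1_sel [simp]:
  "cmod (entw_id1 X) = ring_bimod (base X)"
  "calg (entw_id1 X) = unit_swap (base X) (alg X)"
  "ccoalg (entw_id1 X) = unit_swap (base X) (coalg X)"
  by (simp_all add: entw_id1_def unit_swap_def)

lemmas entw_one_cell_conditions = entw_one_cells_iff[THEN iffD1, unfolded Let_def]

lemma entw_one_cellD:
  assumes "F \<in> entw_one_cells X Y"
  shows "bimodule (base Y) (base X) (cmod F)"
    "calg F \<in> bimod_hom (base Y) (base X) (alg Y \<boxtimes>\<^bsub>base Y\<^esub> cmod F) (cmod F \<boxtimes>\<^bsub>base X\<^esub> alg X)"
    "ccoalg F \<in> bimod_hom (base Y) (base X) (coalg Y \<boxtimes>\<^bsub>base Y\<^esub> cmod F) (cmod F \<boxtimes>\<^bsub>base X\<^esub> coalg X)"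
  using assms by (auto simp: entw_one_cells_def)

lemma entw_pasting:
  fixes X Y Z :: "'u entwining"
  assumes X: "is_entwining X" and Y: "is_entwining Y" and Z: "is_entwining Z"
    and F: "F \<in> entw_one_cells X Y" and G: "G \<in> entw_one_cells Y Z"
  shows "pasting (base X) (base Y) (base Z) (alg X) (alg Y) (alg Z) (cmod G) (cmod F) (calg G) (calg F)"
    and "pasting (base X) (base Y) (base Z) (coalg X) (coalg Y) (coalg Z) (cmod G) (cmod F)
      (ccoalg G) (ccoalg F)"
  by (intro pasting.intro pasting_axioms.intro universe_axioms entwining_facts assms entw_one_cellD)+

lemma entw_comp1_closed:
  fixes X Y Z :: "'u entwining"
  assumes X: "is_entwining X" and Y: "is_entwining Y" and Z: "is_entwining Z"
    and F: "F \<in> entw_one_cells X Y" and G: "G \<in> entw_one_cells Y Z"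
  shows "entw_comp1 X Y Z G F \<in> entw_one_cells X Z"
proof -
  interpret alg: pasting type_of_universe "base X" "base Y" "base Z" "alg X" "alg Y" "alg Z"
    "cmod G" "cmod F" "calg G" "calg F"
    using assms by (rule entw_pasting)
  interpret coalg: pasting type_of_universe "base X" "base Y" "base Z" "coalg X" "coalg Y" "coalg Z"
    "cmod G" "cmod F" "ccoalg G" "ccoalg F"
    using assms by (rule entw_pasting)
  note F' = entw_one_cell_conditions[OF X Y F] and G' = entw_one_cell_conditions[OF Y Z G]
  interpret pasting_pair type_of_universe "base X" "base Y" "base Z" "alg X" "alg Y" "alg Z"
    "coalg X" "coalg Y" "coalg Z" "cmod G" "cmod F" "calg G" "calg F" "ccoalg G" "ccoalg F"
    "entw_map X" "entw_map Y" "entw_map Z"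
    by (intro pasting_pair.intro pasting_pair_axioms.intro alg.pasting_axioms coalg.pasting_axioms
      universe_axioms entwining_facts X Y Z) (use F' G' in blast)+
  have unit: "aunit W \<one>\<^bsub>base W\<^esub> \<in> carrier (alg W)" if "is_entwining W" for W :: "'u entwining"
  proof -
    interpret ring "base W" using entwining_facts(1)[OF that] .
    show ?thesis using hom_closed[OF entwining_facts(5)[OF that]] by simp
  qed
  note mult = alg.paste_mult[OF entwining_facts(4)[OF X] entwining_facts(4)[OF Y] entwining_facts(4)[OF Z]]
  note unit = alg.paste_unit[OF unit[OF X] unit[OF Y] unit[OF Z]]
  note comult = coalg.paste_comult[OF entwining_facts(6)[OF X] entwining_facts(6)[OF Y] entwining_facts(6)[OF Z]]
  note counit = coalg.paste_counit[OF entwining_facts(7)[OF X] entwining_facts(7)[OF Y] entwining_facts(7)[OF Z]]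
  show ?thesis
    unfolding entw_one_cells_iff[OF X Z] entw_comp1_sel Let_def
    by (intro conjI ballI bimodule_tensor alg.paste_hom coalg.paste_hom paste_hexagon mult unit comult
      counit entw_one_cellD[OF F] entw_one_cellD[OF G])
      (use F' G' in blast)+
qed

lemma entw_id1_closed:
  fixes X :: "'u entwining"
  assumes X: "is_entwining X"
  shows "entw_id1 X \<in> entw_one_cells X X"
proof -
  note facts = entwining_facts[OF X]
  interpret ring "base X" by (rule facts)
  have "unit_swap (base X) (alg X) (tensor_elt (base X) (alg X) (ring_bimod (base X)) (aunit X \<one>\<^bsub>base X\<^esub>) r) =
      tensor_elt (base X) (ring_bimod (base X)) (alg X) r (aunit X \<one>\<^bsub>base X\<^esub>)"
    if r: "r \<in> carrier (base X)" for r
  proof -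
    have "aunit X \<one>\<^bsub>base X\<^esub> \<odot>r\<^bsub>alg X\<^esub> r = aunit X r" "r \<odot>\<^bsub>alg X\<^esub> aunit X \<one>\<^bsub>base X\<^esub> = aunit X r"
      using llin_smult[OF hom_lin(1)[OF facts(5)], of r "\<one>\<^bsub>base X\<^esub>"]
        rlin_smult[OF hom_lin(2)[OF facts(5)], of r "\<one>\<^bsub>base X\<^esub>"] r by simp_all
    moreover have "aunit X \<one>\<^bsub>base X\<^esub> \<in> carrier (alg X)"
      using hom_closed[OF facts(5)] by simp
    ultimately show ?thesis
      using r elt_balanced[of "\<one>\<^bsub>base X\<^esub>" "ring_bimod (base X)" r "base X" "aunit X \<one>\<^bsub>base X\<^esub>" "alg X"]
      by (simp add: unit_swap_elt[OF facts(2)])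
  qed
  then show ?thesis
    unfolding entw_one_cells_iff[OF X X] entw_id1_sel Let_def
    using facts
    by (simp add: unit_swap_hom unit_swap_hexagon unit_swap_mult unit_swap_comult unit_swap_counit)
qed

lemma entw_id2_closed:
  fixes X Y :: "'u entwining"
  assumes X: "is_entwining X" and Y: "is_entwining Y" and F: "F \<in> entw_one_cells X Y"
  shows "id_map (cmod F) \<in> entw_two_cells X Y F F"
proof -
  note [simp] = bimodule_facts[OF entw_one_cellD(1)[OF F]] X Y
    hom_closed[OF entw_one_cellD(2)[OF F]] hom_closed[OF entw_one_cellD(3)[OF F]]
  show ?thesis
    by (simp add: entw_two_cells_iff id_map_hom[OF entw_one_cellD(1)[OF F]] lwhisker_id rwhisker_id
      id_map_apply)
qed

lemma entw_vcomp_closed: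
  fixes X Y :: "'u entwining"
  assumes X: "is_entwining X" and Y: "is_entwining Y" and F: "F \<in> entw_one_cells X Y"
    and G: "G \<in> entw_one_cells X Y" and H: "H \<in> entw_one_cells X Y"
    and \<theta>: "\<theta> \<in> entw_two_cells X Y F G" and \<theta>': "\<theta>' \<in> entw_two_cells X Y G H"
  shows "compose (carrier (cmod F)) \<theta>' \<theta> \<in> entw_two_cells X Y F H"
proof -
  have homs: "\<theta> \<in> bimod_hom (base Y) (base X) (cmod F) (cmod G)"
      "\<theta>' \<in> bimod_hom (base Y) (base X) (cmod G) (cmod H)"
    using \<theta> \<theta>' by (auto simp: entw_two_cells_iff)
  note [simp] = bimodule_facts[OF entw_one_cellD(1)[OF F]] bimodule_facts[OF entw_one_cellD(1)[OF G]]
    bimodule_facts[OF entw_one_cellD(1)[OF H]] X Y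
    hom_closed[OF entw_one_cellD(2)[OF F]] hom_closed[OF entw_one_cellD(3)[OF F]]
    hom_lin[OF homs(1)] hom_lin[OF homs(2)]
  have l: "lwhisker (base Y) B (cmod F) (cmod H) (compose (carrier (cmod F)) \<theta>' \<theta>) x =
      lwhisker (base Y) B (cmod G) (cmod H) \<theta>' (lwhisker (base Y) B (cmod F) (cmod G) \<theta> x)"
    if "rmod (base Y) B" "x \<in> carrier (B \<boxtimes>\<^bsub>base Y\<^esub> cmod F)" for B x
    using that lwhisker_cong[of "cmod F" "compose (carrier (cmod F)) \<theta>' \<theta>" "\<lambda>m. \<theta>' (\<theta> m)"]
    by (simp add: lwhisker_comp compose_eq)
  have r: "rwhisker (base X) (cmod F) (cmod H) A (compose (carrier (cmod F)) \<theta>' \<theta>) x =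
      rwhisker (base X) (cmod G) (cmod H) A \<theta>' (rwhisker (base X) (cmod F) (cmod G) A \<theta> x)"
    if "lmod (base X) A" "x \<in> carrier (cmod F \<boxtimes>\<^bsub>base X\<^esub> A)" for A x
    using that rwhisker_cong[of "cmod F" "compose (carrier (cmod F)) \<theta>' \<theta>" "\<lambda>m. \<theta>' (\<theta> m)"]
    by (simp add: rwhisker_comp compose_eq)
  show ?thesis
    using \<theta> \<theta>' by (simp add: entw_two_cells_iff compose_hom[OF entw_one_cellD(1)[OF F] homs] l r)
qed

lemma entw_hcomp_closed:
  fixes X Y Z :: "'u entwining"
  assumes X: "is_entwining X" and Y: "is_entwining Y" and Z: "is_entwining Z"
    and F: "F \<in> entw_one_cells X Y" "F' \<in> entw_one_cells X Y"
    and G: "G \<in> entw_one_cells Y Z" "G' \<in> entw_one_cells Y Z"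
    and \<theta>: "\<theta> \<in> entw_two_cells X Y F F'" and \<eta>: "\<eta> \<in> entw_two_cells Y Z G G'"
  shows "tensor_map (base Y) (cmod G) (cmod G') (cmod F) (cmod F') \<eta> \<theta> \<in>
    entw_two_cells X Z (entw_comp1 X Y Z G F) (entw_comp1 X Y Z G' F')"
  using \<theta> \<eta> entw_one_cellD[OF F(1)] entw_one_cellD[OF F(2)] entw_one_cellD[OF G(1)]
    entw_one_cellD[OF G(2)]
    paste_two_cell[OF entw_pasting(1)[OF X Y Z F(1) G(1)] entw_pasting(1)[OF X Y Z F(2) G(2)], of \<eta> \<theta>]
    paste_two_cell[OF entw_pasting(2)[OF X Y Z F(1) G(1)] entw_pasting(2)[OF X Y Z F(2) G(2)], of \<eta> \<theta>]
  unfolding entw_two_cells_iff entw_comp1_sel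
  by (intro conjI ballI tensor_map_hom) blast+

text \<open>Composing the squares of \<open>\<theta>\<close> with its inverse on both sides gives the squares of the inverse.\<close>

lemma entw_two_cells_inverse:
  fixes X Y :: "'u entwining"
  assumes X: "is_entwining X" and Y: "is_entwining Y" and F: "F \<in> entw_one_cells X Y"
    and G: "G \<in> entw_one_cells X Y" and \<theta>: "\<theta> \<in> entw_two_cells X Y F G"
    and \<theta>': "\<theta>' \<in> bimod_hom (base Y) (base X) (cmod G) (cmod F)"
    and inv: "\<And>x. x \<in> carrier (cmod F) \<Longrightarrow> \<theta>' (\<theta> x) = x" "\<And>x. x \<in> carrier (cmod G) \<Longrightarrow> \<theta> (\<theta>' x) = x"
  shows "\<theta>' \<in> entw_two_cells X Y G F"
proof -
  have hom: "\<theta> \<in> bimod_hom (base Y) (base X) (cmod F) (cmod G)"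
    using \<theta> by (simp add: entw_two_cells_iff)
  note [simp] = bimodule_facts[OF entw_one_cellD(1)[OF F]] bimodule_facts[OF entw_one_cellD(1)[OF G]]
    X Y
    hom_lin[OF hom] hom_lin[OF \<theta>']
  have l: "lwhisker (base Y) B (cmod F) (cmod G) \<theta> (lwhisker (base Y) B (cmod G) (cmod F) \<theta>' x) = x"
    if "rmod (base Y) B" "x \<in> carrier (B \<boxtimes>\<^bsub>base Y\<^esub> cmod G)" for B x
    using that by (simp add: lwhisker_comp lwhisker_id inv)
  have r: "rwhisker (base X) (cmod G) (cmod F) A \<theta>' (rwhisker (base X) (cmod F) (cmod G) A \<theta> x) = x"
    if "lmod (base X) A" "x \<in> carrier (cmod F \<boxtimes>\<^bsub>base X\<^esub> A)" for A x
    using that by (simp add: rwhisker_comp rwhisker_id inv)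
  have square: "rwhisker (base X) (cmod G) (cmod F) A \<theta>' (\<beta> x) =
      \<alpha> (lwhisker (base Y) B (cmod G) (cmod F) \<theta>' x)"
    if "rmod (base Y) B" "lmod (base X) A" "x \<in> carrier (B \<boxtimes>\<^bsub>base Y\<^esub> cmod G)"
      and sq: "\<And>x. x \<in> carrier (B \<boxtimes>\<^bsub>base Y\<^esub> cmod F) \<Longrightarrow>
        rwhisker (base X) (cmod F) (cmod G) A \<theta> (\<alpha> x) =
        \<beta> (lwhisker (base Y) B (cmod F) (cmod G) \<theta> x)"
      and \<alpha>: "\<And>x. x \<in> carrier (B \<boxtimes>\<^bsub>base Y\<^esub> cmod F) \<Longrightarrow> \<alpha> x \<in> carrier (cmod F \<boxtimes>\<^bsub>base X\<^esub> A)"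
    for A B \<alpha> \<beta> x
  proof -
    let ?y = "lwhisker (base Y) B (cmod G) (cmod F) \<theta>' x"
    have y: "?y \<in> carrier (B \<boxtimes>\<^bsub>base Y\<^esub> cmod F)" using that by simp
    have "\<beta> x = rwhisker (base X) (cmod F) (cmod G) A \<theta> (\<alpha> ?y)"
      using sq[OF y] l[OF that(1,3)] by simp
    then show ?thesis using r[OF that(2) \<alpha>[OF y]] by simp
  qed
  show ?thesis
    unfolding entw_two_cells_iff
    using \<theta>' \<theta>[unfolded entw_two_cells_iff] hom_closed[OF entw_one_cellD(2)[OF F]]
      hom_closed[OF entw_one_cellD(3)[OF F]]
    by (intro conjI ballI square) auto
qed

lemma entw_assoc_closed:
  fixes W X Y Z :: "'u entwining"
  assumes cells: "is_entwining W" "is_entwining X" "is_entwining Y" "is_entwining Z"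
    and F: "F \<in> entw_one_cells W X" and G: "G \<in> entw_one_cells X Y" and H: "H \<in> entw_one_cells Y Z"
  shows "tensor_assoc (base Y) (base X) (cmod H) (cmod G) (cmod F) \<in>
    entw_two_cells W Z (entw_comp1 W Y Z H (entw_comp1 W X Y G F))
      (entw_comp1 W X Z (entw_comp1 X Y Z H G) F)"
  unfolding entw_two_cells_iff entw_comp1_sel
  using assoc_hom(1)[OF entw_one_cellD(1)[OF H] entw_one_cellD(1)[OF G] entw_one_cellD(1)[OF F]]
    paste_assoc[OF entw_pasting(1)[OF cells(1-3) F G] entw_pasting(1)[OF cells(2-4) G H]]
    paste_assoc[OF entw_pasting(2)[OF cells(1-3) F G] entw_pasting(2)[OF cells(2-4) G H]]
  by blast

lemma entw_unit_closed:
  fixes X Y :: "'u entwining"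
  assumes X: "is_entwining X" and Y: "is_entwining Y" and F: "F \<in> entw_one_cells X Y"
  shows "left_unit (base Y) (cmod F) \<in> entw_two_cells X Y (entw_comp1 X Y Y (entw_id1 Y) F) F"
    and "right_unit (base X) (cmod F) \<in> entw_two_cells X Y (entw_comp1 X X Y F (entw_id1 X)) F"
  unfolding entw_two_cells_iff entw_comp1_sel entw_id1_sel
  using unit_hom[OF entw_one_cellD(1)[OF F]] entwining_facts[OF X] entwining_facts[OF Y]
    entw_one_cellD[OF F]
  by (simp_all add: paste_left_unit paste_right_unit)

lemma entw_simps:
  "zero_cells entw = {X. is_entwining X}" "one_cells entw = entw_one_cells"
  "two_cells entw = entw_two_cells" "id1 entw = entw_id1" "comp1 entw = entw_comp1"
  "id2 entw X Y F = id2 Bim (base X) (base Y) (cmod F)"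
  "vcomp entw X Y F G H = vcomp Bim (base X) (base Y) (cmod F) (cmod G) (cmod H)"
  "hcomp entw X Y Z G G' F F' =
    hcomp Bim (base X) (base Y) (base Z) (cmod G) (cmod G') (cmod F) (cmod F')"
  "assoc2 entw W X Y Z H G F =
    assoc2 Bim (base W) (base X) (base Y) (base Z) (cmod H) (cmod G) (cmod F)"
  "lunit2 entw X Y F = lunit2 Bim (base X) (base Y) (cmod F)"
  "runit2 entw X Y F = runit2 Bim (base X) (base Y) (cmod F)"
  by (simp_all add: entw_def)

lemma entw_underlying:
  fixes X Y :: "'u entwining"
  shows "is_entwining X \<Longrightarrow> base X \<in> zero_cells Bim"
    and "F \<in> entw_one_cells X Y \<Longrightarrow> cmod F \<in> one_cells Bim (base X) (base Y)"
    and "\<theta> \<in> entw_two_cells X Y F G \<Longrightarrow> \<theta> \<in> two_cells Bim (base X) (base Y) (cmod F) (cmod G)"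
    and "cmod (entw_comp1 X Y Z G F) = comp1 Bim (base X) (base Y) (base Z) (cmod G) (cmod F)"
    and "cmod (entw_id1 X) = id1 Bim (base X)"
  by (simp_all add: is_entwining_def entw_one_cells_def entw_two_cells_iff)

lemma entw_iso2:
  fixes X Y :: "'u entwining"
  assumes X: "is_entwining X" and Y: "is_entwining Y" and F: "F \<in> entw_one_cells X Y"
    and G: "G \<in> entw_one_cells X Y" and \<theta>: "\<theta> \<in> entw_two_cells X Y F G"
    and iso: "iso2 Bim (base X) (base Y) (cmod F) (cmod G) \<theta>"
  shows "iso2 entw X Y F G \<theta>"
proof -
  obtain \<theta>' where \<theta>': "\<theta>' \<in> bimod_hom (base Y) (base X) (cmod G) (cmod F)"
    and inv: "compose (carrier (cmod F)) \<theta>' \<theta> = id_map (cmod F)"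
      "compose (carrier (cmod G)) \<theta> \<theta>' = id_map (cmod G)"
    using iso by (auto simp: iso2_def)
  have "\<theta>' (\<theta> x) = x" if "x \<in> carrier (cmod F)" for x
    using fun_cong[OF inv(1), of x] that by (simp add: compose_eq id_map_apply)
  moreover have "\<theta> (\<theta>' x) = x" if "x \<in> carrier (cmod G)" for x
    using fun_cong[OF inv(2), of x] that by (simp add: compose_eq id_map_apply)
  ultimately have "\<theta>' \<in> entw_two_cells X Y G F"
    by (intro entw_two_cells_inverse[OF X Y F G \<theta> \<theta>'])
  then show ?thesis
    using \<theta> inv by (auto simp: iso2_def entw_simps)
qed

text \<open>
  The operations of \<open>entw\<close> on 2-cells are those of \<open>Bim\<close>, so that its equations are instances of those
  in \<open>Bim\<close>. What remains is that the cells of \<open>entw\<close> are closed under the operations and contain the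
  coherence isomorphisms with their inverses.
\<close>

theorem bicategory_entw: "bicategory (entw :: ('u entwining, 'u entw_cell, 'u \<Rightarrow> 'u) bicat)"
proof -
  interpret Bim: bicategory "Bim :: ('u ring, 'u bimod, 'u \<Rightarrow> 'u) bicat"
    by (rule bicategory_Bim)
  note closed = entw_id1_closed entw_comp1_closed
  show ?thesis
  proof (rule bicategory.intro; (simp only: entw_simps mem_Collect_eq entw_underlying(4,5))?)
    fix X Y :: "'u entwining" and F G H \<theta> \<theta>'
    assume XY: "is_entwining X" "is_entwining Y" and F: "F \<in> entw_one_cells X Y"
    show "id2 Bim (base X) (base Y) (cmod F) \<in> entw_two_cells X Y F F"
      using entw_id2_closed[OF XY F] by simp
    assume G: "G \<in> entw_one_cells X Y" and \<theta>: "\<theta> \<in> entw_two_cells X Y F G"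
    assume H: "H \<in> entw_one_cells X Y" and \<theta>': "\<theta>' \<in> entw_two_cells X Y G H"
    show "vcomp Bim (base X) (base Y) (cmod F) (cmod G) (cmod H) \<theta>' \<theta> \<in> entw_two_cells X Y F H"
      using entw_vcomp_closed[OF XY F G H \<theta> \<theta>'] by simp
  next
    fix X :: "'u entwining" assume "is_entwining X"
    then show "entw_id1 X \<in> entw_one_cells X X" by (rule entw_id1_closed)
  next
    fix X Y Z :: "'u entwining" and F F' G G' \<theta> \<eta>
    assume XYZ: "is_entwining X" "is_entwining Y" "is_entwining Z"
      and F: "F \<in> entw_one_cells X Y" and G: "G \<in> entw_one_cells Y Z"
    show "entw_comp1 X Y Z G F \<in> entw_one_cells X Z"
      using XYZ F G by (rule entw_comp1_closed)
    assume F': "F' \<in> entw_one_cells X Y" and G': "G' \<in> entw_one_cells Y Z"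
      and \<theta>: "\<theta> \<in> entw_two_cells X Y F F'" and \<eta>: "\<eta> \<in> entw_two_cells Y Z G G'"
    show "hcomp Bim (base X) (base Y) (base Z) (cmod G) (cmod G') (cmod F) (cmod F') \<eta> \<theta>
        \<in> entw_two_cells X Z (entw_comp1 X Y Z G F) (entw_comp1 X Y Z G' F')"
      using entw_hcomp_closed[OF XYZ F F' G G' \<theta> \<eta>] by simp
  next
    fix W X Y Z :: "'u entwining" and F G H
    assume cells: "is_entwining W" "is_entwining X" "is_entwining Y" "is_entwining Z"
      and F: "F \<in> entw_one_cells W X" and G: "G \<in> entw_one_cells X Y" and H: "H \<in> entw_one_cells Y Z"
    show "iso2 entw W Z (entw_comp1 W Y Z H (entw_comp1 W X Y G F))
        (entw_comp1 W X Z (entw_comp1 X Y Z H G) F)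
        (assoc2 Bim (base W) (base X) (base Y) (base Z) (cmod H) (cmod G) (cmod F))"
    proof (rule entw_iso2)
      show "assoc2 Bim (base W) (base X) (base Y) (base Z) (cmod H) (cmod G) (cmod F) \<in>
          entw_two_cells W Z (entw_comp1 W Y Z H (entw_comp1 W X Y G F))
            (entw_comp1 W X Z (entw_comp1 X Y Z H G) F)"
        using entw_assoc_closed[OF cells F G H] by simp
    qed (simp_all only: entw_underlying(4),
        (rule Bim.assoc2_iso entw_comp1_closed entw_underlying cells F G H)+)
  next
    fix X Y :: "'u entwining" and F
    assume XY: "is_entwining X" "is_entwining Y" and F: "F \<in> entw_one_cells X Y"
    show "iso2 entw X Y (entw_comp1 X Y Y (entw_id1 Y) F) F (lunit2 Bim (base X) (base Y) (cmod F))"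
    proof (rule entw_iso2)
      show "lunit2 Bim (base X) (base Y) (cmod F) \<in> entw_two_cells X Y (entw_comp1 X Y Y (entw_id1 Y) F) F"
        using entw_unit_closed(1)[OF XY F] by simp
    qed (simp_all only: entw_underlying(4,5),
        (rule Bim.lunit2_iso entw_comp1_closed entw_id1_closed entw_underlying XY F)+)
    show "iso2 entw X Y (entw_comp1 X X Y F (entw_id1 X)) F (runit2 Bim (base X) (base Y) (cmod F))"
    proof (rule entw_iso2)
      show "runit2 Bim (base X) (base Y) (cmod F) \<in> entw_two_cells X Y (entw_comp1 X X Y F (entw_id1 X)) F"
        using entw_unit_closed(2)[OF XY F] by simp
    qed (simp_all only: entw_underlying(4,5),
        (rule Bim.runit2_iso entw_comp1_closed entw_id1_closed entw_underlying XY F)+)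
  qed ((rule Bim.vcomp_id_left Bim.vcomp_id_right Bim.vcomp_assoc Bim.hcomp_id Bim.interchange
      Bim.assoc2_natural Bim.lunit2_natural Bim.runit2_natural Bim.pentagon Bim.triangle;
      erule entw_underlying)+)
qed

end

text \<open>All axioms are universally quantified over 0-cells, so they restrict to a full sub-bicategory.\<close>

lemma bicategory_full:
  assumes "bicategory B" and Z: "Z \<subseteq> zero_cells B"
  shows "bicategory (B\<lparr>zero_cells := Z\<rparr>)"
proof -
  interpret bicategory B by fact
  have sel: "zero_cells (B\<lparr>zero_cells := Z\<rparr>) = Z" "one_cells (B\<lparr>zero_cells := Z\<rparr>) = one_cells B"
    "two_cells (B\<lparr>zero_cells := Z\<rparr>) = two_cells B" "id1 (B\<lparr>zero_cells := Z\<rparr>) = id1 B"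
    "comp1 (B\<lparr>zero_cells := Z\<rparr>) = comp1 B" "id2 (B\<lparr>zero_cells := Z\<rparr>) = id2 B"
    "vcomp (B\<lparr>zero_cells := Z\<rparr>) = vcomp B" "hcomp (B\<lparr>zero_cells := Z\<rparr>) = hcomp B"
    "assoc2 (B\<lparr>zero_cells := Z\<rparr>) = assoc2 B" "lunit2 (B\<lparr>zero_cells := Z\<rparr>) = lunit2 B"
    "runit2 (B\<lparr>zero_cells := Z\<rparr>) = runit2 B"
    by simp_all
  then have iso: "iso2 (B\<lparr>zero_cells := Z\<rparr>) = iso2 B"
    by (simp add: iso2_def fun_eq_iff)
  show ?thesis
    by (rule bicategory.intro; simp only: sel iso;
        (rule id2_closed vcomp_closed vcomp_id_left vcomp_id_right vcomp_assoc id1_closed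
          comp1_closed hcomp_closed hcomp_id interchange assoc2_iso assoc2_natural lunit2_iso
          lunit2_natural runit2_iso runit2_natural pentagon triangle;
          (rule subsetD[OF Z])?; assumption))
qed

theorem mainTheorem1:
  assumes "infinite (UNIV :: 'u set)"
  shows "bicategory (entw_comm :: ('u entwining, 'u entw_cell, 'u \<Rightarrow> 'u) bicat) \<and>
         bicategory (entw :: ('u entwining, 'u entw_cell, 'u \<Rightarrow> 'u) bicat)"
proof -
  interpret universe "TYPE('u)" by (rule universe.intro) fact
  have "is_entwining X" if "is_comm_entwining X" for X :: "'u entwining"
    using that unfolding is_comm_entwining_def is_entwining_def is_R_algebra_def is_R_coalgebra_def
    by (auto simp: cring_def)
  then have "{X. is_comm_entwining X} \<subseteq> zero_cells (entw :: ('u entwining, 'u entw_cell, 'u \<Rightarrow> 'u) bicat)"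
    by (auto simp: entw_simps)
  then show ?thesis
    unfolding entw_comm_def by (intro conjI bicategory_full bicategory_entw)
qed

end
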